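(* Let $d\ge 3$ and $2\le n_1\le n_2\le\dots\le n_d$ be integers. The algorithm $\mathcal{A}$ described in the context is a deterministic polynomial-time algorithm that approximates the tensor spectral norm $\|\mathcal{T}\|_\sigma$ with a worst-case approximation bound $0.3^{d-2}\left(\prod_{k=1}^{d-2}\frac{\ln n_k}{n_k}\right)^{\frac12}$ for any $\mathcal{T}\in\mathbb{R}^{n_1\times n_2\times\dots\times n_d}$; i.e., for any such $\mathcal{T}$ it finds $\mathbf{z}_k\in\mathbb{H}_5^{n_k}(2+\sqrt5,3+\sqrt5)$ for $k=1,\dots,d-2$ and $\mathbf{z}_k\in\mathbb{S}^{n_k}$ for $k=d-1,d$ such that $$0.3^{d-2}\left(\prod_{k=1}^{d-2}\frac{\ln n_k}{n_k}\right)^{\frac12}\|\mathcal{T}\|_\sigma\le \mathcal{T}(\mathbf{z}_1,\mathbf{z}_2,\dots,\mathbf{z}_d)\le\|\mathcal{T}\|_\sigma .$$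
   Context: $\|\cdot\|$ on vectors is the Euclidean norm and $\mathbb{S}^n=\{\mathbf{x}\in\mathbb{R}^n:\|\mathbf{x}\|=1\}$ (so $\mathbb S^0=\emptyset$). For $\mathcal{T}=(t_{i_1\dots i_d})\in\mathbb{R}^{n_1\times\dots\times n_d}$ and $\mathbf{x}_k\in\mathbb{R}^{n_k}$, $$\mathcal{T}(\mathbf{x}_1,\dots,\mathbf{x}_d)=\sum_{i_1=1}^{n_1}\cdots\sum_{i_d=1}^{n_d}t_{i_1\dots i_d}(x_1)_{i_1}\cdots(x_d)_{i_d},$$ and the spectral norm is $\|\mathcal{T}\|_\sigma=\max\{\mathcal{T}(\mathbf{x}_1,\dots,\mathbf{x}_d):\mathbf{x}_k\in\mathbb{S}^{n_k},\ k=1,\dots,d\}$. A tensor norm $\|\cdot\|_\omega$ is approximated with approximation bound $\tau\in(0,1]$ by a polynomial-time algorithm if, for any tensor $\mathcal{T}$ in the concerned space, the algorithm computes a quantity $\omega_{\mathcal{T}}$ with $\tau\|\mathcal{T}\|_\omega\le\omega_{\mathcal{T}}\le\|\mathcal{T}\|_\omega$. Definition of $\mathbb{H}_3^n(\alpha,\beta)$ for an integer $n\ge1$, $\alpha\ge1$, $\beta\ge\alpha+1$. Let $m=\lceil\log_\beta(\alpha n)\rceil$. An admissible partition is a tuple $(I_1,\dots,I_m)$ of pairwise disjoint (possibly empty) sets with union $\{1,\dots,n\}$ such that $|I_k|=\lfloor \alpha n/\beta^{k-1}\rfloor$ for $k=2,\dots,m$ and $|I_1|=n-\sum_{k=2}^m|I_k|$.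 For an admissible partition let $$\mathbb{Z}^n(I_1,\dots,I_m)=\{\mathbf{z}\in\mathbb{R}^n: z_i\in\{\pm1,\pm\beta^{(k-1)/2}\}\text{ if } i\in I_k,\ k=1,\dots,m\},$$ let $\mathbb{Z}^n$ be the union of these sets over all admissible partitions, and $\mathbb{H}_3^n(\alpha,\beta)=\{\mathbf{z}/\|\mathbf{z}\|:\mathbf{z}\in\mathbb{Z}^n\}\subseteq\mathbb{S}^n$. Definition of $\mathbb{H}_5^n(\alpha,\beta)$ for $n\ge2$. Let $p=\lceil\ln n\rceil$, $q=\lfloor n/p\rfloor$, $r=n-pq$. Let $\mathbb{E}^{q}=\{\mathbf{e}_1,\dots,\mathbf{e}_{q}\}$ be the standard basis of $\mathbb{R}^{q}$, $\boxtimes$ the Kronecker product $\mathbf{x}\boxtimes\mathbf{y}=(x_1\mathbf{y}^{\rm T},x_2\mathbf{y}^{\rm T},\dots)^{\rm T}$, and $\vee$ the concatenation of vectors (both applied elementwise to sets of vectors); $\mathbf{0}_{j}$ is the zero vector of $\mathbb{R}^j$. Then $$\mathbb{H}_5^n(\alpha,\beta)=\left((\mathbb{E}^{q}\boxtimes\mathbb{H}_3^{p}(\alpha,\beta))\vee\mathbf{0}_{r}\right)\cup\left(\mathbf{0}_{pq}\vee\mathbb{H}_3^{r}(\alpha,\beta)\right),$$ where the second set is empty if $r=0$. Algorithm $\mathcal{A}$. Input: $\mathcal{T}\in\mathbb{R}^{n_1\times\dots\times n_d}$. (1) Enumerate all $(\mathbf{z}_1,\dots,\mathbf{z}_{d-2})$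 with $\mathbf{z}_k\in\mathbb{H}_5^{n_k}(2+\sqrt5,3+\sqrt5)$ for $k=1,\dots,d-2$, and for each solve the matrix spectral norm problem $\max\{\mathcal{T}(\mathbf{z}_1,\dots,\mathbf{z}_{d-2},\mathbf{x}_{d-1},\mathbf{x}_d):\|\mathbf{x}_{d-1}\|=\|\mathbf{x}_d\|=1\}$, with optimal solution denoted $(\mathbf{z}_{d-1},\mathbf{z}_d)$. (2) Output the largest of all objective values found (with the corresponding $(\mathbf{z}_1,\dots,\mathbf{z}_d)$). *)

theory Defs
  imports Complex_Main "HOL-Library.Disjoint_Sets" "Jordan_Normal_Form.Matrix"
begin

section \<open>Tensors and the spectral norm\<close>

text \<open>
  Vectors of \<open>\<real>\<^sup>n\<close> are the elements of \<^term>\<open>carrier_vec n\<close>.  A tensor of format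
  \<open>n\<^sub>1 \<times> \<dots> \<times> n\<^sub>d\<close> is given by the list \<open>ns = [n\<^sub>1, \<dots>, n\<^sub>d]\<close> and a function on multi-indices
  (lists of length \<open>d\<close>); all indices start at 0, so mode \<open>k + 1\<close> of the mathematics is position
  \<open>k\<close> of the list.  Only the values on \<open>multi_indices ns\<close> are ever used.
\<close>

definition vnorm :: "real vec \<Rightarrow> real" where
  "vnorm x = sqrt (x \<bullet> x)"

definition sphere :: "nat \<Rightarrow> real vec set" where
  "sphere n = {x \<in> carrier_vec n. vnorm x = 1}"

text \<open>The list is in lexicographic order (last index varying fastest).\<close>

definition multi_indices :: "nat list \<Rightarrow> nat list list" where
  "multi_indices ns = product_lists (map (\<lambda>n. [0..<n]) ns)"

definition tensor_form :: "nat list \<Rightarrow> (nat list \<Rightarrow> real) \<Rightarrow> real vec list \<Rightarrow> real" where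
  "tensor_form ns T xs =
     (\<Sum>is\<in>set (multi_indices ns). T is * (\<Prod>k<length ns. (xs ! k) $ (is ! k)))"

text \<open>
  The supremum is a maximum, the form being continuous and the spheres compact (all
  \<open>n\<^sub>k\<close> are positive in the use below).
\<close>

definition spectral_norm :: "nat list \<Rightarrow> (nat list \<Rightarrow> real) \<Rightarrow> real" where
  "spectral_norm ns T = Sup {tensor_form ns T xs | xs.
     length xs = length ns \<and> (\<forall>k<length ns. xs ! k \<in> sphere (ns ! k))}"

definition approximates :: "real \<Rightarrow> real \<Rightarrow> real \<Rightarrow> bool" where
  "approximates \<tau> \<nu> \<omega> \<longleftrightarrow> 0 < \<tau> \<and> \<tau> \<le> 1 \<and> \<tau> * \<nu> \<le> \<omega> \<and> \<omega> \<le> \<nu>"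


section \<open>The sets \<open>\<bbbH>\<^sub>3\<close> and \<open>\<bbbH>\<^sub>5\<close>\<close>

definition num_levels :: "real \<Rightarrow> real \<Rightarrow> nat \<Rightarrow> nat" where
  "num_levels \<alpha> \<beta> n = nat \<lceil>log \<beta> (\<alpha> * real n)\<rceil>"

text \<open>
  The parts carry their mathematical numbers \<open>1, \<dots>, m\<close>; they partition the set of 0-based
  coordinates \<open>{..<n}\<close>.
\<close>

definition admissible_partition :: "real \<Rightarrow> real \<Rightarrow> nat \<Rightarrow> (nat \<Rightarrow> nat set) \<Rightarrow> bool" where
  "admissible_partition \<alpha> \<beta> n I \<longleftrightarrow>
     (let m = num_levels \<alpha> \<beta> n in
        disjoint_family_on I {1..m} \<and> (\<Union>k\<in>{1..m}. I k) = {..<n} \<and>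
        (\<forall>k\<in>{2..m}. int (card (I k)) = \<lfloor>\<alpha> * real n / \<beta> ^ (k - 1)\<rfloor>) \<and>
        int (card (I 1)) = int n - (\<Sum>k=2..m. int (card (I k))))"

definition Z_part :: "real \<Rightarrow> real \<Rightarrow> nat \<Rightarrow> (nat \<Rightarrow> nat set) \<Rightarrow> real vec set" where
  "Z_part \<alpha> \<beta> n I = {z \<in> carrier_vec n. \<forall>k\<in>{1..num_levels \<alpha> \<beta> n}. \<forall>i\<in>I k.
     z $ i \<in> {1, -1, \<beta> powr ((real k - 1) / 2), - (\<beta> powr ((real k - 1) / 2))}}"

definition Z_set :: "real \<Rightarrow> real \<Rightarrow> nat \<Rightarrow> real vec set" where
  "Z_set \<alpha> \<beta> n = (\<Union>I\<in>{I. admissible_partition \<alpha> \<beta> n I}. Z_part \<alpha> \<beta> n I)"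

definition H3 :: "real \<Rightarrow> real \<Rightarrow> nat \<Rightarrow> real vec set" where
  "H3 \<alpha> \<beta> n = {(1 / vnorm z) \<cdot>\<^sub>v z | z. z \<in> Z_set \<alpha> \<beta> n}"

definition kron_vec :: "real vec \<Rightarrow> real vec \<Rightarrow> real vec" (infixl \<open>\<boxtimes>\<close> 70) where
  "x \<boxtimes> y = vec (dim_vec x * dim_vec y) (\<lambda>i. x $ (i div dim_vec y) * y $ (i mod dim_vec y))"

definition H5 :: "real \<Rightarrow> real \<Rightarrow> nat \<Rightarrow> real vec set" where
  "H5 \<alpha> \<beta> n =
     (let p = nat \<lceil>ln (real n)\<rceil>; q = n div p; r = n - p * q in
        {(e \<boxtimes> h) @\<^sub>v 0\<^sub>v r | e h. e \<in> set (unit_vecs q) \<and> h \<in> H3 \<alpha> \<beta> p} \<union>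
        (if r = 0 then {} else {0\<^sub>v (p * q) @\<^sub>v h | h. h \<in> H3 \<alpha> \<beta> r}))"


section \<open>The algorithm\<close>

text \<open>
  A solver for the matrix spectral norm problem
  \<open>max {x \<bullet> (A *\<^sub>v y). \<parallel>x\<parallel> = \<parallel>y\<parallel> = 1}\<close>; it returns an optimal solution.
\<close>

definition matrix_solver :: "(real mat \<Rightarrow> real vec \<times> real vec) \<Rightarrow> bool" where
  "matrix_solver \<sigma> \<longleftrightarrow> (\<forall>A. 0 < dim_row A \<and> 0 < dim_col A \<longrightarrow>
     (case \<sigma> A of (x, y) \<Rightarrow>
        x \<in> sphere (dim_row A) \<and> y \<in> sphere (dim_col A) \<and>
        (\<forall>u\<in>sphere (dim_row A). \<forall>v\<in>sphere (dim_col A). u \<bullet> (A *\<^sub>v v) \<le> x \<bullet> (A *\<^sub>v y))))"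

definition contract :: "nat list \<Rightarrow> (nat list \<Rightarrow> real) \<Rightarrow> real vec list \<Rightarrow> real mat" where
  "contract ns T zs =
     (let d = length ns; a = ns ! (d - 2); b = ns ! (d - 1) in
        mat a b (\<lambda>(i, j). tensor_form ns T (zs @ [unit_vec a i, unit_vec b j])))"

definition candidates ::
  "(real mat \<Rightarrow> real vec \<times> real vec) \<Rightarrow> nat list \<Rightarrow> (nat list \<Rightarrow> real) \<Rightarrow> real vec list set" where
  "candidates \<sigma> ns T =
     {zs @ [x, y] | zs x y. length zs = length ns - 2 \<and>
        (\<forall>k<length ns - 2. zs ! k \<in> H5 (2 + sqrt 5) (3 + sqrt 5) (ns ! k)) \<and>
        \<sigma> (contract ns T zs) = (x, y)}"

text \<open>
  \<open>(v, zs)\<close> is a result of the algorithm: the largest objective value found, with vectors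
  attaining it.  Ties between candidates may be broken in any way.
\<close>

definition algA_output ::
  "(real mat \<Rightarrow> real vec \<times> real vec) \<Rightarrow> nat list \<Rightarrow> (nat list \<Rightarrow> real) \<Rightarrow>
     real \<Rightarrow> real vec list \<Rightarrow> bool" where
  "algA_output \<sigma> ns T v zs \<longleftrightarrow>
     zs \<in> candidates \<sigma> ns T \<and> v = tensor_form ns T zs \<and>
     (\<forall>zs'\<in>candidates \<sigma> ns T. tensor_form ns T zs' \<le> v)"


section \<open>The machine model\<close>

text \<open>
  Running times refer to exact real arithmetic.  Programs work on binary trees whose leaves are
  real numbers; they are built from unit-cost instructions by sequencing, pairing, branching and
  looping.  The only constants are integers, and there is neither rounding nor indexed memory, so
  real numbers can only be combined arithmetically and compared.  The matrix spectral norm problem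
  has no finite exact solution in this arithmetic; it is a separate instruction
  \<open>MatSolve\<close>, which answers with \<open>\<sigma> A\<close> at the cost \<open>\<kappa> a b\<close> on an \<open>a \<times> b\<close> matrix.
\<close>

datatype val = Leaf | Num real | Cell val val

datatype arith = Plus | Minus | Times | Divide

datatype prog =
    Skip
  | MkLeaf
  | Const int
  | Head
  | Tail
  | IsCell
  | Arith arith
  | Sqrt
  | Ln
  | MatSolve
  | Seq prog prog
  | Fork prog prog
  | Cond prog prog prog
  | Loop prog prog

fun arith_defined :: "arith \<Rightarrow> real \<Rightarrow> bool" where
  "arith_defined Divide b \<longleftrightarrow> b \<noteq> 0"
| "arith_defined _ b \<longleftrightarrow> True"

fun arith_op :: "arith \<Rightarrow> real \<Rightarrow> real \<Rightarrow> real" where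
  "arith_op Plus a b = a + b"
| "arith_op Minus a b = a - b"
| "arith_op Times a b = a * b"
| "arith_op Divide a b = a / b"

fun holds :: "val \<Rightarrow> bool" where
  "holds (Num a) \<longleftrightarrow> 0 < a"
| "holds _ \<longleftrightarrow> False"

definition enc_list :: "val list \<Rightarrow> val" where
  "enc_list vs = foldr Cell vs Leaf"

definition enc_reals :: "real list \<Rightarrow> val" where
  "enc_reals xs = enc_list (map Num xs)"

definition enc_vec :: "real vec \<Rightarrow> val" where
  "enc_vec x = enc_reals (list_of_vec x)"

definition enc_mat :: "real mat \<Rightarrow> val" where
  "enc_mat A = enc_list (map enc_vec (rows A))"

text \<open>
  \<open>exec \<sigma> \<kappa> P x y t\<close>: on input \<open>x\<close> the program \<open>P\<close> halts with output \<open>y\<close> after time \<open>t\<close>.  A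
  program gets stuck on an ill-formed argument.
\<close>

inductive exec ::
  "(real mat \<Rightarrow> real vec \<times> real vec) \<Rightarrow> (nat \<Rightarrow> nat \<Rightarrow> nat) \<Rightarrow> prog \<Rightarrow> val \<Rightarrow> val \<Rightarrow> nat \<Rightarrow> bool"
  for \<sigma> \<kappa> where
  Skip: "exec \<sigma> \<kappa> Skip x x 1"
| MkLeaf: "exec \<sigma> \<kappa> MkLeaf x Leaf 1"
| Const: "exec \<sigma> \<kappa> (Const c) x (Num (of_int c)) 1"
| Head: "exec \<sigma> \<kappa> Head (Cell x y) x 1"
| Tail: "exec \<sigma> \<kappa> Tail (Cell x y) y 1"
| IsCell: "exec \<sigma> \<kappa> IsCell x (Num (case x of Cell u v \<Rightarrow> 1 | _ \<Rightarrow> 0)) 1"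
| Arith: "arith_defined f b \<Longrightarrow>
    exec \<sigma> \<kappa> (Arith f) (Cell (Num a) (Num b)) (Num (arith_op f a b)) 1"
| Sqrt: "0 \<le> a \<Longrightarrow> exec \<sigma> \<kappa> Sqrt (Num a) (Num (sqrt a)) 1"
| Ln: "0 < a \<Longrightarrow> exec \<sigma> \<kappa> Ln (Num a) (Num (ln a)) 1"
| MatSolve: "0 < dim_row A \<Longrightarrow> 0 < dim_col A \<Longrightarrow> \<sigma> A = (x, y) \<Longrightarrow>
    exec \<sigma> \<kappa> MatSolve (enc_mat A) (Cell (enc_vec x) (enc_vec y))
      (1 + \<kappa> (dim_row A) (dim_col A))"
| Seq: "exec \<sigma> \<kappa> P x y s \<Longrightarrow> exec \<sigma> \<kappa> Q y z t \<Longrightarrow> exec \<sigma> \<kappa> (Seq P Q) x z (1 + s + t)"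
| Fork: "exec \<sigma> \<kappa> P x y s \<Longrightarrow> exec \<sigma> \<kappa> Q x z t \<Longrightarrow> exec \<sigma> \<kappa> (Fork P Q) x (Cell y z) (1 + s + t)"
| CondT: "exec \<sigma> \<kappa> B x b s \<Longrightarrow> holds b \<Longrightarrow> exec \<sigma> \<kappa> P x y t \<Longrightarrow>
    exec \<sigma> \<kappa> (Cond B P Q) x y (1 + s + t)"
| CondF: "exec \<sigma> \<kappa> B x b s \<Longrightarrow> \<not> holds b \<Longrightarrow> exec \<sigma> \<kappa> Q x y t \<Longrightarrow>
    exec \<sigma> \<kappa> (Cond B P Q) x y (1 + s + t)"
| LoopT: "exec \<sigma> \<kappa> B x b s \<Longrightarrow> holds b \<Longrightarrow> exec \<sigma> \<kappa> P x y t \<Longrightarrow> exec \<sigma> \<kappa> (Loop B P) y z u \<Longrightarrow>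
    exec \<sigma> \<kappa> (Loop B P) x z (1 + s + t + u)"
| LoopF: "exec \<sigma> \<kappa> B x b s \<Longrightarrow> \<not> holds b \<Longrightarrow> exec \<sigma> \<kappa> (Loop B P) x x (1 + s)"

lemma enc_list_inject: "enc_list us = enc_list vs \<longleftrightarrow> us = vs"
proof (induction us arbitrary: vs)
  case Nil
  show ?case by (cases vs) (auto simp: enc_list_def)
next
  case (Cons u us)
  then show ?case by (cases vs) (auto simp: enc_list_def)
qed

lemma enc_vec_inject: "enc_vec x = enc_vec y \<longleftrightarrow> x = y"
proof -
  have "inj Num" by (auto intro: injI)
  then show ?thesis
    unfolding enc_vec_def enc_reals_def enc_list_inject
    by (metis inj_map_eq_map vec_list)
qed

lemma enc_mat_inject:
  assumes "enc_mat A = enc_mat B" "0 < dim_row A"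
  shows "A = B"
proof -
  have "inj enc_vec" by (auto intro: injI simp: enc_vec_inject)
  with assms(1) have r: "rows A = rows B"
    by (simp add: enc_mat_def enc_list_inject inj_map_eq_map)
  then have d: "dim_row A = dim_row B" by (metis length_rows)
  have *: "row A i = row B i" if "i < dim_row A" for i
    using that r d by (metis nth_rows)
  from *[OF assms(2)] have "dim_col A = dim_col B"
    by (metis index_row(2))
  with d * show ?thesis by (intro eq_rowI) auto
qed

text \<open>The model is deterministic: output and running time are determined by the input.\<close>

lemma exec_deterministic:
  "exec \<sigma> \<kappa> P x y t \<Longrightarrow> exec \<sigma> \<kappa> P x y' t' \<Longrightarrow> y' = y \<and> t' = t"
proof (induction arbitrary: y' t' rule: exec.induct)
  case (MatSolve A u v)
  from MatSolve.prems show ?case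
    by cases (use MatSolve.hyps enc_mat_inject in fastforce)
next
  case (Seq P x y s Q z t)
  from Seq.prems show ?case by cases (use Seq.IH in blast)
next
  case (Fork P x y s Q z t)
  from Fork.prems show ?case by cases (use Fork.IH in blast)
next
  case (CondT B x b s P y t Q)
  from CondT.prems show ?case by cases (use CondT.IH CondT.hyps in blast)+
next
  case (CondF B x b s Q y t P)
  from CondF.prems show ?case by cases (use CondF.IH CondF.hyps in blast)+
next
  case (LoopT B x b s P y t z u)
  from LoopT.prems show ?case by cases (use LoopT.IH LoopT.hyps in blast)+
next
  case (LoopF B x b s P)
  from LoopF.prems show ?case by cases (use LoopF.IH LoopF.hyps in blast)+
qed (erule exec.cases; simp)+

text \<open>Input: the list of dimensions, and the entries in lexicographic order.\<close>

definition enc_tensor :: "nat list \<Rightarrow> (nat list \<Rightarrow> real) \<Rightarrow> val" where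
  "enc_tensor ns T = Cell (enc_reals (map real ns)) (enc_reals (map T (multi_indices ns)))"

definition enc_output :: "real \<Rightarrow> real vec list \<Rightarrow> val" where
  "enc_output v zs = Cell (Num v) (enc_list (map enc_vec zs))"

definition poly_cost :: "(nat \<Rightarrow> nat \<Rightarrow> nat) \<Rightarrow> bool" where
  "poly_cost \<kappa> \<longleftrightarrow> (\<exists>c e. \<forall>a b. 0 < a \<and> 0 < b \<longrightarrow> \<kappa> a b \<le> c * (a * b) ^ e)"

text \<open>
  Here the size of a tensor is its number of entries \<open>n\<^sub>1 \<cdots> n\<^sub>d\<close>, which bounds \<open>d\<close> as well
  when all \<open>n\<^sub>k \<ge> 2\<close>.
\<close>

definition polytime_implements_algA ::
  "(real mat \<Rightarrow> real vec \<times> real vec) \<Rightarrow> (nat \<Rightarrow> nat \<Rightarrow> nat) \<Rightarrow> prog \<Rightarrow> bool" where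
  "polytime_implements_algA \<sigma> \<kappa> P \<longleftrightarrow>
     (\<exists>c e. \<forall>ns T. 3 \<le> length ns \<and> sorted ns \<and> (\<forall>n\<in>set ns. 2 \<le> n) \<longrightarrow>
        (\<exists>v zs t. exec \<sigma> \<kappa> P (enc_tensor ns T) (enc_output v zs) t \<and>
           t \<le> c * prod_list ns ^ e \<and> algA_output \<sigma> ns T v zs))"

end

theory Submission
  imports Defs
begin

text \<open>
  The algorithm lets the first \<open>d - 2\<close> arguments of the form range over finite sets and optimises
  the last two exactly.  So two things have to be seen: restricting the arguments loses little, and
  there are few candidates.

  Little is lost, because every \<open>x \<in> \<real>\<^sup>n\<close> has inner product at least
  \<open>3/10 * sqrt (ln n / n) * \<parallel>x\<parallel>\<close> with some member of \<open>H5\<close> (\<open>H5_hits\<close>).  For \<open>H3\<close> the inner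
  product even reaches \<open>\<parallel>x\<parallel> / 2\<close> (\<open>H3_hits\<close>): scale \<open>x\<close> until the squares of its entries sum to
  \<open>\<alpha> n\<close>, and replace an entry whose square lies in \<open>(\<beta>^k, \<beta>^(k+1)]\<close>, \<open>k \<ge> 1\<close>, by \<open>\<beta>^(k/2)\<close> and
  every smaller one by 1, keeping the signs.  Fewer than \<open>\<alpha> n / \<beta>^k\<close> squares exceed \<open>\<beta>^k\<close>, so the
  rounded vector respects the sizes of the parts of some admissible partition; this is all that
  membership in \<open>Z_set\<close> asks for (\<open>Z_set_eq\<close>).  For \<open>H5\<close>, cut \<open>x\<close> into blocks of length about
  \<open>ln n\<close>: one block carries at least an average share of \<open>\<parallel>x\<parallel>\<^sup>2\<close> and is hit by \<open>H3\<close>.  As a function of a single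
  argument the form is the inner product with a vector \<open>v\<close>, which is at most \<open>\<parallel>v\<parallel>\<close> on the sphere;
  hence exchanging the arguments one after the other costs only the product of the factors
  (\<open>hit_modes\<close>).

  There are few candidates, because \<open>H3\<close> has only \<open>exp (O(s))\<close> elements in dimension \<open>s\<close>
  (\<open>length_z_list_le_exp\<close>), and \<open>H5\<close> uses it with \<open>s\<close> at most \<open>ln n + 1\<close>.  So \<open>H5\<close> has at
  most \<open>n^58\<close> elements, and there are at most \<open>(n\<^sub>1 \<cdots> n\<^sub>d)^58\<close> tuples to try.

  The running time is that of an explicit program, composed of folds over lists.  An instruction
  costs one unit however large the values it copies, so the time is governed by the lengths of
  the lists that are folded over.  All of these are bounded by powers of the number \<open>N\<close> of entries
  of the tensor, and only exponents of \<open>N\<close> are recorded.  The functions \<open>z_list\<close>, \<open>h5_list\<close> and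
  \<open>candidate_list\<close> specify what the programs compute and carry the mathematical content.
\<close>

section \<open>Programs over lists and their running times\<close>

text \<open>
  Programs run in an environment, a nest of cells \<open>Cell v\<^sub>0 (Cell v\<^sub>1 \<dots>)\<close> in which \<open>Arg i\<close> reads
  \<open>v\<^sub>i\<close>.  \<open>Bind\<close> pushes one value; the body of a fold finds the current element and the accumulator
  pushed in front, so inside it the outer variables are shifted by two.
\<close>
primrec Arg :: "nat \<Rightarrow> prog" where
  "Arg 0 = Head"
| "Arg (Suc n) = Seq Tail (Arg n)"

definition Bind :: "prog \<Rightarrow> prog \<Rightarrow> prog" where
  "Bind P Q = Seq (Fork P Skip) Q"

definition Op :: "arith \<Rightarrow> prog \<Rightarrow> prog \<Rightarrow> prog" where
  "Op f P Q = Seq (Fork P Q) (Arith f)"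

definition If_less :: "prog \<Rightarrow> prog \<Rightarrow> prog \<Rightarrow> prog \<Rightarrow> prog" where
  "If_less P Q R S = Cond (Op Minus Q P) R S"

definition If_cell :: "prog \<Rightarrow> prog \<Rightarrow> prog \<Rightarrow> prog" where
  "If_cell P R S = Cond (Seq P IsCell) R S"

text \<open>The loop state is the remaining list, the accumulator and the environment.\<close>
definition Foldl :: "prog \<Rightarrow> prog \<Rightarrow> prog \<Rightarrow> prog" where
  "Foldl L A F = Seq (Fork L (Fork A Skip))
     (Seq (Loop (Seq Head IsCell)
             (Fork (Seq Head Tail) (Fork (Seq (Fork (Seq Head Head) Tail) F) (Seq Tail Tail))))
          (Seq Tail Head))"

definition Rev :: "prog \<Rightarrow> prog" where
  "Rev L = Foldl L MkLeaf (Fork (Arg 0) (Arg 1))"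

definition Foldr :: "prog \<Rightarrow> prog \<Rightarrow> prog \<Rightarrow> prog" where
  "Foldr L A F = Foldl (Rev L) A F"

definition Map :: "prog \<Rightarrow> prog \<Rightarrow> prog" where
  "Map L F = Foldr L MkLeaf (Fork F (Arg 1))"

definition Append :: "prog \<Rightarrow> prog \<Rightarrow> prog" where
  "Append P Q = Foldr P Q (Fork (Arg 0) (Arg 1))"

definition Flat_map :: "prog \<Rightarrow> prog \<Rightarrow> prog" where
  "Flat_map L F = Foldr L MkLeaf (Append F (Arg 1))"

definition Upto :: "prog \<Rightarrow> prog" where
  "Upto P = Seq (Seq (Fork P MkLeaf)
     (Loop Head (Fork (Op Minus Head (Const 1)) (Fork (Op Minus Head (Const 1)) Tail)))) Tail"

text \<open>
  The fold visits its list from the last element on, so the other list is consumed in reverse;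
  the accumulator pairs what remains of it with the output.
\<close>
definition Zip :: "prog \<Rightarrow> prog \<Rightarrow> prog" where
  "Zip P Q = Seq (Foldr P (Fork (Rev Q) MkLeaf)
     (Fork (Seq (Arg 1) (Seq Head Tail))
           (Fork (Fork (Arg 0) (Seq (Arg 1) (Seq Head Head))) (Seq (Arg 1) Tail)))) Tail"

lemma enc_list_simps [simp]: "enc_list [] = Leaf" "enc_list (x # xs) = Cell x (enc_list xs)"
  by (simp_all add: enc_list_def)

text \<open>
  Times are bounded by powers of \<open>B \<ge> 2\<close>.  Since \<open>1 + B^j + B^k \<le> B^(j + k + 2)\<close>, exponents simply
  add up along the structure of a program, and a constant factor is absorbed by a constant summand
  of the exponent.  The numerals in the exponents below are generous.
\<close>
locale machine =
  fixes \<sigma> :: "real mat \<Rightarrow> real vec \<times> real vec" and \<kappa> :: "nat \<Rightarrow> nat \<Rightarrow> nat" and B :: nat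
  assumes B: "2 \<le> B"
begin

definition run :: "prog \<Rightarrow> val \<Rightarrow> val \<Rightarrow> nat \<Rightarrow> bool" where
  "run P x y k \<longleftrightarrow> (\<exists>t\<le>B ^ k. exec \<sigma> \<kappa> P x y t)"

lemma power_mono_exp: "j \<le> k \<Longrightarrow> B ^ j \<le> B ^ k"
  using B by (simp add: power_increasing)

lemma one_le_power: "1 \<le> B ^ k"
  using B by simp

lemma pow_shift: "2 ^ i * B ^ k \<le> B ^ (k + i)"
  using B by (simp add: power_add power_mono)

lemma run_weaken: "run P x y j \<Longrightarrow> j \<le> k \<Longrightarrow> run P x y k"
  unfolding run_def using power_mono_exp le_trans by meson

text \<open>
  Applied first, this rule leaves output and exponent open, so that the rules for the instructions
  can compute them by unification; both are compared with the wanted ones at the end.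
\<close>
lemma run_cong: "run P x y j \<Longrightarrow> y = y' \<Longrightarrow> j \<le> k \<Longrightarrow> run P x y' k"
  using run_weaken by blast

lemma run_unit: "exec \<sigma> \<kappa> P x y 1 \<Longrightarrow> run P x y 0"
  unfolding run_def by auto

lemma run_Skip: "run Skip x x 0" and run_MkLeaf: "run MkLeaf x Leaf 0"
  and run_Const: "run (Const c) x (Num (of_int c)) 0"
  and run_Head: "run Head (Cell u v) u 0" and run_Tail: "run Tail (Cell u v) v 0"
  and run_Sqrt: "0 \<le> a \<Longrightarrow> run prog.Sqrt (Num a) (Num (sqrt a)) 0"
  and run_Ln: "0 < a \<Longrightarrow> run prog.Ln (Num a) (Num (ln a)) 0"
  by (auto intro!: run_unit exec.intros)

lemma add_powers: "s \<le> B ^ j \<Longrightarrow> t \<le> B ^ k \<Longrightarrow> 1 + s + t \<le> B ^ (j + k + 2)"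
proof -
  assume "s \<le> B ^ j" "t \<le> B ^ k"
  moreover have "B ^ j \<le> B ^ (j + k)" "B ^ k \<le> B ^ (j + k)"
    by (auto intro: power_mono_exp)
  ultimately have "1 + s + t \<le> 2 ^ 2 * B ^ (j + k)"
    using one_le_power[of "j + k"] by simp
  then show ?thesis using pow_shift[of 2 "j + k"] by linarith
qed

lemma run_Seq: "run P x y j \<Longrightarrow> run Q y z k \<Longrightarrow> run (Seq P Q) x z (j + k + 2)"
  unfolding run_def using exec.Seq add_powers by meson

lemma run_Fork: "run P x y j \<Longrightarrow> run Q x z k \<Longrightarrow> run (Fork P Q) x (Cell y z) (j + k + 2)"
  unfolding run_def using exec.Fork add_powers by meson

lemma run_Cond:
  assumes "run C x b i" "holds b \<Longrightarrow> run P x y j" "\<not> holds b \<Longrightarrow> run Q x z k"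
  shows "run (Cond C P Q) x (if holds b then y else z) (i + j + k + 2)"
proof (cases "holds b")
  case True
  with assms obtain s t where "exec \<sigma> \<kappa> C x b s" "s \<le> B ^ i" "exec \<sigma> \<kappa> P x y t" "t \<le> B ^ j"
    by (auto simp: run_def)
  then have "run (Cond C P Q) x y (i + j + 2)"
    unfolding run_def using exec.CondT True add_powers by meson
  then show ?thesis using True by (auto intro: run_weaken)
next
  case False
  with assms obtain s t where "exec \<sigma> \<kappa> C x b s" "s \<le> B ^ i" "exec \<sigma> \<kappa> Q x z t" "t \<le> B ^ k"
    by (auto simp: run_def)
  then have "run (Cond C P Q) x z (i + k + 2)"
    unfolding run_def using exec.CondF False add_powers by meson
  then show ?thesis using False by (auto intro: run_weaken)
qed

lemma run_Arg_0: "run (Arg 0) (Cell x y) x 0"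
  by (simp add: run_Head)

lemma run_Arg_Suc: "run (Arg n) y z k \<Longrightarrow> run (Arg (Suc n)) (Cell x y) z (k + 2)"
  using run_Seq[OF run_Tail, of "Arg n" y z k x] by simp

lemma run_Arg_1: "run (Arg 1) (Cell x (Cell y z)) y 2"
  using run_Arg_Suc[OF run_Arg_0] by (simp add: numeral_2_eq_2)

lemma run_Arg_2: "run (Arg 2) (Cell a (Cell b (Cell c x))) c 4"
  using run_Arg_Suc[OF run_Arg_1] by (simp add: numeral_eq_Suc)

lemma run_Arg_3: "run (Arg 3) (Cell a (Cell b (Cell c (Cell d x)))) d 6"
  using run_Arg_Suc[OF run_Arg_2] by (simp add: numeral_eq_Suc)

lemma run_Arg_4: "run (Arg 4) (Cell a (Cell b (Cell c (Cell d (Cell e x))))) e 8"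
  using run_Arg_Suc[OF run_Arg_3] by (simp add: numeral_eq_Suc)

lemma run_Arg_5: "run (Arg 5) (Cell a (Cell b (Cell c (Cell d (Cell e (Cell f x)))))) f 10"
  using run_Arg_Suc[OF run_Arg_4] by (simp add: numeral_eq_Suc)

lemma run_Arg_6: "run (Arg 6) (Cell a (Cell b (Cell c (Cell d (Cell e (Cell f (Cell g x))))))) g 12"
  using run_Arg_Suc[OF run_Arg_5] by (simp add: numeral_eq_Suc)

lemmas run_Arg = run_Arg_0 run_Arg_1 run_Arg_2 run_Arg_3 run_Arg_4 run_Arg_5 run_Arg_6

lemma run_Bind: "run P x y j \<Longrightarrow> run Q (Cell y x) z k \<Longrightarrow> run (Bind P Q) x z (j + k + 4)"
  unfolding Bind_def by (rule run_cong, rule run_Seq, rule run_Fork, assumption, rule run_Skip) auto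

lemma run_Op:
  "run P x (Num a) j \<Longrightarrow> run Q x (Num b) k \<Longrightarrow> arith_defined f b \<Longrightarrow>
     run (Op f P Q) x (Num (arith_op f a b)) (j + k + 4)"
  unfolding Op_def
  by (rule run_cong, rule run_Seq, rule run_Fork, assumption+, rule run_unit, rule exec.Arith) auto

lemmas run_arith = run_Op[where f = Plus, simplified] run_Op[where f = Minus, simplified]
  run_Op[where f = Times, simplified]

lemma run_If_less:
  assumes "run P x (Num a) i" "run Q x (Num b) j"
    "a < b \<Longrightarrow> run R x y k" "\<not> a < b \<Longrightarrow> run S x z l"
  shows "run (If_less P Q R S) x (if a < b then y else z) (i + j + k + l + 6)"
  unfolding If_less_def
  by (rule run_cong, rule run_Cond, rule run_Op, (rule assms | simp)+)

lemma run_If_cell: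
  assumes "run P x y i" "\<And>u v. y = Cell u v \<Longrightarrow> run R x z j" "(\<And>u v. y \<noteq> Cell u v) \<Longrightarrow> run S x w k"
  shows "run (If_cell P R S) x (case y of Cell _ _ \<Rightarrow> z | _ \<Rightarrow> w) (i + j + k + 4)"
  unfolding If_cell_def
  by (rule run_cong, rule run_Cond, rule run_Seq, rule assms, rule run_unit, rule exec.IsCell)
    (use assms(2,3) in \<open>auto split: val.splits\<close>)

text \<open>
  The states of the loop are given in advance as a sequence \<open>f 0, \<dots>, f n\<close>, so that no invariant
  has to be guessed.
\<close>
lemma run_loop:
  assumes "\<And>i. i < n \<Longrightarrow> exec \<sigma> \<kappa> C (f i) (c i) s \<and> holds (c i)"
    and "exec \<sigma> \<kappa> C (f n) (c n) s" "\<not> holds (c n)"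
    and "\<And>i. i < n \<Longrightarrow> run P (f i) (f (Suc i)) k"
    and "s \<le> B ^ j" "n \<le> B ^ l"
  shows "run (Loop C P) (f 0) (f n) (j + k + l + 4)"
proof -
  have "\<exists>t\<le>(n - i + 1) * (1 + s + B ^ k). exec \<sigma> \<kappa> (Loop C P) (f i) (f n) t" if "i \<le> n" for i
    using that
  proof (induction i rule: inc_induct)
    case base
    have "exec \<sigma> \<kappa> (Loop C P) (f n) (f n) (1 + s)"
      using assms by (intro exec.LoopF)
    then show ?case by (intro exI[of _ "1 + s"]) auto
  next
    case (step i)
    then obtain t where t: "t \<le> (n - Suc i + 1) * (1 + s + B ^ k)" "exec \<sigma> \<kappa> (Loop C P) (f (Suc i)) (f n) t"
      by auto
    obtain u where u: "u \<le> B ^ k" "exec \<sigma> \<kappa> P (f i) (f (Suc i)) u"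
      using assms(4)[OF \<open>i < n\<close>] by (auto simp: run_def)
    have "exec \<sigma> \<kappa> (Loop C P) (f i) (f n) (1 + s + u + t)"
      using assms(1)[OF \<open>i < n\<close>] u t by (blast intro: exec.LoopT)
    moreover have "n - i + 1 = Suc (n - Suc i + 1)" using step by simp
    then have "1 + s + u + t \<le> (n - i + 1) * (1 + s + B ^ k)" using t u by simp
    ultimately show ?case by blast
  qed
  from this[of 0] obtain t where t: "t \<le> (n + 1) * (1 + s + B ^ k)" "exec \<sigma> \<kappa> (Loop C P) (f 0) (f n) t"
    by auto
  have "n + 1 \<le> 2 ^ 1 * B ^ l" using assms one_le_power[of l] by simp
  also have "\<dots> \<le> B ^ (l + 1)" by (rule pow_shift)
  finally have "t \<le> B ^ (l + 1) * B ^ (j + k + 2)"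
    using t add_powers[of s j "B ^ k" k] assms by (meson le_refl le_trans mult_le_mono)
  also have "\<dots> = B ^ (j + k + l + 3)" by (simp add: power_add power_numeral_reduce)
  also have "\<dots> \<le> B ^ (j + k + l + 4)" by (rule power_mono_exp) simp
  finally show ?thesis using t by (auto simp: run_def)
qed

text \<open>
  Here \<open>E\<close> encodes the elements, and \<open>f\<close> gives the accumulator as a function of the prefix already
  processed.
\<close>
lemma run_Foldl:
  assumes L: "run L \<rho> (enc_list (map E xs)) j" and A: "run A \<rho> (f []) a"
    and F: "\<And>x ys zs. xs = ys @ x # zs \<Longrightarrow> run F (Cell (E x) (Cell (f ys) \<rho>)) (f (ys @ [x])) k"
    and len: "length xs \<le> B ^ l"
  shows "run (Foldl L A F) \<rho> (f xs) (j + a + k + l + 40)"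
proof -
  let ?P = "Fork (Seq Head Tail) (Fork (Seq (Fork (Seq Head Head) Tail) F) (Seq Tail Tail))"
  let ?f = "\<lambda>i. Cell (enc_list (map E (drop i xs))) (Cell (f (take i xs)) \<rho>)"
  let ?c = "\<lambda>i. Num (if i < length xs then 1 else 0)"
  have "run (Loop (Seq Head IsCell) ?P) (?f 0) (?f (length xs)) (2 + (k + 14) + l + 4)"
  proof (rule run_loop[where c = "?c" and s = 3])
    fix i assume i: "i < length xs"
    then have d: "drop i xs = xs ! i # drop (Suc i) xs" by (simp add: Cons_nth_drop_Suc)
    have *: "exec \<sigma> \<kappa> (Seq Head IsCell) (?f i) (Num 1) (1 + 1 + 1)"
      unfolding d by (rule exec.Seq, rule exec.Head) (use exec.IsCell[where x = "Cell u v" for u v] in simp)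
    then show "exec \<sigma> \<kappa> (Seq Head IsCell) (?f i) (?c i) 3 \<and> holds (?c i)"
      using i by (simp add: numeral_3_eq_3)
    have "run F (Cell (E (xs ! i)) (Cell (f (take i xs)) \<rho>)) (f (take (Suc i) xs)) k"
      using F[of "take i xs" "xs ! i" "drop (Suc i) xs"] i
      by (simp add: id_take_nth_drop[symmetric] take_Suc_conv_app_nth)
    then show "run ?P (?f i) (?f (Suc i)) (k + 14)"
      unfolding d list.map enc_list_simps
      by - (rule run_cong, (rule run_Fork run_Seq run_Head run_Tail | assumption)+, simp_all)
  next
    have "exec \<sigma> \<kappa> (Seq Head IsCell) (Cell Leaf v) (Num 0) (1 + 1 + 1)" for v
      by (rule exec.Seq, rule exec.Head) (use exec.IsCell[where x = Leaf] in simp)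
    then show "exec \<sigma> \<kappa> (Seq Head IsCell) (?f (length xs)) (?c (length xs)) 3"
      by (simp add: numeral_3_eq_3)
  next
    show "(3::nat) \<le> B ^ 2" using power_mono[OF B, of 2] by simp
  qed (use len in auto)
  then have loop: "run (Loop (Seq Head IsCell) ?P) (Cell (enc_list (map E xs)) (Cell (f []) \<rho>))
      (Cell Leaf (Cell (f xs) \<rho>)) (k + l + 20)"
    by (simp add: algebra_simps)
  show ?thesis unfolding Foldl_def
    by (rule run_cong, (rule run_Fork run_Seq run_Skip run_Head run_Tail L A loop)+) auto
qed

lemma run_push: "run (Fork (Arg 0) (Arg 1)) (Cell x (Cell y \<rho>)) (Cell x y) 4"
  by (rule run_cong, rule run_Fork, rule run_Arg_0, rule run_Arg_1) auto

lemma run_Rev: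
  assumes "run L \<rho> (enc_list xs) j" "length xs \<le> B ^ l"
  shows "run (Rev L) \<rho> (enc_list (rev xs)) (j + l + 50)"
  unfolding Rev_def
  by (rule run_cong, rule run_Foldl[where E = "\<lambda>x. x" and f = "\<lambda>ys. enc_list (rev ys)" and xs = xs and k = 4])
    (use assms run_push in \<open>auto intro!: run_MkLeaf simp del: Arg.simps One_nat_def\<close>)

text \<open>
  The accumulator is a function \<open>f\<close> of the suffix already processed, so \<open>f\<close> can be any function
  defined by recursion on lists.
\<close>
lemma run_Foldr:
  assumes L: "run L \<rho> (enc_list (map E xs)) j" and A: "run A \<rho> (f []) a"
    and F: "\<And>x ys zs. xs = zs @ x # ys \<Longrightarrow> run F (Cell (E x) (Cell (f ys) \<rho>)) (f (x # ys)) k"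
    and len: "length xs \<le> B ^ l"
  shows "run (Foldr L A F) \<rho> (f xs) (j + a + k + 2 * l + 90)"
  unfolding Foldr_def
proof (rule run_cong, rule run_Foldl[where f = "\<lambda>ys. f (rev ys)" and E = E and xs = "rev xs" and k = k])
  show "run (Rev L) \<rho> (enc_list (map E (rev xs))) (j + l + 50)"
    using run_Rev[OF L] len by (simp add: rev_map)
  fix x ys zs assume "rev xs = ys @ x # zs"
  then have "xs = rev zs @ x # rev ys" by (metis append.assoc append_Cons append_Nil rev.simps(2) rev_append rev_rev_ident)
  then show "run F (Cell (E x) (Cell (f (rev ys)) \<rho>)) (f (rev (ys @ [x]))) k"
    using F by simp
qed (use A len in auto)

lemma run_Map:
  assumes L: "run L \<rho> (enc_list (map E xs)) j"
    and F: "\<And>x acc. x \<in> set xs \<Longrightarrow> run F (Cell (E x) (Cell acc \<rho>)) (g x) k"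
    and len: "length xs \<le> B ^ l"
  shows "run (Map L F) \<rho> (enc_list (map g xs)) (j + k + 2 * l + 100)"
proof -
  have "run (Fork F (Arg 1)) (Cell (E x) (Cell acc \<rho>)) (Cell (g x) acc) (k + 4)" if "x \<in> set xs" for x acc
    by (rule run_cong, rule run_Fork, rule F[OF that], rule run_Arg_1) auto
  then show ?thesis unfolding Map_def
    by - (rule run_cong, rule run_Foldr[where f = "\<lambda>ys. enc_list (map g ys)" and E = E and xs = xs and k = "k + 4", OF L _ _ len],
      auto intro!: run_MkLeaf simp del: Arg.simps One_nat_def)
qed

lemma run_Append:
  assumes "run P \<rho> (enc_list xs) j" "run Q \<rho> (enc_list ys) k" "length xs \<le> B ^ l"
  shows "run (Append P Q) \<rho> (enc_list (xs @ ys)) (j + k + 2 * l + 100)"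
  unfolding Append_def
  by (rule run_cong, rule run_Foldr[where f = "\<lambda>us. enc_list (us @ ys)" and E = "\<lambda>x. x" and xs = xs and k = 4])
    (use assms run_push in \<open>auto simp del: Arg.simps One_nat_def\<close>)

lemma run_Flat_map:
  assumes L: "run L \<rho> (enc_list (map E xs)) j"
    and F: "\<And>x acc. x \<in> set xs \<Longrightarrow> run F (Cell (E x) (Cell acc \<rho>)) (enc_list (g x)) k"
    and len: "length xs \<le> B ^ l" "\<And>x. x \<in> set xs \<Longrightarrow> length (g x) \<le> B ^ m"
  shows "run (Flat_map L F) \<rho> (enc_list (concat (map g xs))) (j + k + 2 * l + 2 * m + 200)"
  unfolding Flat_map_def
proof (rule run_cong, rule run_Foldr[where f = "\<lambda>us. enc_list (concat (map g us))" and E = E and xs = xs, OF L _ _ len(1)])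
  fix x ys zs assume "xs = zs @ x # ys"
  then have "x \<in> set xs" by simp
  then show "run (Append F (Arg 1)) (Cell (E x) (Cell (enc_list (concat (map g ys))) \<rho>))
      (enc_list (concat (map g (x # ys)))) (k + 2 + 2 * m + 100)"
    using run_Append[OF F run_Arg_1] len by simp
qed (auto intro!: run_MkLeaf)

lemma run_Upto:
  assumes P: "run P \<rho> (Num (real n)) j" and n: "n \<le> B ^ l"
  shows "run (Upto P) \<rho> (enc_list (map (\<lambda>i. Num (real i)) [0..<n])) (j + l + 50)"
proof -
  let ?P = "Fork (Op Minus Head (Const 1)) (Fork (Op Minus Head (Const 1)) Tail)"
  let ?f = "\<lambda>i. Cell (Num (real (n - i))) (enc_list (map (\<lambda>i. Num (real i)) [n - i..<n]))"
  have loop: "run (Loop Head ?P) (?f 0) (?f n) (0 + 20 + l + 4)"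
  proof (rule run_loop[where s = 1])
    fix i assume i: "i < n"
    then show "exec \<sigma> \<kappa> Head (?f i) (Num (real (n - i))) 1 \<and> holds (Num (real (n - i)))"
      using exec.Head by (simp del: of_nat_diff One_nat_def)
    have "[n - Suc i..<n] = (n - Suc i) # [n - i..<n]"
      using i by (simp add: upt_conv_Cons Suc_diff_Suc)
    moreover have "real (n - i) - 1 = real (n - Suc i)" using i by (simp add: of_nat_diff)
    ultimately show "run ?P (?f i) (?f (Suc i)) 20"
      by - (rule run_cong, (rule run_Fork run_arith run_Head run_Tail run_Const)+, simp_all)
  qed (use n exec.Head in \<open>auto simp del: One_nat_def\<close>)
  show ?thesis unfolding Upto_def
    by (rule run_cong, rule run_Seq, rule run_Seq, rule run_Fork, rule P, rule run_MkLeaf)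
      (use loop in simp, rule run_Tail, auto)
qed

text \<open>
  When the suffix \<open>us\<close> of \<open>xs\<close> has been paired, the last \<open>length us\<close> elements of \<open>ys\<close> are used up.
\<close>
lemma run_Zip:
  assumes P: "run P \<rho> (enc_list xs) j" and Q: "run Q \<rho> (enc_list ys) k"
    and len: "length xs = length ys" "length xs \<le> B ^ l"
  shows "run (Zip P Q) \<rho> (enc_list (map (\<lambda>(x, y). Cell x y) (zip xs ys))) (j + k + 3 * l + 250)"
proof -
  let ?f = "\<lambda>us. Cell (enc_list (rev (take (length ys - length us) ys)))
     (enc_list (map (\<lambda>(x, y). Cell x y) (zip us (drop (length ys - length us) ys))))"
  have "run (Foldr P (Fork (Rev Q) MkLeaf)
     (Fork (Seq (Arg 1) (Seq Head Tail))
           (Fork (Fork (Arg 0) (Seq (Arg 1) (Seq Head Head))) (Seq (Arg 1) Tail)))) \<rho> (?f xs)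
     (j + (k + l + 52) + 50 + 2 * l + 90)"
  proof (rule run_Foldr[where E = "\<lambda>x. x" and f = ?f])
    show "run (Fork (Rev Q) MkLeaf) \<rho> (?f []) (k + l + 52)"
      by (rule run_cong, rule run_Fork, rule run_Rev[OF Q, of l], use len in simp, rule run_MkLeaf) auto
  next
    fix x us zs assume xs: "xs = zs @ x # us"
    define m where "m = length zs"
    have m: "length ys - length us = Suc m" "length ys - length (x # us) = m" "m < length ys"
      using xs len unfolding m_def by auto
    then have t: "rev (take (Suc m) ys) = ys ! m # rev (take m ys)" "drop m ys = ys ! m # drop (Suc m) ys"
      by (simp_all add: take_Suc_conv_app_nth Cons_nth_drop_Suc)
    show "run (Fork (Seq (Arg 1) (Seq Head Tail))
           (Fork (Fork (Arg 0) (Seq (Arg 1) (Seq Head Head))) (Seq (Arg 1) Tail)))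
       (Cell x (Cell (?f us) \<rho>)) (?f (x # us)) 50"
      unfolding m t enc_list_simps
      by (rule run_cong, (rule run_Fork run_Seq run_Arg_1 run_Arg_0 run_Head run_Tail)+) auto
  qed (use P len in auto)
  then show ?thesis unfolding Zip_def
    by - (rule run_cong, rule run_Seq, assumption, rule run_Tail, use len in auto)
qed

end

definition Length :: "prog \<Rightarrow> prog" where
  "Length L = Foldr L (Const 0) (Op Plus (Arg 1) (Const 1))"

text \<open>
  Cutting into pieces of length \<open>b\<close>, from the end of the list on; the pieces come out even when \<open>b\<close>
  divides the length (\<open>chop_concat\<close>).
\<close>
primrec chop :: "nat \<Rightarrow> 'a list \<Rightarrow> 'a list list" where
  "chop b [] = []"
| "chop b (x # xs) = (case chop b xs of
      [] \<Rightarrow> [[x]]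
    | c # cs \<Rightarrow> if length c < b then (x # c) # cs else [x] # c # cs)"

lemma chop_append:
  assumes "length xs = b" "0 < b" "\<forall>c\<in>set (chop b ys). length c = b"
  shows "chop b (xs @ ys) = xs # chop b ys"
proof -
  have "chop b (us @ ys) = us # chop b ys" if "length us \<le> b" "us \<noteq> []" for us
    using that
  proof (induction us)
    case (Cons u us)
    then show ?case using assms by (cases "us = []") (auto split: list.splits)
  qed simp
  then show ?thesis using assms by force
qed

lemma chop_concat:
  assumes "\<forall>xs\<in>set xss. length xs = b" "0 < b"
  shows "chop b (concat xss) = xss"
  using assms(1)
proof (induction xss)
  case (Cons xs xss)
  then show ?case using chop_append[of xs b "concat xss"] assms(2) by simp
qed simp

lemma length_chop: "c \<in> set (chop b xs) \<Longrightarrow> length c \<le> length xs"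
  by (induction xs arbitrary: c) (fastforce split: list.splits if_splits)+

definition Chop :: "prog \<Rightarrow> prog \<Rightarrow> prog" where
  "Chop P L = Bind (Fork P L) (Foldr (Seq (Arg 0) Tail) MkLeaf
     (If_cell (Arg 1)
        (If_less (Length (Seq (Arg 1) Head)) (Seq (Arg 2) Head)
           (Fork (Fork (Arg 0) (Seq (Arg 1) Head)) (Seq (Arg 1) Tail))
           (Fork (Fork (Arg 0) MkLeaf) (Arg 1)))
        (Fork (Fork (Arg 0) MkLeaf) (Arg 1))))"

definition kron :: "real list \<Rightarrow> real list \<Rightarrow> real list" where
  "kron xs ys = concat (map (\<lambda>x. map (\<lambda>y. x * y) ys) xs)"

definition krons :: "real list list \<Rightarrow> real list" where
  "krons zs = foldr kron zs [1]"

lemma krons_simps [simp]: "krons [] = [1]" "krons (z # zs) = kron z (krons zs)"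
  by (simp_all add: krons_def)

definition Krons :: "prog \<Rightarrow> prog" where
  "Krons L = Foldr L (Fork (Const 1) MkLeaf)
     (Flat_map (Arg 0) (Map (Arg 3) (Op Times (Arg 2) (Arg 0))))"

definition dot :: "real list \<Rightarrow> real list \<Rightarrow> real" where
  "dot xs ys = (\<Sum>(x, y)\<leftarrow>zip xs ys. x * y)"

definition Dot :: "prog \<Rightarrow> prog \<Rightarrow> prog" where
  "Dot P Q = Foldr (Zip P Q) (Const 0)
     (Op Plus (Op Times (Seq (Arg 0) Head) (Seq (Arg 0) Tail)) (Arg 1))"

text \<open>
  The linear combination of the rows \<open>bs\<close>, each of length \<open>c\<close>, with coefficients \<open>ws\<close>.
\<close>
definition combine :: "nat \<Rightarrow> real list \<Rightarrow> real list list \<Rightarrow> real list" where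
  "combine c ws bs =
     foldr (\<lambda>(w, b) acc. map (\<lambda>(x, y). w * x + y) (zip b acc)) (zip ws bs) (replicate c 0)"

definition Combine :: "prog \<Rightarrow> prog \<Rightarrow> prog" where
  "Combine P Q = Foldr (Zip P Q) (Map (Seq Q Head) (Const 0))
     (Map (Zip (Seq (Arg 0) Tail) (Arg 1))
        (Op Plus (Op Times (Seq (Arg 2) Head) (Seq (Arg 0) Head)) (Seq (Arg 0) Tail)))"

abbreviation "reals xs \<equiv> enc_list (map Num xs)"

context machine
begin

lemma run_Length:
  assumes "run L \<rho> (enc_list xs) j" "length xs \<le> B ^ l"
  shows "run (Length L) \<rho> (Num (real (length xs))) (j + 2 * l + 100)"
  unfolding Length_def
proof (rule run_cong, rule run_Foldr[where f = "\<lambda>us. Num (real (length us))" and E = "\<lambda>x. x" and xs = xs and k = 6])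
  show "run (Op Plus (Arg 1) (Const 1)) (Cell x (Cell (Num (real (length ys))) \<rho>)) (Num (real (length (x # ys)))) 6"
    for x :: val and ys :: "val list"
    by (rule run_cong, (rule run_arith run_Arg run_Const)+) auto
  show "run (Const 0) \<rho> (Num (real (length []))) 0" using run_Const[of 0] by simp
qed (use assms in auto)

lemma run_Chop:
  assumes P: "run P \<rho> (Num (real b)) j" and L: "run L \<rho> (enc_list (map E xs)) k"
    and len: "length xs \<le> B ^ l"
  shows "run (Chop P L) \<rho> (enc_list (map (\<lambda>c. enc_list (map E c)) (chop b xs))) (j + k + 4 * l + 300)"
proof -
  let ?f = "\<lambda>us. enc_list (map (\<lambda>c. enc_list (map E c)) (chop b us))"
  let ?\<rho> = "Cell (Cell (Num (real b)) (enc_list (map E xs))) \<rho>"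
  show ?thesis unfolding Chop_def
  proof (rule run_cong, rule run_Bind, rule run_Fork, rule P, rule L,
      rule run_Foldr[where f = ?f and xs = xs and E = E, OF _ _ _ len])
    show "run (Seq (Arg 0) Tail) ?\<rho> (enc_list (map E xs)) 2"
      by (rule run_cong, (rule run_Seq run_Arg run_Tail)+) auto
    show "run MkLeaf ?\<rho> (?f []) 0" by (simp add: run_MkLeaf)
  next
    fix x ys zs assume xs: "xs = zs @ x # ys"
    let ?env = "Cell (E x) (Cell (?f ys) ?\<rho>)"
    show "run (If_cell (Arg 1)
        (If_less (Length (Seq (Arg 1) Head)) (Seq (Arg 2) Head)
           (Fork (Fork (Arg 0) (Seq (Arg 1) Head)) (Seq (Arg 1) Tail))
           (Fork (Fork (Arg 0) MkLeaf) (Arg 1)))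
        (Fork (Fork (Arg 0) MkLeaf) (Arg 1))) ?env (?f (x # ys)) (2 * l + 180)"
    proof (cases "chop b ys")
      case Nil
      show ?thesis
        unfolding Nil list.map enc_list_simps
        by (rule run_cong, rule run_If_cell, rule run_Arg, simp, (rule run_Fork run_Arg run_MkLeaf)+)
          (auto simp: Nil)
    next
      case (Cons c cs)
      have "length c \<le> length ys" using Cons length_chop[of c b ys] by simp
      then have "length (map E c) \<le> B ^ l" using xs len by simp
      note Len = run_Length[OF run_Seq[OF run_Arg_1 run_Head] this]
      show ?thesis
        unfolding Cons list.map enc_list_simps
        by (rule run_cong, rule run_If_cell, rule run_Arg, rule run_If_less, rule Len,
            (rule run_Fork run_Arg run_MkLeaf run_Seq run_Head run_Tail)+) (auto simp: Cons)
    qed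
  qed auto
qed

lemma run_Krons:
  assumes L: "run L \<rho> (enc_list (map reals zs)) j" and len: "length zs \<le> B ^ l"
    and vec: "\<And>z. z \<in> set zs \<Longrightarrow> length z \<le> B ^ l"
    and suf: "\<And>us vs. zs = us @ vs \<Longrightarrow> length (krons vs) \<le> B ^ l"
  shows "run (Krons L) \<rho> (reals (krons zs)) (j + 8 * l + 500)"
  unfolding Krons_def
proof (rule run_cong, rule run_Foldr[where f = "\<lambda>us. reals (krons us)" and xs = zs, OF L _ _ len])
  show "run (Fork (Const 1) MkLeaf) \<rho> (reals (krons [])) 2"
    by (rule run_cong, (rule run_Fork run_Const run_MkLeaf)+) auto
  fix z ys us assume zs: "zs = us @ z # ys"
  let ?\<rho> = "Cell (reals z) (Cell (reals (krons ys)) \<rho>)"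
  have k: "length (krons ys) \<le> B ^ l" using suf[of "us @ [z]"] zs by simp
  have "run (Op Times (Arg 2) (Arg 0)) (Cell (Num y) (Cell acc' (Cell (Num x) \<rho>'))) (Num (x * y)) 8" for x y acc' \<rho>'
    by (rule run_cong, (rule run_arith run_Arg)+) auto
  then have "run (Map (Arg 3) (Op Times (Arg 2) (Arg 0))) (Cell (Num x) (Cell acc ?\<rho>))
      (reals (map (\<lambda>y. x * y) (krons ys))) (6 + 8 + 2 * l + 100)" for x acc
    by - (rule run_cong, rule run_Map[where g = "\<lambda>y. Num (x * y)", OF run_Arg_3 _ k], auto simp: comp_def)
  then show "run (Flat_map (Arg 0) (Map (Arg 3) (Op Times (Arg 2) (Arg 0)))) ?\<rho>
      (reals (krons (z # ys))) (6 * l + 320)"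
    by - (rule run_cong, rule run_Flat_map[where g = "\<lambda>x. map Num (map (\<lambda>y. x * y) (krons ys))"
          and l = l and m = l, OF run_Arg_0], use k vec zs in \<open>auto simp: kron_def map_concat comp_def\<close>)
qed auto

lemma run_Zip_map:
  assumes "run P \<rho> (enc_list (map E xs)) j" "run Q \<rho> (enc_list (map E' ys)) k"
    "length xs = length ys" "length xs \<le> B ^ l"
  shows "run (Zip P Q) \<rho> (enc_list (map (\<lambda>(x, y). Cell (E x) (E' y)) (zip xs ys))) (j + k + 3 * l + 250)"
  using run_Zip[OF assms(1,2), of l] assms(3,4) by (simp add: zip_map_map split_def comp_def)

lemma run_Dot:
  assumes "run P \<rho> (reals xs) j" "run Q \<rho> (reals ys) k" "length xs = length ys" "length xs \<le> B ^ l"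
  shows "run (Dot P Q) \<rho> (Num (dot xs ys)) (j + k + 5 * l + 400)"
  unfolding Dot_def
proof (rule run_cong, rule run_Foldr[where f = "\<lambda>us. Num (\<Sum>(x, y)\<leftarrow>us. x * y)" and xs = "zip xs ys", OF run_Zip_map])
  show "run (Const 0) \<rho> (Num (\<Sum>(x, y)\<leftarrow>[]. x * y)) 0" using run_Const[of 0] by simp
  fix p :: "real \<times> real" and us zs
  show "run (Op Plus (Op Times (Seq (Arg 0) Head) (Seq (Arg 0) Tail)) (Arg 1))
      (Cell ((\<lambda>(x, y). Cell (Num x) (Num y)) p) (Cell (Num (\<Sum>(x, y)\<leftarrow>us. x * y)) \<rho>))
      (Num (\<Sum>(x, y)\<leftarrow>p # us. x * y)) 20"
    by (cases p) (simp only: prod.case,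
      rule run_cong, (rule run_arith run_Seq run_Arg run_Head run_Tail)+, auto)
qed (use assms in \<open>auto simp: dot_def\<close>)

lemma length_combine:
  "\<forall>b\<in>set bs. length b = c \<Longrightarrow> length (combine c ws bs) = c"
proof (induction bs arbitrary: ws)
  case (Cons b bs)
  then show ?case by (cases ws) (auto simp: combine_def)
qed (auto simp: combine_def)

lemma run_Combine:
  assumes P: "run P \<rho> (reals ws) j" and Q: "run Q \<rho> (enc_list (map reals bs)) k"
    and len: "length ws = length bs" "length ws \<le> B ^ l" "bs \<noteq> []"
    and c: "\<forall>b\<in>set bs. length b = c" "c \<le> B ^ l"
  shows "run (Combine P Q) \<rho> (reals (combine c ws bs)) (j + 2 * k + 12 * l + 900)"
proof -
  let ?f = "\<lambda>ps. reals (foldr (\<lambda>(w, b) acc. map (\<lambda>(x, y). w * x + y) (zip b acc)) ps (replicate c 0))"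
  have f: "length (foldr (\<lambda>(w, b) acc. map (\<lambda>(x, y). w * x + y) (zip b acc)) ps (replicate c 0)) = c"
    if "\<forall>p\<in>set ps. length (snd p) = c" for ps :: "(real \<times> real list) list"
    using that by (induction ps) auto
  show ?thesis unfolding Combine_def
  proof (rule run_cong, rule run_Foldr[where f = ?f and xs = "zip ws bs", OF run_Zip_map[OF P Q]])
    obtain b0 bs' where bs: "bs = b0 # bs'" using len(3) by (cases bs) auto
    have "run (Seq Q Head) \<rho> (reals (hd bs)) (k + 2)"
      by (rule run_cong, rule run_Seq, rule Q[unfolded bs list.map enc_list_simps], rule run_Head)
        (auto simp: bs)
    then show "run (Map (Seq Q Head) (Const 0)) \<rho> (?f []) (k + 2 * l + 120)"
      by - (rule run_cong, rule run_Map[where g = "\<lambda>x. Num 0"], assumption,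
        use run_Const[of 0] c len in \<open>auto simp: map_replicate_const\<close>)
  next
    fix p ps zs assume ps: "zip ws bs = zs @ p # ps"
    obtain w b where p: "p = (w, b)" by fastforce
    have sub: "set (p # ps) \<subseteq> set (zip ws bs)" using ps by auto
    have *: "length (snd q) = c" if "q \<in> set (p # ps)" for q
    proof -
      have "(fst q, snd q) \<in> set (zip ws bs)" using sub that by auto
      then show ?thesis using c(1) set_zip_rightD by fast
    qed
    have b: "length b = c" using *[of p] p by simp
    have "\<forall>p\<in>set ps. length (snd p) = c" using * by simp
    note f = f[OF this]
    let ?acc = "foldr (\<lambda>(w, b) acc. map (\<lambda>(x, y). w * x + y) (zip b acc)) ps (replicate c 0)"
    let ?\<rho> = "Cell (Cell (Num w) (reals b)) (Cell (reals ?acc) \<rho>)"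
    have Z: "run (Zip (Seq (Arg 0) Tail) (Arg 1)) ?\<rho>
       (enc_list (map (\<lambda>(x, y). Cell (Num x) (Num y)) (zip b ?acc))) (2 + 2 + 3 * l + 250)"
      by (rule run_cong, rule run_Zip_map[OF run_Seq[OF run_Arg_0 run_Tail] run_Arg_1])
        (use b f c(2) in auto)
    have "run (Op Plus (Op Times (Seq (Arg 2) Head) (Seq (Arg 0) Head)) (Seq (Arg 0) Tail))
       (Cell (Cell (Num x) (Num y)) (Cell a ?\<rho>)) (Num (w * x + y)) 30" for x y a
      by (rule run_cong, (rule run_arith run_Seq run_Arg run_Head run_Tail)+) auto
    then have "run (Map (Zip (Seq (Arg 0) Tail) (Arg 1))
        (Op Plus (Op Times (Seq (Arg 2) Head) (Seq (Arg 0) Head)) (Seq (Arg 0) Tail))) ?\<rho>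
        (?f ((w, b) # ps)) (5 * l + 400)"
      by - (rule run_cong, rule run_Map[where g = "\<lambda>(x, y). Num (w * x + y)" and k = 30 and l = l, OF Z],
          use b f c(2) in \<open>auto simp: split_def comp_def\<close>)
    then show "run (Map (Zip (Seq (Arg 0) Tail) (Arg 1))
        (Op Plus (Op Times (Seq (Arg 2) Head) (Seq (Arg 0) Head)) (Seq (Arg 0) Tail)))
        (Cell ((\<lambda>(x, y). Cell (Num x) (reals y)) p) (Cell (?f ps) \<rho>)) (?f (p # ps)) (5 * l + 400)"
      unfolding p by simp
  qed (use len in \<open>auto simp: combine_def\<close>)
qed

end

section \<open>The elements of H3 as admissibly rounded vectors\<close>

text \<open>
  The squares that the entries of a vector in \<open>Z_set\<close> may have.  The exponents below \<open>s\<close> suffice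
  when \<open>\<alpha> + 1 \<le> \<beta>\<close>, because then \<open>\<beta>^s > \<alpha> s\<close>.
\<close>
definition levels :: "real \<Rightarrow> real \<Rightarrow> nat \<Rightarrow> real list" where
  "levels \<alpha> \<beta> s = map (\<lambda>k. \<beta> ^ k) (filter (\<lambda>k. \<beta> ^ k < \<alpha> * real s) [0..<s])"

definition count_sq :: "real \<Rightarrow> real list \<Rightarrow> nat" where
  "count_sq u z = length (filter (\<lambda>b. b * b = u) z)"

text \<open>
  Growing a vector by one entry of square \<open>u\<close>, unless this would exceed the capacity
  \<open>\<alpha> s / u\<close> of that square.  Checking the capacities at every step keeps the intermediate lists
  small: the bound on their length holds for incomplete vectors as well.
\<close>
definition extensions :: "real \<Rightarrow> real \<Rightarrow> nat \<Rightarrow> real list \<Rightarrow> real \<Rightarrow> real list list" where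
  "extensions \<alpha> \<beta> s z u = (if \<alpha> * real s < (real (count_sq u z) + 1) * u then []
     else [sqrt u # z, - sqrt u # z])"

primrec z_list :: "real \<Rightarrow> real \<Rightarrow> nat \<Rightarrow> nat \<Rightarrow> real list list" where
  "z_list \<alpha> \<beta> s 0 = [[]]"
| "z_list \<alpha> \<beta> s (Suc i) =
     concat (map (\<lambda>z. concat (map (extensions \<alpha> \<beta> s z) (levels \<alpha> \<beta> s))) (z_list \<alpha> \<beta> s i))"

lemma length_z_list_elem: "z \<in> set (z_list \<alpha> \<beta> s i) \<Longrightarrow> length z = i"
  by (induction i arbitrary: z) (auto simp: extensions_def split: if_splits)

definition normalise :: "real list \<Rightarrow> real list" where
  "normalise z = map (\<lambda>b. b / sqrt (dot z z)) z"

definition h3_list :: "real \<Rightarrow> real \<Rightarrow> nat \<Rightarrow> real list list" where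
  "h3_list \<alpha> \<beta> s = map normalise (z_list \<alpha> \<beta> s s)"

definition block_size :: "nat \<Rightarrow> nat" where
  "block_size n = nat \<lceil>ln (real n)\<rceil>"

definition pad :: "nat \<Rightarrow> nat \<Rightarrow> real list \<Rightarrow> real list" where
  "pad n i h = replicate i 0 @ h @ replicate (n - i - length h) 0"

text \<open>
  The block that starts at \<open>i\<close> has length \<open>block_size n\<close> unless it reaches beyond \<open>n\<close>; treating
  both cases by a minimum covers the two parts of \<open>H5\<close> at once.
\<close>
definition h5_block :: "real \<Rightarrow> real \<Rightarrow> nat \<Rightarrow> nat \<Rightarrow> real list list" where
  "h5_block \<alpha> \<beta> n i = (if i < n then map (pad n i) (h3_list \<alpha> \<beta> (min (block_size n) (n - i))) else [])"

definition h5_list :: "real \<Rightarrow> real \<Rightarrow> nat \<Rightarrow> real list list" where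
  "h5_list \<alpha> \<beta> n = concat (map (\<lambda>j. h5_block \<alpha> \<beta> n (j * block_size n)) [0..<n])"

text \<open>
  Serves to fill up the parts of a partition with indices that are still free.
\<close>
lemma disjoint_subsets_of_sizes:
  fixes e :: "'k \<Rightarrow> nat"
  assumes "finite K" "finite S" "(\<Sum>k\<in>K. e k) \<le> card S"
  obtains J where "\<And>k. k \<in> K \<Longrightarrow> J k \<subseteq> S \<and> card (J k) = e k" "disjoint_family_on J K"
proof -
  have "\<exists>J. (\<forall>k\<in>K. J k \<subseteq> S \<and> card (J k) = e k) \<and> disjoint_family_on J K"
    using assms(1,3)
  proof (induction K rule: finite_induct)
    case empty
    show ?case by (simp add: disjoint_family_on_def)
  next
    case (insert k K)
    then obtain J where J: "\<forall>k\<in>K. J k \<subseteq> S \<and> card (J k) = e k" "disjoint_family_on J K"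
      by auto
    have "card (\<Union>k\<in>K. J k) \<le> (\<Sum>k\<in>K. card (J k))" by (rule card_UN_le) fact
    also have "\<dots> = (\<Sum>k\<in>K. e k)" using J by simp
    finally have "e k \<le> card S - card (\<Union>k\<in>K. J k)" using insert by simp
    moreover have "card S - card (\<Union>k\<in>K. J k) = card (S - (\<Union>k\<in>K. J k))"
      using J assms(2) by (intro card_Diff_subset[symmetric]) (auto intro: finite_subset)
    ultimately obtain T where T: "T \<subseteq> S - (\<Union>k\<in>K. J k)" "card T = e k"
      by (metis obtain_subset_with_card_n)
    have disj: "disjoint_family_on (J(k := T)) (insert k K)"
      unfolding disjoint_family_on_def
    proof (intro ballI impI)
      fix i j assume ij: "i \<in> insert k K" "j \<in> insert k K" "i \<noteq> j"
      have "J i \<inter> J j = {}" if "i \<in> K" "j \<in> K"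
        using J(2) that ij(3) unfolding disjoint_family_on_def by simp
      then show "(J(k := T)) i \<inter> (J(k := T)) j = {}" using T ij by auto
    qed
    have sub: "\<forall>i\<in>insert k K. (J(k := T)) i \<subseteq> S \<and> card ((J(k := T)) i) = e i"
    proof
      fix i assume "i \<in> insert k K"
      then show "(J(k := T)) i \<subseteq> S \<and> card ((J(k := T)) i) = e i"
        using J(1) T insert(2) by (cases "i = k") auto
    qed
    show ?case by (rule exI[of _ "J(k := T)"], rule conjI, fact sub, fact disj)
  qed
  then show ?thesis using that by blast
qed

lemma sum_inverse_powers:
  fixes \<beta> :: real
  assumes "1 < \<beta>"
  shows "(\<Sum>k<m. 1 / \<beta> ^ Suc k) \<le> 1 / (\<beta> - 1)"
proof -
  have "(\<Sum>k<m. 1 / \<beta> ^ Suc k) = (1 - 1 / \<beta> ^ m) / (\<beta> - 1)"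
  proof (induction m)
    case (Suc m)
    have "(1 - 1 / q) / (\<beta> - 1) + 1 / (\<beta> * q) = (1 - 1 / (\<beta> * q)) / (\<beta> - 1)" if "0 < q" for q
      using assms that by (simp add: divide_simps) (simp add: algebra_simps)
    from this[of "\<beta> ^ m"] show ?case using Suc assms by simp
  qed simp
  also have "\<dots> \<le> 1 / (\<beta> - 1)" using assms by (intro divide_right_mono) auto
  finally show ?thesis .
qed

lemma powr_half_squared: "0 < (\<beta>::real) \<Longrightarrow> 1 \<le> k \<Longrightarrow> (\<beta> powr ((real k - 1) / 2))\<^sup>2 = \<beta> ^ (k - 1)"
proof -
  assume "0 < \<beta>" "1 \<le> k"
  have "(\<beta> powr ((real k - 1) / 2))\<^sup>2 = \<beta> powr ((real k - 1) / 2 + (real k - 1) / 2)"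
    by (simp only: power2_eq_square powr_add)
  also have "(real k - 1) / 2 + (real k - 1) / 2 = real (k - 1)"
    using \<open>1 \<le> k\<close> by (simp add: of_nat_diff)
  finally show ?thesis using \<open>0 < \<beta>\<close> by (simp only: powr_realpow)
qed

lemma square_cases: "(y::real) \<in> {1, -1, w, - w} \<longleftrightarrow> y\<^sup>2 = 1 \<or> y\<^sup>2 = w\<^sup>2"
  by (auto simp: power2_eq_iff power2_eq_1_iff)

text \<open>
  The condition on \<open>\<beta>\<close> makes the prescribed sizes of the parts from the second on sum to at most
  \<open>n\<close> (\<open>sum_capacities\<close>), so that admissible partitions exist.
\<close>
locale partition_parameters =
  fixes \<alpha> \<beta> :: real
  assumes \<alpha>: "1 < \<alpha>" and \<beta>: "\<alpha> + 1 \<le> \<beta>"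
begin

text \<open>By Bernoulli's inequality, \<open>\<beta>^k \<ge> (1 + \<alpha>)^k \<ge> 1 + k \<alpha>\<close>.\<close>
lemma power_less_imp_index_less:
  assumes "\<beta> ^ k < \<alpha> * real n"
  shows "k < n"
proof (rule ccontr)
  assume "\<not> k < n"
  have "1 + real k * \<alpha> \<le> (1 + \<alpha>) ^ k" using \<alpha> by (intro Bernoulli_inequality) auto
  also have "\<dots> \<le> \<beta> ^ k" using \<alpha> \<beta> by (intro power_mono) auto
  finally have "1 + real k * \<alpha> < \<alpha> * real n" using assms by simp
  moreover have "\<alpha> * real n \<le> real k * \<alpha>" using \<open>\<not> k < n\<close> \<alpha> by simp
  ultimately show False by simp
qed

lemma set_levels: "set (levels \<alpha> \<beta> n) = {\<beta> ^ k |k. \<beta> ^ k < \<alpha> * real n}"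
  using power_less_imp_index_less by (force simp: levels_def)

lemma one_less_scaled_dimension: "0 < n \<Longrightarrow> 1 < \<alpha> * real n"
  using less_le_trans[OF \<alpha>, of "\<alpha> * real n"] \<alpha> by simp

lemma one_in_levels: "0 < n \<Longrightarrow> 1 \<in> set (levels \<alpha> \<beta> n)"
  unfolding set_levels using one_less_scaled_dimension[of n] by (intro CollectI exI[of _ 0]) simp

lemma le_num_levels_iff:
  assumes "0 < n" "0 < k"
  shows "k \<le> num_levels \<alpha> \<beta> n \<longleftrightarrow> \<beta> ^ (k - 1) < \<alpha> * real n"
proof -
  have "k \<le> num_levels \<alpha> \<beta> n \<longleftrightarrow> real k - 1 < log \<beta> (\<alpha> * real n)"
  proof -
    have "k \<le> nat c \<longleftrightarrow> int k \<le> c" for c using assms(2) by arith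
    then show ?thesis unfolding num_levels_def by (simp add: le_ceiling_iff)
  qed
  also have "\<dots> \<longleftrightarrow> \<beta> powr real (k - 1) < \<alpha> * real n"
  proof -
    have "real k - 1 = real (k - 1)" using assms(2) by (simp add: of_nat_diff)
    moreover have "1 < \<beta>" "0 < \<alpha> * real n" using \<alpha> \<beta> assms(1) by simp_all
    ultimately show ?thesis by (simp only: less_log_iff)
  qed
  also have "\<beta> powr real (k - 1) = \<beta> ^ (k - 1)" using \<alpha> \<beta> by (intro powr_realpow) simp
  finally show ?thesis .
qed

lemma sum_capacities:
  "(\<Sum>k=2..m. nat \<lfloor>\<alpha> * real n / \<beta> ^ (k - 1)\<rfloor>) \<le> n"
proof -
  have "real (\<Sum>k=2..m. nat \<lfloor>\<alpha> * real n / \<beta> ^ (k - 1)\<rfloor>) \<le> (\<Sum>k=2..m. \<alpha> * real n / \<beta> ^ (k - 1))"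
    unfolding of_nat_sum using \<alpha> \<beta> by (intro sum_mono) (simp add: of_nat_floor)
  also have "\<dots> = (\<Sum>k<m - 1. \<alpha> * real n / \<beta> ^ Suc k)"
    by (rule sum.reindex_bij_witness[of _ "\<lambda>k. k + 2" "\<lambda>k. k - 2"]) (auto simp: numeral_2_eq_2 Suc_diff_Suc)
  also have "\<dots> = \<alpha> * real n * (\<Sum>k<m - 1. 1 / \<beta> ^ Suc k)"
    by (simp add: sum_distrib_left)
  also have "\<dots> \<le> \<alpha> * real n * (1 / (\<beta> - 1))"
    using \<alpha> \<beta> by (intro mult_left_mono sum_inverse_powers) auto
  also have "\<dots> \<le> real n"
    using \<alpha> \<beta> mult_right_mono[of \<alpha> "\<beta> - 1" "real n"] by (simp add: field_simps)
  finally show ?thesis by linarith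
qed

text \<open>
  Membership in \<open>Z_set\<close> without partitions.  An index of part \<open>k\<close> may also carry the entry
  \<open>\<plusminus>1\<close>, so only upper bounds matter: at most \<open>\<alpha> n / u\<close> entries may have the square \<open>u\<close>, and for
  \<open>u = 1\<close> this bound is void.
\<close>
definition balanced :: "nat \<Rightarrow> real vec \<Rightarrow> bool" where
  "balanced n z \<longleftrightarrow> (\<forall>i<n. (z $ i)\<^sup>2 \<in> set (levels \<alpha> \<beta> n)) \<and>
     (\<forall>u\<in>set (levels \<alpha> \<beta> n). real (card {i. i < n \<and> (z $ i)\<^sup>2 = u}) * u \<le> \<alpha> * real n)"

text \<open>
  An entry whose square is \<open>\<beta>^k\<close> with \<open>k \<ge> 1\<close> can only sit in part \<open>k + 1\<close>, whose size is the
  capacity rounded down.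
\<close>
lemma Z_set_balanced:
  assumes n: "0 < n" and z: "z \<in> Z_set \<alpha> \<beta> n"
  shows "balanced n z"
proof -
  define m where "m = num_levels \<alpha> \<beta> n"
  from z obtain I where I: "admissible_partition \<alpha> \<beta> n I" "z \<in> Z_part \<alpha> \<beta> n I"
    by (auto simp: Z_set_def)
  have U: "(\<Union>k\<in>{1..m}. I k) = {..<n}" and c: "\<And>k. k \<in> {2..m} \<Longrightarrow> int (card (I k)) = \<lfloor>\<alpha> * real n / \<beta> ^ (k - 1)\<rfloor>"
    using I(1) by (auto simp: admissible_partition_def Let_def m_def)
  have sq: "(z $ i)\<^sup>2 = 1 \<or> (z $ i)\<^sup>2 = \<beta> ^ (k - 1)" if "k \<in> {1..m}" "i \<in> I k" for i k
  proof -
    have "z $ i \<in> {1, -1, \<beta> powr ((real k - 1) / 2), - (\<beta> powr ((real k - 1) / 2))}"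
      using I(2) that unfolding Z_part_def m_def by blast
    moreover have "(\<beta> powr ((real k - 1) / 2))\<^sup>2 = \<beta> ^ (k - 1)"
      using \<alpha> \<beta> that by (intro powr_half_squared) auto
    ultimately show ?thesis unfolding square_cases by simp
  qed
  have "(z $ i)\<^sup>2 \<in> set (levels \<alpha> \<beta> n)" if "i < n" for i
  proof -
    have "i \<in> (\<Union>k\<in>{1..m}. I k)" unfolding U using that by simp
    then obtain k where k: "k \<in> {1..m}" "i \<in> I k" by (elim UN_E)
    then have "\<beta> ^ (k - 1) < \<alpha> * real n"
      using le_num_levels_iff[of n k] n unfolding m_def by simp
    then have "\<beta> ^ (k - 1) \<in> set (levels \<alpha> \<beta> n)" unfolding set_levels by blast
    moreover note sq[OF k] one_in_levels[OF n]
    ultimately show ?thesis by metis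
  qed
  moreover have "real (card {i. i < n \<and> (z $ i)\<^sup>2 = u}) * u \<le> \<alpha> * real n"
    if "u \<in> set (levels \<alpha> \<beta> n)" for u
  proof -
    from that obtain k where k: "u = \<beta> ^ k" "\<beta> ^ k < \<alpha> * real n" by (auto simp: set_levels)
    show ?thesis
    proof (cases "k = 0")
      case True
      have "card {i. i < n \<and> (z $ i)\<^sup>2 = u} \<le> card {..<n}" by (rule card_mono) auto
      also have "real \<dots> \<le> \<alpha> * real n" using \<alpha> mult_right_mono[of 1 \<alpha> "real n"] by simp
      finally show ?thesis using True k by simp
    next
      case False
      then have Sk: "Suc k \<in> {2..m}" using k le_num_levels_iff[of n "Suc k"] n by (auto simp: m_def)
      have "{i. i < n \<and> (z $ i)\<^sup>2 = u} \<subseteq> I (Suc k)"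
      proof
        fix i assume "i \<in> {i. i < n \<and> (z $ i)\<^sup>2 = u}"
        then have i: "i < n" "(z $ i)\<^sup>2 = \<beta> ^ k" using k by auto
        then have "i \<in> (\<Union>k\<in>{1..m}. I k)" unfolding U by simp
        then obtain k' where k': "k' \<in> {1..m}" "i \<in> I k'" by (elim UN_E)
        have "\<beta> ^ k \<noteq> \<beta> ^ 0" using \<alpha> \<beta> False by (subst power_inject_exp) auto
        then have "\<beta> ^ k = \<beta> ^ (k' - 1)" using sq[OF k'] i by auto
        then have "k = k' - 1" using \<alpha> \<beta> by (subst (asm) power_inject_exp) auto
        then show "i \<in> I (Suc k)" using k' by auto
      qed
      moreover have "finite (I (Suc k))"
      proof (rule finite_subset)
        show "I (Suc k) \<subseteq> {..<n}" unfolding U[symmetric] using Sk by (intro UN_upper) simp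
      qed simp
      ultimately have "real (card {i. i < n \<and> (z $ i)\<^sup>2 = u}) \<le> real (card (I (Suc k)))"
        by (simp add: card_mono)
      also have "real (card (I (Suc k))) = of_int \<lfloor>\<alpha> * real n / \<beta> ^ k\<rfloor>"
        using arg_cong[OF c[OF Sk], of real_of_int] by simp
      also have "\<dots> \<le> \<alpha> * real n / \<beta> ^ k" by simp
      finally show ?thesis using k \<alpha> \<beta> pos_le_divide_eq[of "\<beta> ^ k"] by simp
    qed
  qed
  ultimately show ?thesis by (simp add: balanced_def)
qed

text \<open>
  Let \<open>D k\<close> consist of the indices whose entry has square \<open>\<beta>^(k - 1)\<close>.  For \<open>k \<ge> 2\<close> this is too
  small to be part \<open>k\<close>, and it is filled up with indices from \<open>D 1\<close>, whose entries \<open>\<plusminus>1\<close> are allowed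
  everywhere.  There are enough of them since all capacities together do not exceed \<open>n\<close>.
\<close>
lemma balanced_Z_set:
  assumes n: "0 < n" and z: "z \<in> carrier_vec n" "balanced n z"
  shows "z \<in> Z_set \<alpha> \<beta> n"
proof -
  define m where "m = num_levels \<alpha> \<beta> n"
  define D where "D k = {i. i < n \<and> (z $ i)\<^sup>2 = \<beta> ^ (k - 1)}" for k
  define c where "c k = nat \<lfloor>\<alpha> * real n / \<beta> ^ (k - 1)\<rfloor>" for k
  have m: "1 \<le> m" using le_num_levels_iff[of n 1] n one_less_scaled_dimension[OF n] by (simp add: m_def)
  have lev: "\<beta> ^ (k - 1) \<in> set (levels \<alpha> \<beta> n)" if "k \<in> {1..m}" for k
  proof -
    have "\<beta> ^ (k - 1) < \<alpha> * real n"
      using le_num_levels_iff[of n k] n that unfolding m_def by simp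
    then show ?thesis unfolding set_levels by blast
  qed
  have D_le: "card (D k) \<le> c k" if "k \<in> {1..m}" for k
  proof -
    have "real (card (D k)) * \<beta> ^ (k - 1) \<le> \<alpha> * real n"
      using z(2) lev[OF that] by (auto simp: balanced_def D_def)
    then have "real (card (D k)) \<le> \<alpha> * real n / \<beta> ^ (k - 1)"
      using \<alpha> \<beta> pos_le_divide_eq[of "\<beta> ^ (k - 1)"] by simp
    then show ?thesis unfolding c_def by linarith
  qed
  have D_disj: "disjoint_family_on D {1..m}"
  proof -
    have "k = k'" if "k \<in> {1..m}" "k' \<in> {1..m}" "i \<in> D k" "i \<in> D k'" for i k k'
    proof -
      have "\<beta> ^ (k - 1) = \<beta> ^ (k' - 1)" using that by (auto simp: D_def)
      then have "k - 1 = k' - 1" using \<alpha> \<beta> by (subst (asm) power_inject_exp) auto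
      then show ?thesis using that by auto
    qed
    then show ?thesis unfolding disjoint_family_on_def by blast
  qed
  have D_Un: "(\<Union>k\<in>{1..m}. D k) = {..<n}"
  proof -
    have "\<exists>k\<in>{1..m}. i \<in> D k" if "i < n" for i
    proof -
      obtain k where k: "(z $ i)\<^sup>2 = \<beta> ^ k" "\<beta> ^ k < \<alpha> * real n"
        using z(2) \<open>i < n\<close> by (auto simp: balanced_def set_levels)
      then have "Suc k \<in> {1..m}" using le_num_levels_iff[of n "Suc k"] n by (auto simp: m_def)
      then show ?thesis using k that by (intro bexI[of _ "Suc k"]) (auto simp: D_def)
    qed
    then show ?thesis by (auto simp: D_def)
  qed
  have fin: "finite (D k)" for k by (simp add: D_def)
  have split: "{1..m} = insert 1 {2..m}" using m by auto
  have "card (D 1) + (\<Sum>k=2..m. card (D k)) = (\<Sum>k\<in>{1..m}. card (D k))"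
    unfolding split by simp
  also have "\<dots> = card (\<Union>k\<in>{1..m}. D k)"
    using D_disj fin unfolding disjoint_family_on_def by (intro card_UN_disjoint[symmetric]) blast+
  finally have cD: "card (D 1) + (\<Sum>k=2..m. card (D k)) = n" using D_Un by simp
  have "(\<Sum>k=2..m. c k - card (D k)) = (\<Sum>k=2..m. c k) - (\<Sum>k=2..m. card (D k))"
    by (intro sum_subtractf_nat) (use D_le in auto)
  then have e: "(\<Sum>k=2..m. c k - card (D k)) \<le> card (D 1)"
    using cD sum_capacities[of n m] unfolding c_def by linarith
  obtain J where J: "\<And>k. k \<in> {2..m} \<Longrightarrow> J k \<subseteq> D 1 \<and> card (J k) = c k - card (D k)"
      and J_disj: "disjoint_family_on J {2..m}"
    using disjoint_subsets_of_sizes[OF _ fin e] by blast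
  define I where "I k = (if k = 1 then D 1 - (\<Union>k\<in>{2..m}. J k) else D k \<union> J k)" for k
  have D1: "D k \<inter> D 1 = {}" if "k \<in> {2..m}" for k
    using D_disj that by (auto simp: disjoint_family_on_def)
  have Ik: "I k = D k \<union> J k" if "k \<in> {2..m}" for k using that by (auto simp: I_def)
  have I_disj: "disjoint_family_on I {1..m}"
  proof -
    have "I k \<inter> I k' = {}" if "k \<in> {2..m}" "k' \<in> {2..m}" "k \<noteq> k'" for k k'
    proof -
      have "D k \<inter> D k' = {}" using that D_disj unfolding disjoint_family_on_def by simp
      moreover have "J k \<inter> J k' = {}" using that J_disj unfolding disjoint_family_on_def by simp
      moreover have "J k \<subseteq> D 1" "J k' \<subseteq> D 1" using J that by blast+
      moreover have "I k = D k \<union> J k" "I k' = D k' \<union> J k'" using that by (simp_all only: Ik)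
      ultimately show ?thesis using D1[OF that(1)] D1[OF that(2)] by blast
    qed
    moreover have "I 1 \<inter> I k = {}" if "k \<in> {2..m}" for k
    proof -
      have "I k = D k \<union> J k" using that by (auto simp: I_def)
      then show ?thesis using that D1[OF that] by (auto simp: I_def)
    qed
    ultimately show ?thesis unfolding split disjoint_family_on_def by blast
  qed
  have I_Un: "(\<Union>k\<in>{1..m}. I k) = {..<n}"
  proof -
    have "(\<Union>k\<in>{1..m}. I k) = (\<Union>k\<in>{1..m}. D k)"
    proof -
      have "(\<Union>k\<in>{2..m}. I k) = (\<Union>k\<in>{2..m}. D k \<union> J k)"
        by (intro SUP_cong refl Ik)
      then have "(\<Union>k\<in>{2..m}. I k) = (\<Union>k\<in>{2..m}. D k) \<union> (\<Union>k\<in>{2..m}. J k)"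
        by (simp only: UN_Un_distrib)
      moreover have "(\<Union>k\<in>{2..m}. J k) \<subseteq> D 1" by (rule UN_least) (use J in blast)
      moreover have "I 1 = D 1 - (\<Union>k\<in>{2..m}. J k)" by (simp add: I_def)
      moreover have "(X - Y) \<union> (Z \<union> Y) = X \<union> Z" if "Y \<subseteq> X" for X Y Z :: "nat set"
        using that by blast
      ultimately show ?thesis unfolding split UN_insert by simp
    qed
    then show ?thesis using D_Un by simp
  qed
  have I_card: "card (I k) = c k" if "k \<in> {2..m}" for k
  proof -
    have "card (I k) = card (D k) + card (J k)"
    proof -
      have "J k \<subseteq> D 1" using J[OF that] by simp
      then have "card (D k \<union> J k) = card (D k) + card (J k)"
        using D1[OF that] fin finite_subset[OF _ fin] by (intro card_Un_disjoint) blast+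
      then show ?thesis using that by (simp add: I_def)
    qed
    then show ?thesis using J[OF that] D_le[of k] that by auto
  qed
  have finI: "finite (I k)" if "k \<in> {1..m}" for k
  proof -
    have "I k \<subseteq> {..<n}" unfolding I_Un[symmetric] using that by (rule UN_upper)
    then show ?thesis by (rule finite_subset) simp
  qed
  have "card (\<Union>k\<in>{1..m}. I k) = (\<Sum>k\<in>{1..m}. card (I k))"
    using I_disj finI unfolding disjoint_family_on_def by (intro card_UN_disjoint) blast+
  also have "\<dots> = card (I 1) + (\<Sum>k=2..m. card (I k))" unfolding split by simp
  finally have I1: "n = card (I 1) + (\<Sum>k=2..m. card (I k))" using I_Un by simp
  then have I1': "int (card (I 1)) = int n - (\<Sum>k=2..m. int (card (I k)))"
    by (metis add_diff_cancel_right' of_nat_add of_nat_sum)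
  have "admissible_partition \<alpha> \<beta> n I"
    unfolding admissible_partition_def Let_def m_def[symmetric]
  proof (intro conjI ballI)
    fix k assume "k \<in> {2..m}"
    then show "int (card (I k)) = \<lfloor>\<alpha> * real n / \<beta> ^ (k - 1)\<rfloor>"
      using I_card[of k] \<alpha> \<beta> by (simp add: c_def)
  qed (fact I_disj I_Un I1')+
  moreover have "z \<in> Z_part \<alpha> \<beta> n I"
  proof -
    have *: "(z $ i)\<^sup>2 = 1 \<or> (z $ i)\<^sup>2 = \<beta> ^ (k - 1)" if "k \<in> {1..m}" "i \<in> I k" for i k
    proof (cases "k = 1")
      case True
      then show ?thesis using that by (simp add: I_def D_def)
    next
      case False
      then have "k \<in> {2..m}" using that by auto
      then have "J k \<subseteq> D 1" "i \<in> D k \<union> J k" using J[of k] Ik[of k] that by auto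
      then show ?thesis by (auto simp: D_def)
    qed
    have "z $ i \<in> {1, -1, \<beta> powr ((real k - 1) / 2), - (\<beta> powr ((real k - 1) / 2))}"
      if "k \<in> {1..m}" "i \<in> I k" for i k
    proof -
      have "(\<beta> powr ((real k - 1) / 2))\<^sup>2 = \<beta> ^ (k - 1)"
        using \<alpha> \<beta> that by (intro powr_half_squared) auto
      then show ?thesis unfolding square_cases using *[OF that] by simp
    qed
    then show ?thesis using z(1) by (auto simp: Z_part_def m_def)
  qed
  ultimately show ?thesis by (auto simp: Z_set_def)
qed

lemma Z_set_eq: "0 < n \<Longrightarrow> Z_set \<alpha> \<beta> n = {z \<in> carrier_vec n. balanced n z}"
  using Z_set_balanced balanced_Z_set by (auto simp: Z_set_def Z_part_def)

end

section \<open>Listing H3 and H5\<close>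

lemma dot_conv_sum: "length xs = length ys \<Longrightarrow> dot xs ys = (\<Sum>i<length xs. xs ! i * ys ! i)"
  unfolding dot_def by (simp add: sum_list_sum_nth split_def atLeast0LessThan)

lemma dot_conv_scalar_prod:
  "length xs = length ys \<Longrightarrow> dot xs ys = vec_of_list xs \<bullet> vec_of_list ys"
  by (simp add: dot_conv_sum scalar_prod_def vec_of_list_index atLeast0LessThan)

lemma scalar_prod_conv_sum: "y \<in> carrier_vec n \<Longrightarrow> x \<bullet> y = (\<Sum>i<n. x $ i * y $ i)"
  by (auto simp: scalar_prod_def atLeast0LessThan)

lemma vnorm_nonneg [simp]: "0 \<le> vnorm x"
  by (simp add: vnorm_def scalar_prod_def sum_nonneg)

lemma vnorm_squared: "(vnorm x)\<^sup>2 = x \<bullet> x"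
  by (simp add: vnorm_def scalar_prod_def sum_nonneg)

lemma count_sq_Cons: "count_sq u (b # z) = (if b * b = u then Suc (count_sq u z) else count_sq u z)"
  by (simp add: count_sq_def)

lemma mem_extensions:
  assumes "0 \<le> u"
  shows "x \<in> set (extensions \<alpha> \<beta> s z u) \<longleftrightarrow>
    (\<exists>b. x = b # z \<and> b * b = u \<and> (real (count_sq u z) + 1) * u \<le> \<alpha> * real s)"
proof -
  have "b * b = u \<longleftrightarrow> b = sqrt u \<or> b = - sqrt u" for b
  proof
    assume "b * b = u"
    then have "b\<^sup>2 = (sqrt u)\<^sup>2" using assms by (simp add: power2_eq_square)
    then show "b = sqrt u \<or> b = - sqrt u" by (simp only: power2_eq_iff)
  qed (use assms in auto)
  then show ?thesis by (auto simp: extensions_def)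
qed

lemma vec_of_list_pad_index:
  "i < n \<Longrightarrow> a + length h \<le> n \<Longrightarrow>
     vec_of_list (pad n a h) $ i = (if a \<le> i \<and> i < a + length h then h ! (i - a) else 0)"
  by (auto simp: vec_of_list_index pad_def nth_append)

lemma length_pad: "a + length h \<le> n \<Longrightarrow> length (pad n a h) = n"
  by (simp add: pad_def)

lemma scalar_prod_pad:
  assumes "a + length h \<le> n"
  shows "x \<bullet> vec_of_list (pad n a h) = (\<Sum>i<length h. x $ (a + i) * h ! i)"
proof -
  have c: "vec_of_list (pad n a h) \<in> carrier_vec n"
    using length_pad[OF assms] by (intro carrier_vecI) simp
  have "x \<bullet> vec_of_list (pad n a h) = (\<Sum>i<n. x $ i * vec_of_list (pad n a h) $ i)"
    by (rule scalar_prod_conv_sum[OF c])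
  also have "\<dots> = (\<Sum>i<n. if i \<in> {a..<a + length h} then x $ i * h ! (i - a) else 0)"
    using assms by (intro sum.cong) (auto simp: vec_of_list_pad_index)
  also have "\<dots> = (\<Sum>i\<in>{..<n} \<inter> {a..<a + length h}. x $ i * h ! (i - a))"
    by (rule sum.inter_restrict[symmetric]) simp
  also have "{..<n} \<inter> {a..<a + length h} = {a..<a + length h}" using assms by auto
  also have "(\<Sum>i\<in>{a..<a + length h}. x $ i * h ! (i - a)) = (\<Sum>i<length h. x $ (a + i) * h ! i)"
    by (rule sum.reindex_bij_witness[of _ "\<lambda>i. a + i" "\<lambda>i. i - a"]) auto
  finally show ?thesis .
qed

lemma block_size_bounds:
  assumes "2 \<le> n"
  shows "0 < block_size n" "block_size n \<le> n" "ln (real n) \<le> block_size n" "block_size n \<le> ln (real n) + 1"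
proof -
  have p: "0 < ln (real n)" using assms by simp
  have "ln (real n) \<le> real n" using assms ln_bound by simp
  then show "0 < block_size n" "block_size n \<le> n" "ln (real n) \<le> block_size n" "block_size n \<le> ln (real n) + 1"
    using p unfolding block_size_def by linarith+
qed

lemma set_h5_list:
  assumes "2 \<le> n"
  shows "set (h5_list \<alpha> \<beta> n) = {pad n (j * block_size n) h |j h. j * block_size n < n \<and>
    h \<in> set (h3_list \<alpha> \<beta> (min (block_size n) (n - j * block_size n)))}"
proof -
  have "j < n" if "j * block_size n < n" for j
  proof -
    have "j * 1 \<le> j * block_size n" using block_size_bounds(1)[OF assms] by (intro mult_le_mono2) simp
    then show ?thesis using that by linarith
  qed
  note small = this
  have "x \<in> set (h5_list \<alpha> \<beta> n) \<longleftrightarrow> (\<exists>j<n. j * block_size n < n \<and>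
      (\<exists>h\<in>set (h3_list \<alpha> \<beta> (min (block_size n) (n - j * block_size n))). x = pad n (j * block_size n) h))" for x
    unfolding h5_list_def h5_block_def by (auto simp: image_iff split: if_splits)
  then show ?thesis using small by blast
qed

lemma geometric_half: "(\<Sum>k<s. c ^ k) \<le> 2" if "0 \<le> c" "c \<le> 1 / 2" for c :: real
proof -
  have "(\<Sum>k<s. c ^ k) \<le> (\<Sum>k<s. (1 / 2) ^ k)"
    using that by (intro sum_mono power_mono)
  also have "\<dots> = 2 - 2 * (1 / 2) ^ s" by (induction s) auto
  also have "\<dots> \<le> 2" by simp
  finally show ?thesis .
qed

context partition_parameters
begin

lemma levels_pos: "u \<in> set (levels \<alpha> \<beta> n) \<Longrightarrow> 0 < u"
  using \<alpha> \<beta> by (auto simp: levels_def)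

text \<open>
  Only the capacity of the new square has to be checked, the other counts being unchanged.
\<close>
lemma Cons_in_z_list:
  "b # z \<in> set (z_list \<alpha> \<beta> n (Suc i)) \<longleftrightarrow> z \<in> set (z_list \<alpha> \<beta> n i) \<and> b * b \<in> set (levels \<alpha> \<beta> n) \<and>
     (real (count_sq (b * b) z) + 1) * (b * b) \<le> \<alpha> * real n"
proof -
  have "x \<in> set (extensions \<alpha> \<beta> n z u) \<longleftrightarrow>
    (\<exists>b. x = b # z \<and> b * b = u \<and> (real (count_sq u z) + 1) * u \<le> \<alpha> * real n)"
    if "u \<in> set (levels \<alpha> \<beta> n)" for x z u
    by (rule mem_extensions) (use levels_pos[OF that] in simp)
  note ext = this
  have "b # z \<in> set (z_list \<alpha> \<beta> n (Suc i)) \<longleftrightarrow>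
      (\<exists>z'\<in>set (z_list \<alpha> \<beta> n i). \<exists>u\<in>set (levels \<alpha> \<beta> n). b # z \<in> set (extensions \<alpha> \<beta> n z' u))"
    by simp
  also have "\<dots> \<longleftrightarrow> (\<exists>z'\<in>set (z_list \<alpha> \<beta> n i). \<exists>u\<in>set (levels \<alpha> \<beta> n).
      z' = z \<and> b * b = u \<and> (real (count_sq u z) + 1) * u \<le> \<alpha> * real n)"
    by (intro bex_cong refl) (auto simp only: ext list.inject)
  also have "\<dots> \<longleftrightarrow> z \<in> set (z_list \<alpha> \<beta> n i) \<and> b * b \<in> set (levels \<alpha> \<beta> n) \<and>
     (real (count_sq (b * b) z) + 1) * (b * b) \<le> \<alpha> * real n"
    by blast
  finally show ?thesis .
qed

lemma in_z_list_iff: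
  "z \<in> set (z_list \<alpha> \<beta> n i) \<longleftrightarrow> length z = i \<and> (\<forall>b\<in>set z. b * b \<in> set (levels \<alpha> \<beta> n)) \<and>
     (\<forall>u\<in>set (levels \<alpha> \<beta> n). real (count_sq u z) * u \<le> \<alpha> * real n)"
proof (induction z arbitrary: i)
  case Nil
  show ?case using \<alpha> length_z_list_elem[of "[]" \<alpha> \<beta> n i] by (cases i) (auto simp: count_sq_def)
next
  case (Cons b z)
  let ?L = "set (levels \<alpha> \<beta> n)"
  have *: "(\<forall>u\<in>?L. real (count_sq u (b # z)) * u \<le> \<alpha> * real n) \<longleftrightarrow>
      (\<forall>u\<in>?L. real (count_sq u z) * u \<le> \<alpha> * real n) \<and>
      (real (count_sq (b * b) z) + 1) * (b * b) \<le> \<alpha> * real n" if L: "b * b \<in> ?L"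
  proof (intro iffI conjI ballI)
    assume A: "\<forall>u\<in>?L. real (count_sq u (b # z)) * u \<le> \<alpha> * real n"
    show "(real (count_sq (b * b) z) + 1) * (b * b) \<le> \<alpha> * real n"
      using A[rule_format, OF L] by (simp add: count_sq_Cons algebra_simps)
    fix u assume u: "u \<in> ?L"
    have "real (count_sq u z) * u \<le> real (count_sq u (b # z)) * u"
      using levels_pos[OF u] by (intro mult_right_mono) (auto simp: count_sq_Cons)
    also have "\<dots> \<le> \<alpha> * real n" using A u by blast
    finally show "real (count_sq u z) * u \<le> \<alpha> * real n" .
  next
    fix u assume A: "(\<forall>u\<in>?L. real (count_sq u z) * u \<le> \<alpha> * real n) \<and>
      (real (count_sq (b * b) z) + 1) * (b * b) \<le> \<alpha> * real n" and u: "u \<in> ?L"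
    show "real (count_sq u (b # z)) * u \<le> \<alpha> * real n"
    proof (cases "b * b = u")
      case True
      then show ?thesis using A by (simp add: count_sq_Cons algebra_simps)
    next
      case False
      then show ?thesis using A u by (simp add: count_sq_Cons)
    qed
  qed
  show ?case
  proof (cases i)
    case 0
    then show ?thesis by simp
  next
    case (Suc j)
    show ?thesis unfolding Suc Cons_in_z_list Cons.IH using * by auto
  qed
qed

lemma dot_self_pos:
  assumes "0 < n" "z \<in> set (z_list \<alpha> \<beta> m n)"
  shows "0 < dot z z"
proof -
  have z: "length z = n" "\<forall>b\<in>set z. b * b \<in> set (levels \<alpha> \<beta> m)" using assms by (simp_all add: in_z_list_iff)
  have "0 < z ! i * z ! i" if "i < n" for i using z that levels_pos nth_mem by blast
  then show ?thesis using z assms(1) unfolding dot_conv_sum[OF refl] by (intro sum_pos) auto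
qed

lemma Z_set_z_list:
  assumes "0 < n"
  shows "Z_set \<alpha> \<beta> n = vec_of_list ` set (z_list \<alpha> \<beta> n n)"
proof -
  have bal: "balanced n (vec_of_list z) \<longleftrightarrow> z \<in> set (z_list \<alpha> \<beta> n n)" if "length z = n" for z
  proof -
    have "count_sq u z = card {i. i < n \<and> (vec_of_list z $ i)\<^sup>2 = u}" for u
      unfolding count_sq_def length_filter_conv_card
      using that by (simp add: vec_of_list_index power2_eq_square)
    then show ?thesis using that
      unfolding balanced_def in_z_list_iff by (simp add: vec_of_list_index power2_eq_square all_set_conv_all_nth)
  qed
  show ?thesis unfolding Z_set_eq[OF assms]
  proof (intro equalityI subsetI)
    fix z assume z: "z \<in> {z \<in> carrier_vec n. balanced n z}"
    then have "list_of_vec z \<in> set (z_list \<alpha> \<beta> n n)" using bal[of "list_of_vec z"] by (simp add: vec_list)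
    then show "z \<in> vec_of_list ` set (z_list \<alpha> \<beta> n n)"
      by (intro image_eqI[of _ _ "list_of_vec z"]) (simp_all add: vec_list)
  next
    fix z assume "z \<in> vec_of_list ` set (z_list \<alpha> \<beta> n n)"
    then obtain xs where xs: "xs \<in> set (z_list \<alpha> \<beta> n n)" "z = vec_of_list xs" by blast
    then have "length xs = n" by (simp add: in_z_list_iff)
    then show "z \<in> {z \<in> carrier_vec n. balanced n z}" using xs bal[of xs] by (auto intro: carrier_vecI)
  qed
qed

lemma H3_h3_list:
  assumes "0 < n"
  shows "H3 \<alpha> \<beta> n = vec_of_list ` set (h3_list \<alpha> \<beta> n)"
proof -
  have "(1 / vnorm (vec_of_list z)) \<cdot>\<^sub>v vec_of_list z = vec_of_list (normalise z)" for z
    unfolding normalise_def vnorm_def dot_conv_scalar_prod[OF refl]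
    by (rule eq_vecI) (auto simp: vec_of_list_index)
  moreover have "H3 \<alpha> \<beta> n = (\<lambda>z. (1 / vnorm z) \<cdot>\<^sub>v z) ` Z_set \<alpha> \<beta> n" by (auto simp: H3_def)
  ultimately show ?thesis
    unfolding h3_list_def set_map Z_set_z_list[OF assms] by (simp add: image_image)
qed

lemma H3_unit:
  assumes "0 < n" "h \<in> set (h3_list \<alpha> \<beta> n)"
  shows "dot h h = 1"
proof -
  obtain z where z: "z \<in> set (z_list \<alpha> \<beta> n n)" "h = normalise z" using assms by (auto simp: h3_list_def)
  have p: "0 < dot z z" by (rule dot_self_pos[OF assms(1) z(1)])
  have "dot h h = (\<Sum>i<length z. (z ! i * z ! i) / dot z z)"
    using p by (simp add: z(2) normalise_def dot_conv_sum[of "map f z" "map f z" for f])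
  also have "\<dots> = dot z z / dot z z" unfolding sum_divide_distrib[symmetric] by (simp add: dot_conv_sum)
  finally show ?thesis using p by simp
qed

text \<open>
  With \<open>n = q p + r\<close>, the blocks starting at \<open>j p\<close> for \<open>j < q\<close> give the Kronecker products with unit
  vectors, and the block starting at \<open>q p\<close>, which is present only if \<open>r > 0\<close>, gives the second part.
\<close>
lemma H5_h5_list:
  assumes n: "2 \<le> n"
  shows "H5 \<alpha> \<beta> n = vec_of_list ` set (h5_list \<alpha> \<beta> n)"
proof -
  define p q r where "p = block_size n" and "q = n div p" and "r = n - p * q"
  have p: "0 < p" using block_size_bounds[OF n] by (simp add: p_def)
  have nqr: "n = q * p + r" "r < p"
    using p by (simp_all add: q_def r_def mult.commute minus_mult_div_eq_mod)
  have lenp: "length h = s" if "h \<in> set (h3_list \<alpha> \<beta> s)" for h s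
    using that by (auto simp: h3_list_def normalise_def length_z_list_elem)
  have unit: "(unit_vec q j \<boxtimes> vec_of_list h) @\<^sub>v 0\<^sub>v r = vec_of_list (pad n (j * p) h)"
    if "j < q" "length h = p" for j h
  proof -
    have jp: "j * p + p \<le> q * p" using that mult_le_mono1[of "Suc j" q p] by simp
    show ?thesis
    proof (rule eq_vecI)
      show "dim_vec ((unit_vec q j \<boxtimes> vec_of_list h) @\<^sub>v 0\<^sub>v r) = dim_vec (vec_of_list (pad n (j * p) h))"
        using jp that nqr by (simp add: kron_vec_def length_pad)
      fix i assume "i < dim_vec (vec_of_list (pad n (j * p) h))"
      then have i: "i < n" using jp that nqr by (simp add: length_pad)
      have R: "vec_of_list (pad n (j * p) h) $ i = (if j * p \<le> i \<and> i < j * p + p then h ! (i - j * p) else 0)"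
        using i jp that nqr by (subst vec_of_list_pad_index) auto
      show "((unit_vec q j \<boxtimes> vec_of_list h) @\<^sub>v 0\<^sub>v r) $ i = vec_of_list (pad n (j * p) h) $ i"
      proof (cases "i < q * p")
        case True
        then have "i div p < q" using p by (simp add: less_mult_imp_div_less)
        moreover have "j * p \<le> i \<and> i < j * p + p \<longleftrightarrow> i div p = j"
          using p by (metis add.commute div_nat_eqI dividend_less_div_times div_mult_mod_eq le_add1 mult.commute mult_Suc)
        moreover have "i mod p = i - j * p" if "i div p = j"
          using that by (simp add: minus_div_mult_eq_mod[symmetric])
        ultimately show ?thesis using True that i nqr unfolding R
          by (auto simp: kron_vec_def unit_vec_def vec_of_list_index)
      next
        case False
        then show ?thesis using that i nqr jp unfolding R by (auto simp: kron_vec_def)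
      qed
    qed
  qed
  have last: "0\<^sub>v (p * q) @\<^sub>v vec_of_list h = vec_of_list (pad n (q * p) h)" if "length h = r" for h
  proof (rule eq_vecI)
    have le: "q * p + length h \<le> n" using that nqr by simp
    have dim: "dim_vec (vec_of_list (pad n (q * p) h)) = n" using length_pad[OF le] by simp
    show "dim_vec (0\<^sub>v (p * q) @\<^sub>v vec_of_list h) = dim_vec (vec_of_list (pad n (q * p) h))"
      unfolding dim using that nqr(1) by (simp add: mult.commute)
    fix i assume "i < dim_vec (vec_of_list (pad n (q * p) h))"
    then have i: "i < n" unfolding dim .
    then have "i < q * p + length h" using that nqr(1) by simp
    then show "(0\<^sub>v (p * q) @\<^sub>v vec_of_list h) $ i = vec_of_list (pad n (q * p) h) $ i"
      unfolding vec_of_list_pad_index[OF i le] by (auto simp: mult.commute[of p q] vec_of_list_index)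
  qed
  have "H5 \<alpha> \<beta> n =
     {(e \<boxtimes> h) @\<^sub>v 0\<^sub>v r |e h. e \<in> set (unit_vecs q) \<and> h \<in> H3 \<alpha> \<beta> p} \<union>
        (if r = 0 then {} else {0\<^sub>v (p * q) @\<^sub>v h |h. h \<in> H3 \<alpha> \<beta> r})"
    unfolding H5_def Let_def p_def q_def r_def block_size_def ..
  also have "{(e \<boxtimes> h) @\<^sub>v 0\<^sub>v r |e h. e \<in> set (unit_vecs q) \<and> h \<in> H3 \<alpha> \<beta> p} =
      {vec_of_list (pad n (j * p) h) |j h. j < q \<and> h \<in> set (h3_list \<alpha> \<beta> p)}"
  proof -
    have "{(e \<boxtimes> h) @\<^sub>v 0\<^sub>v r |e h. e \<in> set (unit_vecs q) \<and> h \<in> H3 \<alpha> \<beta> p} =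
      {(unit_vec q j \<boxtimes> vec_of_list h) @\<^sub>v 0\<^sub>v r |j h. j < q \<and> h \<in> set (h3_list \<alpha> \<beta> p)}"
      unfolding H3_h3_list[OF p] unit_vecs_def by fastforce
    also have "\<dots> = {vec_of_list (pad n (j * p) h) |j h. j < q \<and> h \<in> set (h3_list \<alpha> \<beta> p)}"
      using unit lenp by (intro Collect_cong ex_cong1) auto
    finally show ?thesis .
  qed
  also have "(if r = 0 then {} else {0\<^sub>v (p * q) @\<^sub>v h |h. h \<in> H3 \<alpha> \<beta> r}) =
      {vec_of_list (pad n (q * p) h) |h. 0 < r \<and> h \<in> set (h3_list \<alpha> \<beta> r)}"
  proof (cases "r = 0")
    case False
    then have "{0\<^sub>v (p * q) @\<^sub>v h |h. h \<in> H3 \<alpha> \<beta> r} = {0\<^sub>v (p * q) @\<^sub>v vec_of_list h |h. h \<in> set (h3_list \<alpha> \<beta> r)}"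
      using H3_h3_list[of r] by auto
    also have "\<dots> = {vec_of_list (pad n (q * p) h) |h. h \<in> set (h3_list \<alpha> \<beta> r)}"
      using last lenp by (intro Collect_cong ex_cong1) auto
    finally show ?thesis using False by simp
  qed simp
  also have "{vec_of_list (pad n (j * p) h) |j h. j < q \<and> h \<in> set (h3_list \<alpha> \<beta> p)} \<union>
      {vec_of_list (pad n (q * p) h) |h. 0 < r \<and> h \<in> set (h3_list \<alpha> \<beta> r)} =
      {vec_of_list (pad n (j * p) h) |j h. j * p < n \<and> h \<in> set (h3_list \<alpha> \<beta> (min p (n - j * p)))}"
  proof -
    have cases: "j * p < n \<and> h \<in> set (h3_list \<alpha> \<beta> (min p (n - j * p))) \<longleftrightarrow>
      j < q \<and> h \<in> set (h3_list \<alpha> \<beta> p) \<or> j = q \<and> 0 < r \<and> h \<in> set (h3_list \<alpha> \<beta> r)" for j h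
    proof (cases j q rule: linorder_cases)
      case less
      then have "j * p + p \<le> q * p" using mult_le_mono1[of "Suc j" q p] by simp
      then have "j * p < n" "min p (n - j * p) = p" using nqr p by auto
      then show ?thesis using less by simp
    next
      case equal
      then show ?thesis using nqr by (auto simp: min_def)
    next
      case greater
      then have "q * p + p \<le> j * p" using mult_le_mono1[of "Suc q" j p] by simp
      then show ?thesis using greater nqr by simp
    qed
    show ?thesis unfolding cases by blast
  qed
  finally show ?thesis unfolding set_h5_list[OF n] p_def[symmetric] by blast
qed

lemma H5_subset_sphere:
  assumes n: "2 \<le> n"
  shows "H5 \<alpha> \<beta> n \<subseteq> sphere n"
proof
  fix x assume "x \<in> H5 \<alpha> \<beta> n"
  then obtain j h where x: "x = vec_of_list (pad n (j * block_size n) h)" "j * block_size n < n"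
      and h: "h \<in> set (h3_list \<alpha> \<beta> (min (block_size n) (n - j * block_size n)))"
    unfolding H5_h5_list[OF n] set_h5_list[OF n] by blast
  have len: "length h = min (block_size n) (n - j * block_size n)"
    using h by (auto simp: h3_list_def normalise_def length_z_list_elem)
  then have le: "j * block_size n + length h \<le> n" using x by simp
  have "x \<bullet> x = (\<Sum>i<length h. x $ (j * block_size n + i) * h ! i)"
    unfolding x(1) by (rule scalar_prod_pad[OF le])
  also have "\<dots> = (\<Sum>i<length h. h ! i * h ! i)"
    using le unfolding x(1) by (intro sum.cong refl) (subst vec_of_list_pad_index, auto)
  also have "\<dots> = dot h h" by (simp add: dot_conv_sum)
  also have "\<dots> = 1" using H3_unit[OF _ h] x(2) block_size_bounds[OF n] by simp
  finally show "x \<in> sphere n" using length_pad[OF le] by (auto simp: sphere_def vnorm_def x(1) intro: carrier_vecI)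
qed

lemma inverse_sqrt_le_half: "1 / sqrt \<beta> \<le> 1 / 2" if "4 \<le> \<beta>"
proof -
  have "sqrt 4 \<le> sqrt \<beta>" using that by (intro real_sqrt_le_mono)
  then show ?thesis by (intro frac_le) auto
qed

text \<open>
  At most \<open>\<alpha> s / u\<close> entries have the absolute value \<open>sqrt u\<close>, so they contribute at most
  \<open>\<alpha> s / sqrt u\<close>; over the powers of \<open>\<beta> \<ge> 4\<close> this is a geometric series of ratio at most 1/2.
\<close>
lemma sum_abs_z_list:
  assumes "z \<in> set (z_list \<alpha> \<beta> s i)" "4 \<le> \<beta>"
  shows "(\<Sum>b\<leftarrow>z. \<bar>b\<bar>) \<le> 2 * \<alpha> * real s"
proof -
  let ?L = "set (levels \<alpha> \<beta> s)"
  have z: "\<forall>b\<in>set z. b * b \<in> ?L" "\<forall>u\<in>?L. real (count_sq u z) * u \<le> \<alpha> * real s"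
    using assms(1) by (simp_all add: in_z_list_iff)
  have "(\<Sum>b\<leftarrow>z. \<bar>b\<bar>) = (\<Sum>u\<in>?L. real (count_sq u z) * sqrt u)"
    using z(1)
  proof (induction z)
    case Nil
    show ?case by (simp add: count_sq_def)
  next
    case (Cons b z)
    have "(\<Sum>u\<in>?L. real (count_sq u (b # z)) * sqrt u) =
        (\<Sum>u\<in>?L. real (count_sq u z) * sqrt u + (if b * b = u then sqrt u else 0))"
      by (intro sum.cong refl) (simp add: count_sq_Cons algebra_simps)
    also have "\<dots> = (\<Sum>u\<in>?L. real (count_sq u z) * sqrt u) + sqrt (b * b)"
      using Cons.prems by (simp add: sum.distrib sum.delta)
    finally show ?case using Cons by simp
  qed
  also have "\<dots> \<le> (\<Sum>u\<in>?L. \<alpha> * real s * (1 / sqrt u))"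
  proof (rule sum_mono)
    fix u assume u: "u \<in> ?L"
    have "real (count_sq u z) * sqrt u = real (count_sq u z) * u * (1 / sqrt u)"
      using levels_pos[OF u] by (simp add: field_simps)
    also have "\<dots> \<le> \<alpha> * real s * (1 / sqrt u)"
      using z(2) u levels_pos[OF u] by (intro mult_right_mono) auto
    finally show "real (count_sq u z) * sqrt u \<le> \<alpha> * real s * (1 / sqrt u)" .
  qed
  also have "\<dots> = \<alpha> * real s * (\<Sum>u\<in>?L. 1 / sqrt u)" by (simp add: sum_distrib_left)
  also have "(\<Sum>u\<in>?L. 1 / sqrt u) \<le> (\<Sum>k<s. (1 / sqrt \<beta>) ^ k)"
  proof -
    have L: "?L = (\<lambda>k. \<beta> ^ k) ` {k \<in> {..<s}. \<beta> ^ k < \<alpha> * real s}" by (auto simp: levels_def)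
    have "inj_on (\<lambda>k. \<beta> ^ k) {k \<in> {..<s}. \<beta> ^ k < \<alpha> * real s}"
    proof (rule inj_onI)
      fix j k assume "\<beta> ^ j = \<beta> ^ k"
      then show "j = k" using \<alpha> \<beta> by (subst (asm) power_inject_exp) auto
    qed
    then have "(\<Sum>u\<in>?L. 1 / sqrt u) = (\<Sum>k\<in>{k \<in> {..<s}. \<beta> ^ k < \<alpha> * real s}. 1 / sqrt (\<beta> ^ k))"
      unfolding L by (simp add: sum.reindex)
    also have "\<dots> = (\<Sum>k\<in>{k \<in> {..<s}. \<beta> ^ k < \<alpha> * real s}. (1 / sqrt \<beta>) ^ k)"
      by (simp add: real_sqrt_power power_one_over)
    also have "\<dots> \<le> (\<Sum>k<s. (1 / sqrt \<beta>) ^ k)"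
      using \<alpha> \<beta> by (intro sum_mono2) auto
    finally show ?thesis .
  qed
  also have "\<dots> \<le> 2" using inverse_sqrt_le_half assms(2) by (intro geometric_half) auto
  finally show ?thesis using \<alpha> by (simp add: mult_left_mono)
qed

text \<open>
  Weigh a vector by the product of the inverse squares of its entries.  The two signs and the
  possible squares \<open>u\<close> multiply the total weight by at most \<open>2 * (\<Sum> 1 / u) \<le> 4\<close> per entry.
\<close>
lemma sum_weights_z_list:
  assumes "2 \<le> \<beta>"
  shows "(\<Sum>z\<leftarrow>z_list \<alpha> \<beta> s i. \<Prod>b\<leftarrow>z. 1 / (b * b)) \<le> 4 ^ i"
proof (induction i)
  case 0
  show ?case by simp
next
  case (Suc i)
  let ?w = "\<lambda>z. \<Prod>b\<leftarrow>z. 1 / (b * b) :: real"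
  have w: "0 \<le> ?w z" for z by (induction z) auto
  have inv: "(\<Sum>u\<leftarrow>levels \<alpha> \<beta> s. 1 / u) \<le> 2"
  proof -
    have "(\<Sum>u\<leftarrow>levels \<alpha> \<beta> s. 1 / u) = (\<Sum>k\<leftarrow>filter (\<lambda>k. \<beta> ^ k < \<alpha> * real s) [0..<s]. (1 / \<beta>) ^ k)"
      by (simp add: levels_def comp_def power_one_over)
    also have "\<dots> = (\<Sum>k\<in>{k \<in> {..<s}. \<beta> ^ k < \<alpha> * real s}. (1 / \<beta>) ^ k)"
      by (subst sum_list_distinct_conv_sum_set) (auto intro: sum.cong)
    also have "\<dots> \<le> (\<Sum>k<s. (1 / \<beta>) ^ k)" using assms by (intro sum_mono2) auto
    also have "\<dots> \<le> 2" using assms by (intro geometric_half) (auto simp: field_simps)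
    finally show ?thesis .
  qed
  have ext: "(\<Sum>x\<leftarrow>extensions \<alpha> \<beta> s z u. ?w x) \<le> 2 * ?w z * (1 / u)" if "u \<in> set (levels \<alpha> \<beta> s)" for z u
    using levels_pos[OF that] w[of z] by (auto simp: extensions_def)
  have concat: "(\<Sum>x\<leftarrow>concat (map g xs). f x) = (\<Sum>y\<leftarrow>xs. \<Sum>x\<leftarrow>g y. f x)"
    for f :: "real list \<Rightarrow> real" and g :: "'x \<Rightarrow> real list list" and xs
    by (induction xs) auto
  have step: "(\<Sum>x\<leftarrow>concat (map (extensions \<alpha> \<beta> s z) (levels \<alpha> \<beta> s)). ?w x) \<le> 4 * ?w z" for z
  proof -
    have "(\<Sum>x\<leftarrow>concat (map (extensions \<alpha> \<beta> s z) (levels \<alpha> \<beta> s)). ?w x) \<le>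
        (\<Sum>u\<leftarrow>levels \<alpha> \<beta> s. 2 * ?w z * (1 / u))"
      unfolding concat by (intro sum_list_mono ext)
    also have "\<dots> = 2 * ?w z * (\<Sum>u\<leftarrow>levels \<alpha> \<beta> s. 1 / u)" by (rule sum_list_const_mult)
    also have "\<dots> \<le> 2 * ?w z * 2" using w[of z] inv by (intro mult_left_mono) auto
    finally show ?thesis by simp
  qed
  have "(\<Sum>z\<leftarrow>z_list \<alpha> \<beta> s (Suc i). ?w z) \<le> (\<Sum>z\<leftarrow>z_list \<alpha> \<beta> s i. 4 * ?w z)"
    unfolding z_list.simps concat[of ?w "\<lambda>z. concat (map (extensions \<alpha> \<beta> s z) (levels \<alpha> \<beta> s))"]
    by (intro sum_list_mono step)
  also have "\<dots> = 4 * (\<Sum>z\<leftarrow>z_list \<alpha> \<beta> s i. ?w z)" by (rule sum_list_const_mult)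
  finally show ?case using Suc by simp
qed

text \<open>
  No weight is small: since \<open>b * b \<le> exp (2 * \<bar>b\<bar>)\<close>, it is at least \<open>exp\<close> of minus twice the sum
  of the absolute values.  Dividing the total weight by the least weight bounds the number of
  vectors.
\<close>
lemma length_z_list_le_exp:
  assumes "4 \<le> \<beta>"
  shows "real (length (z_list \<alpha> \<beta> s i)) \<le> 4 ^ i * exp (4 * \<alpha> * real s)"
proof -
  have "exp (- 4 * \<alpha> * real s) \<le> (\<Prod>b\<leftarrow>z. 1 / (b * b))" if z: "z \<in> set (z_list \<alpha> \<beta> s i)" for z
  proof -
    have nz: "\<forall>b\<in>set z. b \<noteq> 0" using z levels_pos by (fastforce simp: in_z_list_iff)
    have le: "exp (- 2 * \<bar>b\<bar>) \<le> 1 / (b * b)" if "b \<noteq> 0" for b :: real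
    proof -
      have "\<bar>b\<bar> \<le> exp \<bar>b\<bar>" using exp_ge_add_one_self[of "\<bar>b\<bar>"] by linarith
      then have "\<bar>b\<bar> * \<bar>b\<bar> \<le> exp \<bar>b\<bar> * exp \<bar>b\<bar>" by (intro mult_mono) auto
      then have "b * b \<le> exp (2 * \<bar>b\<bar>)" by (simp add: exp_add[symmetric] flip: abs_mult)
      then have "1 / exp (2 * \<bar>b\<bar>) \<le> 1 / (b * b)" using that by (intro divide_left_mono) (auto simp: zero_less_mult_iff)
      then show ?thesis by (simp add: exp_minus inverse_eq_divide)
    qed
    have "exp (- 4 * \<alpha> * real s) \<le> exp (- 2 * (\<Sum>b\<leftarrow>z. \<bar>b\<bar>))"
      using sum_abs_z_list[OF z assms] by simp
    also have "\<dots> \<le> (\<Prod>b\<leftarrow>z. 1 / (b * b))"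
      using nz
    proof (induction z)
      case (Cons b z)
      have "exp (- 2 * (\<Sum>b\<leftarrow>b # z. \<bar>b\<bar>)) = exp (- 2 * \<bar>b\<bar>) * exp (- 2 * (\<Sum>b\<leftarrow>z. \<bar>b\<bar>))"
        by (simp add: algebra_simps flip: exp_add)
      also have "\<dots> \<le> 1 / (b * b) * (\<Prod>b\<leftarrow>z. 1 / (b * b))"
        using Cons le[of b] by (intro mult_mono) auto
      finally show ?case by simp
    qed simp
    finally show ?thesis .
  qed
  then have "(\<Sum>z\<leftarrow>z_list \<alpha> \<beta> s i. exp (- 4 * \<alpha> * real s)) \<le> (\<Sum>z\<leftarrow>z_list \<alpha> \<beta> s i. \<Prod>b\<leftarrow>z. 1 / (b * b))"
    by (intro sum_list_mono)
  also have "\<dots> \<le> 4 ^ i" using assms by (intro sum_weights_z_list) simp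
  finally have "real (length (z_list \<alpha> \<beta> s i)) * exp (- (4 * \<alpha> * real s)) \<le> 4 ^ i"
    by (simp add: sum_list_triv)
  then show ?thesis by (simp add: exp_minus field_simps)
qed

text \<open>
  With \<open>s \<le> ln n + 1\<close> and \<open>4 \<le> exp 2\<close> the exponential bound is at most
  \<open>exp (19 s) \<le> n^19 * exp 19\<close>, and \<open>exp 19 \<le> 4^19 = 2^38 \<le> n^38\<close>.
\<close>
lemma length_z_list_le_power:
  assumes "4 \<le> \<beta>" "\<alpha> \<le> 17 / 4" "2 \<le> n" "s \<le> block_size n" "i \<le> s"
  shows "length (z_list \<alpha> \<beta> s i) \<le> n ^ 57"
proof -
  have e1: "2 \<le> exp (1::real)" using exp_ge_add_one_self[of 1] by simp
  then have "2 * 2 \<le> exp (1::real) * exp 1" by (intro mult_mono) auto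
  then have e2: "4 \<le> exp (2::real)" by (simp flip: exp_add)
  have s: "real s \<le> ln (real n) + 1"
    using block_size_bounds(4)[OF assms(3)] assms(4) by (meson le_trans of_nat_le_iff order_trans)
  have "(4::real) ^ i \<le> 4 ^ s" using assms(5) by (intro power_increasing) auto
  also have "\<dots> \<le> exp 2 ^ s" using e2 by (intro power_mono) auto
  also have "\<dots> = exp (2 * real s)" by (simp add: exp_of_nat_mult[symmetric] mult.commute)
  finally have "(4::real) ^ i * exp (4 * \<alpha> * real s) \<le> exp (2 * real s) * exp (17 * real s)"
    using assms(2) by (intro mult_mono) (auto intro!: mult_right_mono)
  also have "\<dots> = exp (19 * real s)" by (simp flip: exp_add)
  also have "\<dots> \<le> exp (19 * (ln (real n) + 1))" using s by simp
  also have "\<dots> = exp (ln (real n)) ^ 19 * exp 1 ^ 19"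
    by (simp add: exp_add algebra_simps flip: exp_of_nat_mult)
  also have "\<dots> \<le> real n ^ 19 * (real n ^ 2) ^ 19"
  proof (intro mult_mono power_mono)
    have "exp (1::real) \<le> 2 ^ 2" using exp_le by simp
    also have "\<dots> \<le> real n ^ 2" using assms(3) by (intro power_mono) auto
    finally show "exp 1 \<le> real n ^ 2" .
  qed (use assms(3) in auto)
  also have "\<dots> = real n ^ 57" by (simp flip: power_mult power_add)
  finally have "real (length (z_list \<alpha> \<beta> s i)) \<le> real n ^ 57"
    using length_z_list_le_exp[OF assms(1), of s i] by linarith
  then show ?thesis by (simp only: of_nat_le_iff flip: of_nat_power)
qed

lemma length_h5_list:
  assumes "4 \<le> \<beta>" "\<alpha> \<le> 17 / 4" "2 \<le> n"
  shows "length (h5_list \<alpha> \<beta> n) \<le> n ^ 58"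
proof -
  have "length (h5_block \<alpha> \<beta> n i) \<le> n ^ 57" for i
    unfolding h5_block_def h3_list_def using length_z_list_le_power[OF assms] by simp
  then have "length (concat (map (\<lambda>j. h5_block \<alpha> \<beta> n (j * block_size n)) js)) \<le> n ^ 57 * length js" for js
    by (induction js) (auto intro: add_mono)
  from this[of "[0..<n]"] show ?thesis
    unfolding h5_list_def using power_add[of n 57 1] by simp
qed

end

section \<open>H3 and H5 hit every direction\<close>

abbreviation \<alpha>0 :: real where "\<alpha>0 \<equiv> 2 + sqrt 5"
abbreviation \<beta>0 :: real where "\<beta>0 \<equiv> 3 + sqrt 5"

text \<open>
  For an entry \<open>a\<close> rounded to \<open>w\<close> with \<open>w \<le> a \<le> s w\<close> this is \<open>(a - w) (s w - a) \<ge> 0\<close>.  An entry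
  below 1 is rounded to \<open>w = 1\<close>; the error \<open>s\<close> pays for it.
\<close>
lemma rounding_inequality:
  fixes a w s :: real
  assumes "0 \<le> a" "0 \<le> s" "a \<le> s * w" "w = 1 \<or> w \<le> a"
  shows "a\<^sup>2 + s * w\<^sup>2 - s \<le> (1 + s) * (a * w)"
  using assms(4)
proof
  assume w: "w = 1"
  have "a * a \<le> s * a" using assms w by (intro mult_right_mono) simp_all
  then have "a * a \<le> a + s * a" using assms(1) by linarith
  then show ?thesis by (simp add: w power2_eq_square distrib_right)
next
  assume "w \<le> a"
  then have "0 \<le> (a - w) * (s * w - a)" using assms(3) by simp
  also have "\<dots> = (1 + s) * (a * w) - a\<^sup>2 - s * w\<^sup>2" by (simp add: power2_eq_square algebra_simps)
  finally show ?thesis using assms(2) by linarith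
qed

context partition_parameters
begin

text \<open>
  Here \<open>a i\<close> are the scaled absolute values, \<open>w i\<close> their rounded values, \<open>W\<close> the sum of the squares
  of the \<open>w i\<close> and \<open>y\<close> the sum of the products.  Summing the rounding inequality gives
  \<open>(\<alpha> - s) n + s W \<le> (1 + s) y\<close> with \<open>s = sqrt \<beta>\<close>; by the inequality of the arithmetic and the
  geometric mean \<open>y\<^sup>2\<close> is then at least a multiple of \<open>n W\<close>, and the condition on \<open>\<alpha>\<close> and \<open>\<beta>\<close>
  makes it \<open>\<alpha> n W / 4\<close>.
\<close>
lemma H3_hits_nonzero:
  assumes n: "0 < n" and x: "x \<in> carrier_vec n" "0 < vnorm x"
    and s: "sqrt \<beta> \<le> \<alpha>" "(1 + sqrt \<beta>)\<^sup>2 * \<alpha> \<le> 16 * ((\<alpha> - sqrt \<beta>) * sqrt \<beta>)"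
  shows "\<exists>h\<in>H3 \<alpha> \<beta> n. vnorm x / 2 \<le> x \<bullet> h"
proof -
  define s where "s = sqrt \<beta>"
  define N where "N = vnorm x"
  define c where "c = sqrt (\<alpha> * real n) / N"
  define a where "a i = c * \<bar>x $ i\<bar>" for i
  have N: "0 < N" using x by (simp add: N_def)
  have \<beta>1: "1 < \<beta>" using \<alpha> \<beta> by simp
  have s0: "0 \<le> s" "s\<^sup>2 = \<beta>" using \<beta>1 by (simp_all add: s_def)
  have an: "0 < \<alpha> * real n" using \<alpha> n by simp
  have c: "0 < c" using an N by (simp add: c_def)
  have a0: "0 \<le> a i" for i using c by (simp add: a_def)
  have sum_a: "(\<Sum>i<n. (a i)\<^sup>2) = \<alpha> * real n"
  proof -
    have "(a i)\<^sup>2 = c\<^sup>2 * (x $ i * x $ i)" for i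
      by (simp only: a_def power_mult_distrib power2_abs) (simp only: power2_eq_square)
    then have "(\<Sum>i<n. (a i)\<^sup>2) = c\<^sup>2 * (\<Sum>i<n. x $ i * x $ i)"
      by (simp only: sum_distrib_left)
    also have "(\<Sum>i<n. x $ i * x $ i) = N\<^sup>2"
      using scalar_prod_conv_sum[OF x(1)] by (simp add: N_def vnorm_squared)
    finally show ?thesis using N an by (simp add: c_def power_divide)
  qed
  have a_le: "(a i)\<^sup>2 \<le> \<alpha> * real n" if "i < n" for i
    unfolding sum_a[symmetric] using that by (intro member_le_sum) auto
  \<comment> \<open>Squares up to \<open>\<beta>\<close> get the exponent 0; a larger one lies in \<open>(\<beta>^(l i), \<beta>^(l i + 1)]\<close>.\<close>
  define l where "l i = (LEAST k. (a i)\<^sup>2 \<le> \<beta> ^ Suc k)" for i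
  have l1: "(a i)\<^sup>2 \<le> \<beta> ^ Suc (l i)" for i
  proof -
    obtain k where "(a i)\<^sup>2 < \<beta> ^ k" using real_arch_pow[OF \<beta>1] by blast
    also have "\<beta> ^ k \<le> \<beta> ^ Suc k" using \<beta>1 by (intro power_increasing) auto
    finally have "(a i)\<^sup>2 \<le> \<beta> ^ Suc k" by simp
    then show ?thesis unfolding l_def by (rule LeastI)
  qed
  have l2: "\<beta> ^ l i < (a i)\<^sup>2" if nz: "l i \<noteq> 0" for i
  proof -
    obtain k where k: "l i = Suc k" using nz by (cases "l i") auto
    then have "k < (LEAST k. (a i)\<^sup>2 \<le> \<beta> ^ Suc k)" unfolding l_def[symmetric] by simp
    from not_less_Least[OF this] show ?thesis unfolding k by simp
  qed
  define w where "w i = sqrt (\<beta> ^ l i)" for i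
  have w2: "(w i)\<^sup>2 = \<beta> ^ l i" for i using \<beta>1 by (simp add: w_def)
  have w1: "1 \<le> w i" for i using \<beta>1 one_le_power[of \<beta> "l i"] by (simp add: w_def)
  have wpos: "0 < w i" for i using w1[of i] by linarith
  define z where "z = vec n (\<lambda>i. (if x $ i < 0 then -1 else 1) * w i)"
  have z: "z \<in> carrier_vec n" by (simp add: z_def)
  have zi: "(z $ i)\<^sup>2 = \<beta> ^ l i" if "i < n" for i
    using that w2[of i] by (auto simp: z_def)
  have "balanced n z"
    unfolding balanced_def
  proof (intro conjI allI impI ballI)
    fix i assume i: "i < n"
    have "\<beta> ^ l i < \<alpha> * real n"
    proof (cases "l i = 0")
      case True
      then show ?thesis using one_less_scaled_dimension[OF n] by simp
    next
      case False
      then show ?thesis using l2 a_le[OF i] by fastforce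
    qed
    then show "(z $ i)\<^sup>2 \<in> set (levels \<alpha> \<beta> n)" unfolding zi[OF i] set_levels by blast
  next
    fix u assume "u \<in> set (levels \<alpha> \<beta> n)"
    then obtain k where k: "u = \<beta> ^ k" by (auto simp: set_levels)
    let ?S = "{i. i < n \<and> (z $ i)\<^sup>2 = u}"
    show "real (card ?S) * u \<le> \<alpha> * real n"
    proof (cases "k = 0")
      case True
      have "card ?S \<le> card {..<n}" by (rule card_mono) auto
      then have "real (card ?S) \<le> 1 * real n" by simp
      also have "\<dots> \<le> \<alpha> * real n" using \<alpha> by (intro mult_right_mono) auto
      finally show ?thesis using True k by simp
    next
      case False
      have "real (card ?S) * u = (\<Sum>i\<in>?S. u)" by simp
      also have "\<dots> \<le> (\<Sum>i\<in>?S. (a i)\<^sup>2)"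
      proof (rule sum_mono)
        fix i assume "i \<in> ?S"
        then have "\<beta> ^ l i = \<beta> ^ k" using zi[of i] k by simp
        then have "l i = k" using \<beta>1 by (subst (asm) power_inject_exp) auto
        then show "u \<le> (a i)\<^sup>2" using l2[of i] False k by simp
      qed
      also have "\<dots> \<le> (\<Sum>i<n. (a i)\<^sup>2)" by (rule sum_mono2) auto
      finally show ?thesis unfolding sum_a .
    qed
  qed
  then have zZ: "z \<in> Z_set \<alpha> \<beta> n" using Z_set_eq[OF n] z by simp
  define W where "W = (\<Sum>i<n. (w i)\<^sup>2)"
  define y where "y = (\<Sum>i<n. a i * w i)"
  have W: "0 < W" unfolding W_def
    using n wpos by (intro sum_pos zero_less_power) auto
  have zz: "vnorm z = sqrt W"
  proof -
    have "z \<bullet> z = W" unfolding scalar_prod_conv_sum[OF z] W_def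
      using zi w2 by (intro sum.cong) (auto simp: power2_eq_square)
    then show ?thesis by (simp add: vnorm_def)
  qed
  have xz: "c * (x \<bullet> z) = y"
    unfolding scalar_prod_conv_sum[OF z] y_def sum_distrib_left
    by (intro sum.cong) (auto simp: z_def a_def abs_if)
  have y0: "0 \<le> y" unfolding y_def using a0 wpos by (intro sum_nonneg mult_nonneg_nonneg) (auto intro: less_imp_le)
  have main: "(\<alpha> - s) * real n + s * W \<le> (1 + s) * y"
  proof -
    have pt: "(a i)\<^sup>2 + s * (w i)\<^sup>2 - s \<le> (1 + s) * (a i * w i)" for i
    proof -
      have "(a i)\<^sup>2 \<le> (s * w i)\<^sup>2" using l1[of i] w2[of i] s0 by (simp add: power_mult_distrib)
      then have up: "a i \<le> s * w i" by (rule power2_le_imp_le) (use s0 w1[of i] in auto)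
      have "w i = 1 \<or> w i \<le> a i"
      proof (cases "l i = 0")
        case True
        then show ?thesis by (simp add: w_def)
      next
        case False
        then have "(w i)\<^sup>2 \<le> (a i)\<^sup>2" using l2[of i] w2[of i] by simp
        then show ?thesis using power2_le_imp_le a0 by blast
      qed
      then show ?thesis using rounding_inequality a0 s0(1) up by blast
    qed
    have le: "(\<Sum>i<n. (a i)\<^sup>2 + s * (w i)\<^sup>2 - s) \<le> (\<Sum>i<n. (1 + s) * (a i * w i))"
      by (intro sum_mono pt)
    show ?thesis
    proof -
      have "(\<Sum>i<n. (a i)\<^sup>2 + s * (w i)\<^sup>2 - s) = \<alpha> * real n + s * W - real n * s"
        unfolding sum_a[symmetric] W_def sum_distrib_left by (simp add: sum.distrib sum_subtractf)
      moreover have "(\<Sum>i<n. (1 + s) * (a i * w i)) = (1 + s) * y"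
        by (simp only: y_def sum_distrib_left)
      moreover note le
      ultimately have "\<alpha> * real n + s * W - real n * s \<le> (1 + s) * y" by simp
      moreover have "(\<alpha> - s) * real n = \<alpha> * real n - real n * s"
        by (simp only: left_diff_distrib mult.commute[of s])
      ultimately show ?thesis by linarith
    qed
  qed
  have "\<alpha> * real n * W \<le> 4 * y\<^sup>2"
  proof -
    let ?P = "(\<alpha> - s) * real n" and ?Q = "s * W"
    have nW: "0 \<le> real n * W" using W by simp
    have "4 * (?P * ?Q) \<le> (?P + ?Q)\<^sup>2" using zero_le_power2[of "?P - ?Q"] by (simp add: power2_eq_square algebra_simps)
    also have "\<dots> \<le> ((1 + s) * y)\<^sup>2" using main s(1) s0 W by (intro power_mono) (auto simp: s_def)
    finally have 1: "4 * (((\<alpha> - s) * s) * (real n * W)) \<le> (1 + s)\<^sup>2 * y\<^sup>2"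
      by (simp only: power_mult_distrib mult_ac)
    have "(1 + s)\<^sup>2 * \<alpha> * (real n * W) \<le> 16 * ((\<alpha> - s) * s) * (real n * W)"
      using s(2) nW unfolding s_def by (rule mult_right_mono)
    moreover have "16 * ((\<alpha> - s) * s) * (real n * W) = 16 * (((\<alpha> - s) * s) * (real n * W))"
      "(1 + s)\<^sup>2 * \<alpha> * (real n * W) = (1 + s)\<^sup>2 * (\<alpha> * real n * W)"
      "(1 + s)\<^sup>2 * (4 * y\<^sup>2) = 4 * ((1 + s)\<^sup>2 * y\<^sup>2)"
      by (simp_all only: mult_ac)
    ultimately have "(1 + s)\<^sup>2 * (\<alpha> * real n * W) \<le> (1 + s)\<^sup>2 * (4 * y\<^sup>2)"
      using 1 by linarith
    moreover have "0 < (1 + s)\<^sup>2" using s0 by (simp add: zero_less_power)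
    ultimately show ?thesis by (simp only: mult_le_cancel_left_pos)
  qed
  then have "(sqrt (\<alpha> * real n) * sqrt W)\<^sup>2 \<le> (2 * y)\<^sup>2"
    using an W by (simp add: power_mult_distrib)
  then have "sqrt (\<alpha> * real n) * sqrt W \<le> 2 * y" by (rule power2_le_imp_le) (use y0 in simp)
  moreover have "sqrt (\<alpha> * real n) = c * N" using N by (simp add: c_def)
  ultimately have "c * (N * sqrt W) \<le> c * (2 * (x \<bullet> z))" unfolding xz[symmetric] by (simp add: mult_ac)
  then have "N * sqrt W \<le> 2 * (x \<bullet> z)" using c by (simp only: mult_le_cancel_left_pos)
  then have "N / 2 \<le> (1 / sqrt W) * (x \<bullet> z)" using W by (simp add: field_simps)
  also have "\<dots> = x \<bullet> ((1 / vnorm z) \<cdot>\<^sub>v z)" unfolding zz using x z by (simp add: scalar_prod_smult_distrib)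
  finally show ?thesis using zZ unfolding N_def by (intro bexI[of _ "(1 / vnorm z) \<cdot>\<^sub>v z"]) (auto simp: H3_def)
qed

text \<open>For \<open>x = 0\<close> any member of \<open>H3\<close> will do; the previous lemma, for a unit vector, yields one.\<close>
lemma H3_hits:
  assumes n: "0 < n" and x: "x \<in> carrier_vec n"
    and s: "sqrt \<beta> \<le> \<alpha>" "(1 + sqrt \<beta>)\<^sup>2 * \<alpha> \<le> 16 * ((\<alpha> - sqrt \<beta>) * sqrt \<beta>)"
  shows "\<exists>h\<in>H3 \<alpha> \<beta> n. vnorm x / 2 \<le> x \<bullet> h"
proof (cases "vnorm x = 0")
  case False
  then have "0 < vnorm x" using vnorm_nonneg[of x] by linarith
  then show ?thesis by (rule H3_hits_nonzero[OF n x _ s])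
next
  case True
  have u: "unit_vec n 0 \<in> carrier_vec n" "0 < vnorm (unit_vec n 0)"
    using n by (auto simp: vnorm_def)
  obtain h where h: "h \<in> H3 \<alpha> \<beta> n" using H3_hits_nonzero[OF n u s] by blast
  obtain z where z: "z \<in> Z_set \<alpha> \<beta> n" "h = (1 / vnorm z) \<cdot>\<^sub>v z" using h unfolding H3_def by blast
  then have "z \<in> carrier_vec n" unfolding Z_set_eq[OF n] by simp
  then have hc: "h \<in> carrier_vec n" unfolding z(2) by simp
  have "(\<Sum>i<n. x $ i * x $ i) = 0"
    using True scalar_prod_conv_sum[OF x] vnorm_squared[of x] by simp
  then have "x $ i = 0" if "i < n" for i
    using that by (subst (asm) sum_nonneg_eq_0_iff) auto
  then have "x \<bullet> h = 0" unfolding scalar_prod_conv_sum[OF hc] by simp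
  then show ?thesis using True h by (intro bexI[of _ h]) auto
qed

text \<open>
  Of the \<open>Q\<close> blocks of \<open>x\<close> one has squared norm at least \<open>\<parallel>x\<parallel>\<^sup>2 / Q\<close>, and \<open>Q p < n + p \<le> 2 n\<close>.  So the
  factor is at least \<open>1/2 * sqrt (ln n / (2 n))\<close>, which exceeds the claimed one because
  \<open>(3/10)\<^sup>2 * 2 \<le> (1/2)\<^sup>2\<close>.
\<close>
lemma H5_hits:
  assumes n: "2 \<le> n" and x: "x \<in> carrier_vec n"
    and s: "sqrt \<beta> \<le> \<alpha>" "(1 + sqrt \<beta>)\<^sup>2 * \<alpha> \<le> 16 * ((\<alpha> - sqrt \<beta>) * sqrt \<beta>)"
  shows "\<exists>h\<in>H5 \<alpha> \<beta> n. 3 / 10 * sqrt (ln (real n) / real n) * vnorm x \<le> x \<bullet> h"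
proof -
  define p where "p = block_size n"
  have p: "0 < p" "p \<le> n" "ln (real n) \<le> p"
    using block_size_bounds[OF n] by (simp_all add: p_def)
  \<comment> \<open>The number of blocks, \<open>n / p\<close> rounded up; the last block may be shorter than \<open>p\<close>.\<close>
  define Q where "Q = (n + p - 1) div p"
  have Q1: "n \<le> Q * p"
  proof -
    have "n + p - 1 < Suc Q * p" unfolding Q_def using p(1) by (metis dividend_less_div_times mult.commute mult_Suc add.commute)
    then show ?thesis by simp
  qed
  have Q2: "Q * p < n + p" unfolding Q_def using div_times_less_eq_dividend[of "n + p - 1" p] p(1) by linarith
  have jp: "j * p < n" if "j < Q" for j
    using mult_le_mono1[of "Suc j" Q p] that Q2 by simp
  have Qpos: "0 < Q" using Q1 n by (cases Q) auto
  \<comment> \<open>Extended by 0 beyond \<open>n\<close>, so that all blocks can be summed over \<open>p\<close> indices.\<close>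
  define g where "g i = (if i < n then x $ i * x $ i else 0)" for i
  define v where "v j = vec (min p (n - j * p)) (\<lambda>i. x $ (j * p + i))" for j
  have vv: "v j \<bullet> v j = sum g {j * p..<j * p + p}" if "j < Q" for j
  proof -
    let ?s = "min p (n - j * p)"
    have "v j \<bullet> v j = (\<Sum>i<?s. x $ (j * p + i) * x $ (j * p + i))"
      by (subst scalar_prod_conv_sum[of _ ?s]) (auto simp: v_def)
    also have "\<dots> = (\<Sum>i<?s. g (j * p + i))" by (intro sum.cong) (auto simp: g_def)
    also have "\<dots> = (\<Sum>i<p. g (j * p + i))"
      by (intro sum.mono_neutral_left) (auto simp: g_def)
    also have "\<dots> = sum g {j * p..<j * p + p}"
      by (rule sum.reindex_bij_witness[of _ "\<lambda>i. i - j * p" "\<lambda>i. j * p + i"]) auto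
    finally show ?thesis .
  qed
  have "(\<Sum>j<Q. v j \<bullet> v j) = (\<Sum>j<Q. sum g {j * p..<j * p + p})" by (intro sum.cong) (auto simp: vv)
  also have "\<dots> = sum g {..<Q * p}" by (rule sum.nat_group)
  also have "\<dots> = sum g {..<n}" using Q1 by (intro sum.mono_neutral_right) (auto simp: g_def)
  also have "\<dots> = x \<bullet> x" unfolding scalar_prod_conv_sum[OF x] by (intro sum.cong) (auto simp: g_def)
  finally have total: "(\<Sum>j<Q. v j \<bullet> v j) = x \<bullet> x" .
  have "\<exists>j<Q. x \<bullet> x \<le> real Q * (v j \<bullet> v j)"
  proof (rule ccontr)
    assume "\<not> ?thesis"
    then have "v j \<bullet> v j < x \<bullet> x / real Q" if "j < Q" for j
      using that Qpos by (auto simp: field_simps not_le)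
    then have "(\<Sum>j<Q. v j \<bullet> v j) < (\<Sum>j<Q. x \<bullet> x / real Q)"
      using Qpos by (intro sum_strict_mono) auto
    then show False using total Qpos by simp
  qed
  then obtain j where j: "j < Q" "x \<bullet> x \<le> real Q * (v j \<bullet> v j)" by blast
  let ?s = "min p (n - j * p)"
  have s0: "0 < ?s" using jp[OF j(1)] p by simp
  have vc: "v j \<in> carrier_vec ?s" by (simp add: v_def)
  obtain h where h: "h \<in> H3 \<alpha> \<beta> ?s" "vnorm (v j) / 2 \<le> v j \<bullet> h" using H3_hits[OF s0 vc s] by blast
  obtain hs where hs: "hs \<in> set (h3_list \<alpha> \<beta> ?s)" "h = vec_of_list hs" using h(1) H3_h3_list[OF s0] by auto
  have len: "length hs = ?s" using hs(1) by (auto simp: h3_list_def normalise_def length_z_list_elem)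
  have mem: "vec_of_list (pad n (j * p) hs) \<in> H5 \<alpha> \<beta> n"
    unfolding H5_h5_list[OF n] set_h5_list[OF n] using hs(1) jp[OF j(1)] unfolding p_def by blast
  have "x \<bullet> vec_of_list (pad n (j * p) hs) = (\<Sum>i<length hs. x $ (j * p + i) * hs ! i)"
    using len jp[OF j(1)] by (intro scalar_prod_pad) simp
  also have "\<dots> = (\<Sum>i<?s. v j $ i * h $ i)"
    unfolding len by (intro sum.cong) (auto simp: v_def hs(2) vec_of_list_index)
  also have "\<dots> = v j \<bullet> h"
    by (rule scalar_prod_conv_sum[symmetric]) (simp add: hs(2) len carrier_vecI)
  finally have xh: "x \<bullet> vec_of_list (pad n (j * p) hs) = v j \<bullet> h" .
  have lnQ: "ln (real n) * real Q \<le> 2 * real n"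
  proof -
    have "ln (real n) * real Q \<le> real p * real Q" using p by (intro mult_right_mono) auto
    also have "\<dots> = real (Q * p)" by simp
    also have "\<dots> \<le> real (n + p)" using Q2 by linarith
    also have "\<dots> \<le> 2 * real n" using p(2) by simp
    finally show ?thesis .
  qed
  have ln0: "0 \<le> ln (real n)" using n by simp
  have "(3 / 10 * sqrt (ln (real n) / real n) * vnorm x)\<^sup>2 \<le> (vnorm (v j) / 2)\<^sup>2"
  proof -
    have vj0: "0 \<le> v j \<bullet> v j" using vnorm_squared[of "v j"] zero_le_power2[of "vnorm (v j)"] by linarith
    have "(3 / 10 * sqrt (ln (real n) / real n) * vnorm x)\<^sup>2 = 9 / 100 * (ln (real n) / real n) * (x \<bullet> x)"
      using ln0 by (simp add: power_mult_distrib vnorm_squared power_divide)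
    also have "\<dots> \<le> 9 / 100 * (ln (real n) / real n) * (real Q * (v j \<bullet> v j))"
      using j(2) ln0 by (intro mult_left_mono) auto
    also have "\<dots> = 9 / 100 * (ln (real n) * real Q / real n) * (v j \<bullet> v j)" by simp
    also have "\<dots> \<le> 9 / 100 * 2 * (v j \<bullet> v j)"
      using lnQ n vj0 by (intro mult_right_mono mult_left_mono) (auto simp: divide_le_eq)
    also have "\<dots> \<le> (v j \<bullet> v j) / 4" using vj0 by simp
    also have "\<dots> = (vnorm (v j) / 2)\<^sup>2" by (simp add: power_divide vnorm_squared)
    finally show ?thesis .
  qed
  then have "3 / 10 * sqrt (ln (real n) / real n) * vnorm x \<le> vnorm (v j) / 2"
    by (rule power2_le_imp_le) simp
  also have "\<dots> \<le> x \<bullet> vec_of_list (pad n (j * p) hs)" unfolding xh by (rule h(2))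
  finally show ?thesis using mem by blast
qed

end

lemma sqrt5_bounds: "2236 / 1000 \<le> sqrt 5" "sqrt 5 \<le> 2237 / 1000"
proof -
  have "sqrt ((2236 / 1000)\<^sup>2) \<le> sqrt 5" "sqrt 5 \<le> sqrt ((2237 / 1000)\<^sup>2)"
    by (intro real_sqrt_le_mono; simp add: power2_eq_square)+
  then show "2236 / 1000 \<le> sqrt 5" "sqrt 5 \<le> 2237 / 1000" by simp_all
qed

interpretation chosen: partition_parameters \<alpha>0 \<beta>0
  by unfold_locales (use sqrt5_bounds in linarith)+

lemma parameters_balance:
  "sqrt \<beta>0 \<le> \<alpha>0" "(1 + sqrt \<beta>0)\<^sup>2 * \<alpha>0 \<le> 16 * ((\<alpha>0 - sqrt \<beta>0) * sqrt \<beta>0)"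
proof -
  have lo: "228 / 100 \<le> sqrt \<beta>0"
    by (rule real_le_rsqrt) (use sqrt5_bounds in \<open>simp add: power2_eq_square\<close>)
  have hi: "sqrt \<beta>0 \<le> 229 / 100"
    by (rule real_le_lsqrt) (use sqrt5_bounds in \<open>simp_all add: power2_eq_square\<close>)
  show "sqrt \<beta>0 \<le> \<alpha>0" using hi sqrt5_bounds by linarith
  have "(1 + sqrt \<beta>0)\<^sup>2 * \<alpha>0 \<le> (329 / 100)\<^sup>2 * (4237 / 1000)"
    using lo hi sqrt5_bounds by (intro mult_mono power_mono) auto
  also have "\<dots> \<le> 16 * ((4236 / 1000 - 229 / 100) * (228 / 100))" by (simp add: power2_eq_square)
  also have "\<dots> \<le> 16 * ((\<alpha>0 - sqrt \<beta>0) * sqrt \<beta>0)"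
    using lo hi sqrt5_bounds by (intro mult_left_mono mult_mono) auto
  finally show "(1 + sqrt \<beta>0)\<^sup>2 * \<alpha>0 \<le> 16 * ((\<alpha>0 - sqrt \<beta>0) * sqrt \<beta>0)" .
qed

section \<open>Tensors as multilinear forms\<close>

lemma multi_indices_simps:
  "multi_indices [] = [[]]"
  "multi_indices (n # ns) = concat (map (\<lambda>i. map (Cons i) (multi_indices ns)) [0..<n])"
  by (simp_all add: multi_indices_def)

lemma concat_concat: "concat (concat xss) = concat (map concat xss)"
  by (induction xss) auto

lemma multi_indices_append:
  "multi_indices (ms @ ns) = concat (map (\<lambda>is. map (\<lambda>js. is @ js) (multi_indices ns)) (multi_indices ms))"
proof (induction ms)
  case Nil
  show ?case by (simp add: multi_indices_simps map_idI)
next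
  case (Cons m ms)
  have "(@) (i # is) = (\<lambda>js. i # is @ js)" for i :: nat and "is" by (rule ext) simp
  then show ?case using Cons
    by (simp add: multi_indices_simps map_concat comp_def concat_concat)
qed

lemma multi_indices_pair:
  "multi_indices [a, b] = concat (map (\<lambda>i. map (\<lambda>j. [i, j]) [0..<b]) [0..<a])"
  by (simp add: multi_indices_simps map_concat comp_def concat_map_singleton)

lemma distinct_multi_indices: "distinct (multi_indices ns)"
  unfolding multi_indices_def by (rule distinct_product_lists) auto

lemma in_multi_indices:
  assumes "is \<in> set (multi_indices ns)"
  shows "length is = length ns" "k < length ns \<Longrightarrow> is ! k < ns ! k"
  using assms by (auto simp: multi_indices_def product_lists_set list_all2_conv_all_nth)

lemma length_multi_indices: "length (multi_indices ns) = prod_list ns"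
proof (induction ns)
  case (Cons n ns)
  have "length (concat (map (\<lambda>i. map (Cons i) (multi_indices ns)) is)) = length is * length (multi_indices ns)" for "is"
    by (induction "is") auto
  then show ?case using Cons by (simp add: multi_indices_simps)
qed (simp add: multi_indices_simps)

text \<open>
  The entries of an iterated Kronecker product appear in the order of the multi-indices.  So the
  program can evaluate a form as a scalar product with the list of entries of the tensor.
\<close>
lemma krons_multi_indices:
  "krons zs = map (\<lambda>is. \<Prod>k<length zs. zs ! k ! (is ! k)) (multi_indices (map length zs))"
proof (induction zs)
  case Nil
  show ?case by (simp add: multi_indices_simps)
next
  case (Cons z zs)
  have "krons (z # zs) = concat (map (\<lambda>i. map (\<lambda>y. z ! i * y) (krons zs)) [0..<length z])"
    unfolding krons_simps kron_def by (subst (1) map_nth[symmetric]) (simp add: comp_def)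
  also have "\<dots> = map (\<lambda>is. \<Prod>k<length (z # zs). (z # zs) ! k ! (is ! k)) (multi_indices (map length (z # zs)))"
    unfolding Cons by (simp add: multi_indices_simps map_concat comp_def prod.lessThan_Suc_shift del: prod.lessThan_Suc)
  finally show ?case .
qed

lemma length_krons: "length (krons zs) = prod_list (map length zs)"
  by (simp add: krons_multi_indices length_multi_indices)

lemma tensor_form_sum_list:
  "tensor_form ns T xs = (\<Sum>is\<leftarrow>multi_indices ns. T is * (\<Prod>k<length ns. (xs ! k) $ (is ! k)))"
  by (simp add: tensor_form_def sum_list_distinct_conv_sum_set[OF distinct_multi_indices])

lemma tensor_form_dot:
  assumes "map length zs = ns"
  shows "tensor_form ns T (map vec_of_list zs) = dot (map T (multi_indices ns)) (krons zs)"
proof -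
  have "length zs = length ns" using assms by auto
  then have "tensor_form ns T (map vec_of_list zs) =
      (\<Sum>is\<leftarrow>multi_indices ns. T is * (\<Prod>k<length zs. zs ! k ! (is ! k)))"
    unfolding tensor_form_sum_list by (simp add: vec_of_list_index)
  then show ?thesis
    unfolding krons_multi_indices assms dot_def
    by (simp add: zip_map_map zip_same_conv_map comp_def)
qed

text \<open>
  The vector on the right represents the form as a functional of its argument \<open>k\<close>; it turns
  exchanging one argument into a question about inner products.
\<close>
lemma tensor_form_update:
  assumes k: "k < length ns" "length xs = length ns" and y: "y \<in> carrier_vec (ns ! k)"
  shows "tensor_form ns T (xs[k := y]) =
    vec (ns ! k) (\<lambda>i. tensor_form ns T (xs[k := unit_vec (ns ! k) i])) \<bullet> y"
proof -
  define R where "R is = (\<Prod>j\<in>{..<length ns} - {k}. (xs ! j) $ (is ! j))" for "is"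
  have prod: "(\<Prod>j<length ns. (xs[k := w] ! j) $ (is ! j)) = w $ (is ! k) * R is" for w "is"
  proof -
    have "(\<Prod>j<length ns. (xs[k := w] ! j) $ (is ! j)) =
        (xs[k := w] ! k) $ (is ! k) * (\<Prod>j\<in>{..<length ns} - {k}. (xs[k := w] ! j) $ (is ! j))"
      using k by (intro prod.remove) auto
    also have "(\<Prod>j\<in>{..<length ns} - {k}. (xs[k := w] ! j) $ (is ! j)) = R is"
      unfolding R_def by (intro prod.cong) auto
    finally show ?thesis using k by simp
  qed
  have "vec (ns ! k) (\<lambda>i. tensor_form ns T (xs[k := unit_vec (ns ! k) i])) \<bullet> y =
      (\<Sum>i<ns ! k. (\<Sum>is\<in>set (multi_indices ns). T is * (unit_vec (ns ! k) i $ (is ! k) * R is)) * y $ i)"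
    unfolding scalar_prod_conv_sum[OF y] by (intro sum.cong) (auto simp: tensor_form_def prod)
  also have "\<dots> = (\<Sum>is\<in>set (multi_indices ns). \<Sum>i<ns ! k. T is * (unit_vec (ns ! k) i $ (is ! k) * R is) * y $ i)"
    unfolding sum_distrib_right by (rule sum.swap)
  also have "\<dots> = (\<Sum>is\<in>set (multi_indices ns). T is * (y $ (is ! k) * R is))"
  proof (rule sum.cong)
    fix "is" assume "is \<in> set (multi_indices ns)"
    then have i: "is ! k < ns ! k" using in_multi_indices(2) k by blast
    have "(\<Sum>i<ns ! k. T is * (unit_vec (ns ! k) i $ (is ! k) * R is) * y $ i) =
        (\<Sum>i<ns ! k. if is ! k = i then T is * (y $ i * R is) else 0)"
      using i by (intro sum.cong) (auto simp: unit_vec_def)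
    then show "(\<Sum>i<ns ! k. T is * (unit_vec (ns ! k) i $ (is ! k) * R is) * y $ i) = T is * (y $ (is ! k) * R is)"
      using i by simp
  qed simp
  finally show ?thesis by (simp add: tensor_form_def prod)
qed

lemma tensor_form_contract:
  assumes d: "2 \<le> length ns" "length zs = length ns - 2"
    and x: "x \<in> carrier_vec (ns ! (length ns - 2))" and y: "y \<in> carrier_vec (ns ! (length ns - 1))"
  shows "tensor_form ns T (zs @ [x, y]) = x \<bullet> (contract ns T zs *\<^sub>v y)"
proof -
  define a b where "a = ns ! (length ns - 2)" and "b = ns ! (length ns - 1)"
  have upd: "(zs @ [u, v])[length ns - 2 := w] = zs @ [w, v]" "(zs @ [u, v])[length ns - 1 := w] = zs @ [u, w]" for u v w
  proof -
    have "length ns - 1 = Suc (length zs)" "length ns - 2 = length zs" using d by auto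
    then show "(zs @ [u, v])[length ns - 2 := w] = zs @ [w, v]" "(zs @ [u, v])[length ns - 1 := w] = zs @ [u, w]"
      by (simp_all add: list_update_append)
  qed
  have len: "length (zs @ [u, v]) = length ns" for u v using d by simp
  have d2: "length ns - 2 < length ns" "length ns - 1 < length ns" using d by auto
  have row: "(contract ns T zs *\<^sub>v y) $ i = tensor_form ns T (zs @ [unit_vec a i, y])" if "i < a" for i
  proof -
    have "tensor_form ns T (zs @ [unit_vec a i, y]) = vec b (\<lambda>j. tensor_form ns T (zs @ [unit_vec a i, unit_vec b j])) \<bullet> y"
      using tensor_form_update[OF d2(2) len y, of T "unit_vec a i" y] unfolding upd b_def[symmetric] .
    also have "vec b (\<lambda>j. tensor_form ns T (zs @ [unit_vec a i, unit_vec b j])) = row (contract ns T zs) i"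
      using that by (auto simp: contract_def Let_def a_def b_def row_def)
    finally show ?thesis using that by (simp add: contract_def Let_def a_def)
  qed
  have "tensor_form ns T (zs @ [x, y]) = vec a (\<lambda>i. tensor_form ns T (zs @ [unit_vec a i, y])) \<bullet> x"
    using tensor_form_update[OF d2(1) len x, of T x y] unfolding upd a_def[symmetric] .
  also have "vec a (\<lambda>i. tensor_form ns T (zs @ [unit_vec a i, y])) = contract ns T zs *\<^sub>v y"
    using row by (intro eq_vecI) (auto simp: contract_def Let_def a_def)
  also have "\<dots> \<bullet> x = x \<bullet> \<dots>"
    using x by (intro comm_scalar_prod[of _ a]) (auto simp: contract_def Let_def a_def intro: carrier_vecI)
  finally show ?thesis .
qed

text \<open>
  The Cauchy-Schwarz inequality, from \<open>0 \<le> \<parallel>v - t x\<parallel>\<^sup>2\<close> with \<open>t = v \<bullet> x\<close>.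
\<close>
lemma sphere_scalar_prod_le:
  assumes "v \<in> carrier_vec n" "x \<in> sphere n"
  shows "v \<bullet> x \<le> vnorm v"
proof -
  have x: "x \<in> carrier_vec n" "x \<bullet> x = 1" using assms vnorm_squared[of x] by (auto simp: sphere_def)
  let ?t = "v \<bullet> x"
  have "0 \<le> (\<Sum>i<n. (v $ i - ?t * x $ i)\<^sup>2)" by (intro sum_nonneg) simp
  also have "\<dots> = (\<Sum>i<n. v $ i * v $ i - 2 * ?t * (v $ i * x $ i) + ?t\<^sup>2 * (x $ i * x $ i))"
    by (intro sum.cong refl) (simp add: power2_eq_square algebra_simps)
  also have "\<dots> = v \<bullet> v - 2 * ?t * ?t + ?t\<^sup>2 * (x \<bullet> x)"
    unfolding scalar_prod_conv_sum[OF x(1)] scalar_prod_conv_sum[OF assms(1)]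
    by (simp only: sum.distrib sum_subtractf sum_distrib_left)
  also have "\<dots> = v \<bullet> v - ?t\<^sup>2" by (simp add: x(2) power2_eq_square)
  finally have "(v \<bullet> x)\<^sup>2 \<le> v \<bullet> v" by simp
  then have "(v \<bullet> x)\<^sup>2 \<le> (vnorm v)\<^sup>2" by (simp add: vnorm_squared)
  then show ?thesis by (rule power2_le_imp_le) simp
qed

lemma sphere_component_le: "x \<in> sphere n \<Longrightarrow> i < n \<Longrightarrow> \<bar>x $ i\<bar> \<le> 1"
proof -
  assume x: "x \<in> sphere n" "i < n"
  have "x $ i * x $ i \<le> (\<Sum>i<n. x $ i * x $ i)" using x(2) by (intro member_le_sum) auto
  also have "\<dots> = 1" using x(1) scalar_prod_conv_sum[of x n x] vnorm_squared[of x] by (auto simp: sphere_def)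
  finally have "\<bar>x $ i\<bar>\<^sup>2 \<le> 1\<^sup>2" by (simp add: power2_eq_square)
  then show ?thesis by (rule power2_le_imp_le) simp
qed

definition unit_tuple :: "nat list \<Rightarrow> real vec list \<Rightarrow> bool" where
  "unit_tuple ns xs \<longleftrightarrow> length xs = length ns \<and> (\<forall>k<length ns. xs ! k \<in> sphere (ns ! k))"

text \<open>The supremum is finite, because the entries of unit vectors are at most 1 in absolute value.\<close>
lemma tensor_form_le_spectral_norm:
  assumes "unit_tuple ns xs"
  shows "tensor_form ns T xs \<le> spectral_norm ns T"
proof -
  have "tensor_form ns T ys \<le> (\<Sum>is\<in>set (multi_indices ns). \<bar>T is\<bar>)" if "unit_tuple ns ys" for ys
    unfolding tensor_form_def
  proof (rule sum_mono)
    fix "is" assume i: "is \<in> set (multi_indices ns)"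
    have "\<bar>\<Prod>k<length ns. (ys ! k) $ (is ! k)\<bar> \<le> 1"
      unfolding abs_prod
      by (rule prod_le_1) (use that in_multi_indices(2)[OF i] sphere_component_le in \<open>auto simp: unit_tuple_def\<close>)
    then have "\<bar>T is * (\<Prod>k<length ns. (ys ! k) $ (is ! k))\<bar> \<le> \<bar>T is\<bar> * 1"
      unfolding abs_mult by (intro mult_left_mono) auto
    then show "T is * (\<Prod>k<length ns. (ys ! k) $ (is ! k)) \<le> \<bar>T is\<bar>" by linarith
  qed
  then have "bdd_above {tensor_form ns T xs | xs. unit_tuple ns xs}" by (intro bdd_aboveI) blast
  then show ?thesis
    unfolding spectral_norm_def unit_tuple_def[symmetric] using assms by (intro cSup_upper) blast+
qed

lemma spectral_norm_le:
  assumes "\<And>xs. unit_tuple ns xs \<Longrightarrow> tensor_form ns T xs \<le> c" "unit_tuple ns ys"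
  shows "spectral_norm ns T \<le> c"
  unfolding spectral_norm_def unit_tuple_def[symmetric] using assms by (intro cSup_least) blast+

text \<open>
  Induction on the number \<open>m\<close> of arguments already exchanged.  When \<open>v\<close> represents the form as
  a functional of argument \<open>m\<close>, the old value \<open>v \<bullet> xs ! m\<close> is at most \<open>\<parallel>v\<parallel>\<close>, while some \<open>h \<in> H m\<close>
  reaches \<open>\<tau> m * \<parallel>v\<parallel>\<close>.
\<close>
lemma hit_modes:
  assumes hit: "\<And>k x. k < m \<Longrightarrow> x \<in> carrier_vec (ns ! k) \<Longrightarrow> \<exists>h\<in>H k. \<tau> k * vnorm x \<le> x \<bullet> h"
    and H: "\<And>k. k < m \<Longrightarrow> H k \<subseteq> carrier_vec (ns ! k)" and \<tau>: "\<And>k. k < m \<Longrightarrow> 0 \<le> \<tau> k"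
    and xs: "unit_tuple ns xs" "m \<le> length ns"
  shows "\<exists>zs. length zs = length ns \<and> (\<forall>k<m. zs ! k \<in> H k) \<and> (\<forall>k. m \<le> k \<longrightarrow> zs ! k = xs ! k) \<and>
    (\<Prod>k<m. \<tau> k) * tensor_form ns T xs \<le> tensor_form ns T zs"
  using assms
proof (induction m)
  case 0
  then show ?case by (intro exI[of _ xs]) (simp add: unit_tuple_def)
next
  case (Suc m)
  have "\<exists>zs. length zs = length ns \<and> (\<forall>k<m. zs ! k \<in> H k) \<and> (\<forall>k. m \<le> k \<longrightarrow> zs ! k = xs ! k) \<and>
    (\<Prod>k<m. \<tau> k) * tensor_form ns T xs \<le> tensor_form ns T zs"
    by (rule Suc.IH) (use Suc.prems in auto)
  then obtain zs where zs: "length zs = length ns" "\<forall>k<m. zs ! k \<in> H k" "\<forall>k. m \<le> k \<longrightarrow> zs ! k = xs ! k"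
    "(\<Prod>k<m. \<tau> k) * tensor_form ns T xs \<le> tensor_form ns T zs" by blast
  have m: "m < length ns" using Suc.prems(5) by simp
  define v where "v = vec (ns ! m) (\<lambda>i. tensor_form ns T (zs[m := unit_vec (ns ! m) i]))"
  have v: "v \<in> carrier_vec (ns ! m)" by (simp add: v_def)
  obtain h where h: "h \<in> H m" "\<tau> m * vnorm v \<le> v \<bullet> h" using Suc.prems(1)[OF _ v] by blast
  have xm: "xs ! m \<in> sphere (ns ! m)" using Suc.prems(4) m by (simp add: unit_tuple_def)
  then have "xs ! m \<in> carrier_vec (ns ! m)" by (simp add: sphere_def)
  then have "tensor_form ns T (zs[m := xs ! m]) = v \<bullet> xs ! m"
    unfolding v_def by (intro tensor_form_update m zs(1))
  moreover have "zs[m := xs ! m] = zs" using zs(3) by (metis le_refl list_update_id)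
  ultimately have le: "tensor_form ns T zs \<le> vnorm v" using sphere_scalar_prod_le[OF v xm] by simp
  have "(\<Prod>k<Suc m. \<tau> k) * tensor_form ns T xs = \<tau> m * ((\<Prod>k<m. \<tau> k) * tensor_form ns T xs)" by simp
  also have "\<dots> \<le> \<tau> m * vnorm v" using zs(4) le Suc.prems(3)[of m] by (intro mult_left_mono) auto
  also have "\<dots> \<le> v \<bullet> h" by (rule h(2))
  also have "\<dots> = tensor_form ns T (zs[m := h])"
    unfolding v_def using Suc.prems(2)[of m] h(1) by (intro tensor_form_update[symmetric] m zs(1)) auto
  finally show ?case
    using zs h(1) m by (intro exI[of _ "zs[m := h]"]) (auto simp: nth_list_update less_Suc_eq)
qed

section \<open>The approximation bound\<close>

lemma sqrt_prod: "sqrt (\<Prod>k<m::nat. f k) = (\<Prod>k<m. sqrt (f k))"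
  by (induction m) (simp_all add: real_sqrt_mult)

text \<open>
  Given any unit vectors, exchange the first \<open>d - 2\<close> of them by members of \<open>H5\<close>; the solver then
  finds last arguments at least as good as the given ones, and this tuple is a candidate.
\<close>
lemma algA_output_approximates:
  assumes \<sigma>: "matrix_solver \<sigma>" and d: "3 \<le> length ns" and n2: "\<forall>n\<in>set ns. 2 \<le> n"
    and out: "algA_output \<sigma> ns T v zs"
  shows "length zs = length ns"
    and "\<forall>k<length ns - 2. zs ! k \<in> H5 \<alpha>0 \<beta>0 (ns ! k)"
    and "\<forall>k\<in>{length ns - 2..<length ns}. zs ! k \<in> sphere (ns ! k)"
    and "v = tensor_form ns T zs"
    and "approximates ((3 / 10) ^ (length ns - 2) * sqrt (\<Prod>k<length ns - 2. ln (real (ns ! k)) / real (ns ! k)))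
      (spectral_norm ns T) v"
proof -
  define m where "m = length ns - 2"
  have m: "length ns = Suc (Suc m)" using d by (simp add: m_def)
  have n2': "2 \<le> ns ! k" if "k < length ns" for k using n2 that by simp
  have solver: "x \<in> sphere (ns ! m) \<and> y \<in> sphere (ns ! Suc m) \<and>
      (\<forall>u\<in>sphere (ns ! m). \<forall>w\<in>sphere (ns ! Suc m). tensor_form ns T (us @ [u, w]) \<le> tensor_form ns T (us @ [x, y]))"
    if xy: "\<sigma> (contract ns T us) = (x, y)" and us: "length us = m" for us x y
  proof -
    have dims: "dim_row (contract ns T us) = ns ! m" "dim_col (contract ns T us) = ns ! Suc m"
      by (simp_all add: contract_def Let_def m)
    have "0 < ns ! m" "0 < ns ! Suc m" using n2'[of m] n2'[of "Suc m"] m by auto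
    then have opt: "x \<in> sphere (ns ! m) \<and> y \<in> sphere (ns ! Suc m) \<and>
      (\<forall>u\<in>sphere (ns ! m). \<forall>w\<in>sphere (ns ! Suc m). u \<bullet> (contract ns T us *\<^sub>v w) \<le> x \<bullet> (contract ns T us *\<^sub>v y))"
      using \<sigma>[unfolded matrix_solver_def, rule_format, of "contract ns T us"] by (simp add: dims xy)
    have "tensor_form ns T (us @ [u, w]) = u \<bullet> (contract ns T us *\<^sub>v w)"
      if "u \<in> sphere (ns ! m)" "w \<in> sphere (ns ! Suc m)" for u w
      using that us by (intro tensor_form_contract) (auto simp: m sphere_def)
    then show ?thesis using opt by simp
  qed
  obtain us x y where zs: "zs = us @ [x, y]" "length us = m" "\<sigma> (contract ns T us) = (x, y)"
      and us: "\<forall>k<m. us ! k \<in> H5 \<alpha>0 \<beta>0 (ns ! k)"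
    using out by (auto simp: algA_output_def candidates_def m_def)
  have xy: "x \<in> sphere (ns ! m)" "y \<in> sphere (ns ! Suc m)" using solver[OF zs(3,2)] by auto
  show len: "length zs = length ns" using zs m by simp
  show H: "\<forall>k<length ns - 2. zs ! k \<in> H5 \<alpha>0 \<beta>0 (ns ! k)"
    using us zs by (auto simp: nth_append m_def[symmetric])
  show S: "\<forall>k\<in>{length ns - 2..<length ns}. zs ! k \<in> sphere (ns ! k)"
  proof
    fix k assume "k \<in> {length ns - 2..<length ns}"
    then have "k = m \<or> k = Suc m" using m by auto
    then show "zs ! k \<in> sphere (ns ! k)" using xy zs by (auto simp: nth_append)
  qed
  show v: "v = tensor_form ns T zs" using out by (simp add: algA_output_def)
  have unit: "unit_tuple ns zs"
    unfolding unit_tuple_def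
  proof (intro conjI allI impI len)
    fix k assume k: "k < length ns"
    show "zs ! k \<in> sphere (ns ! k)"
      using H S k chosen.H5_subset_sphere[OF n2'[OF k]] by (cases "k < length ns - 2") auto
  qed
  define f where "f k = ln (real (ns ! k)) / real (ns ! k)" for k
  have f: "0 < f k" "f k \<le> 1" if "k < m" for k
    using n2'[of k] that m ln_bound[of "real (ns ! k)"] by (auto simp: f_def divide_le_eq)
  define \<tau> where "\<tau> = (\<Prod>k<m. 3 / 10 * sqrt (f k))"
  have \<tau>: "(3 / 10) ^ (length ns - 2) * sqrt (\<Prod>k<length ns - 2. ln (real (ns ! k)) / real (ns ! k)) = \<tau>"
    unfolding \<tau>_def m_def[symmetric] f_def[symmetric] by (simp only: prod.distrib prod_constant card_lessThan sqrt_prod)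
  have \<tau>0: "0 < \<tau>" unfolding \<tau>_def using f by (intro prod_pos) auto
  have \<tau>1: "\<tau> \<le> 1" unfolding \<tau>_def
  proof (intro prod_le_1 conjI)
    fix k assume "k \<in> {..<m}"
    then have "0 \<le> sqrt (f k)" "sqrt (f k) \<le> 1" using f[of k] by simp_all
    then show "0 \<le> 3 / 10 * sqrt (f k)" "3 / 10 * sqrt (f k) \<le> 1" by linarith+
  qed
  have lower: "\<tau> * tensor_form ns T xs \<le> v" if xs: "unit_tuple ns xs" for xs
  proof -
    have hit: "\<exists>h\<in>H5 \<alpha>0 \<beta>0 (ns ! k). 3 / 10 * sqrt (f k) * vnorm x \<le> x \<bullet> h"
      if "k < m" "x \<in> carrier_vec (ns ! k)" for k x
      unfolding f_def using that n2'[of k] m by (intro chosen.H5_hits parameters_balance) auto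
    have sub: "H5 \<alpha>0 \<beta>0 (ns ! k) \<subseteq> carrier_vec (ns ! k)" if "k < m" for k
      using that n2'[of k] m chosen.H5_subset_sphere[of "ns ! k"] by (auto simp: sphere_def)
    have "\<exists>ws. length ws = length ns \<and> (\<forall>k<m. ws ! k \<in> H5 \<alpha>0 \<beta>0 (ns ! k)) \<and> (\<forall>k. m \<le> k \<longrightarrow> ws ! k = xs ! k) \<and>
      (\<Prod>k<m. 3 / 10 * sqrt (f k)) * tensor_form ns T xs \<le> tensor_form ns T ws"
      using hit sub f xs m by (intro hit_modes) (auto intro: less_imp_le)
    then obtain ws where ws: "length ws = length ns" "\<forall>k<m. ws ! k \<in> H5 \<alpha>0 \<beta>0 (ns ! k)" "\<forall>k. m \<le> k \<longrightarrow> ws ! k = xs ! k"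
      "\<tau> * tensor_form ns T xs \<le> tensor_form ns T ws" unfolding \<tau>_def by blast
    obtain x' y' where x'y': "\<sigma> (contract ns T (take m ws)) = (x', y')" by fastforce
    have split: "ws = take m ws @ [xs ! m, xs ! Suc m]"
    proof -
      have "ws = take m ws @ drop m ws" by simp
      also have "drop m ws = [ws ! m, ws ! Suc m]"
        using ws(1) m by (auto simp: list_eq_iff_nth_eq less_Suc_eq nth_Cons split: nat.splits)
      also have "\<dots> = [xs ! m, xs ! Suc m]" using ws(3) by simp
      finally show ?thesis .
    qed
    have tk: "length (take m ws) = m" using ws(1) m by simp
    have "xs ! m \<in> sphere (ns ! m)" "xs ! Suc m \<in> sphere (ns ! Suc m)"
      using xs m by (auto simp: unit_tuple_def)
    then have "tensor_form ns T (take m ws @ [xs ! m, xs ! Suc m]) \<le> tensor_form ns T (take m ws @ [x', y'])"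
      using solver[OF x'y' tk] by blast
    also have "\<dots> \<le> v"
    proof -
      have "take m ws @ [x', y'] \<in> candidates \<sigma> ns T"
        unfolding candidates_def m_def[symmetric] using tk ws(2) x'y' by fastforce
      then show ?thesis using out unfolding algA_output_def by blast
    qed
    finally show ?thesis using ws(4) split by simp
  qed
  have "spectral_norm ns T \<le> v / \<tau>"
  proof (rule spectral_norm_le[OF _ unit])
    fix xs assume "unit_tuple ns xs"
    then show "tensor_form ns T xs \<le> v / \<tau>" using lower \<tau>0 by (simp add: field_simps)
  qed
  then have "\<tau> * spectral_norm ns T \<le> v" using \<tau>0 by (simp add: field_simps)
  then show "approximates ((3 / 10) ^ (length ns - 2) * sqrt (\<Prod>k<length ns - 2. ln (real (ns ! k)) / real (ns ! k)))
      (spectral_norm ns T) v"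
    unfolding \<tau> approximates_def using \<tau>0 \<tau>1 tensor_form_le_spectral_norm[OF unit] v by simp
qed

section \<open>Programs listing the candidates\<close>

definition Alpha :: prog where "Alpha = Op Plus (Const 2) (Seq (Const 5) prog.Sqrt)"
definition Beta :: prog where "Beta = Op Plus (Const 3) (Seq (Const 5) prog.Sqrt)"
definition Power :: "prog \<Rightarrow> prog" where
  "Power P = Foldr (Upto P) (Const 1) (Op Times Beta (Arg 1))"

definition Levels :: "prog \<Rightarrow> prog" where
  "Levels P = Bind P (Foldr (Upto (Arg 0)) MkLeaf
     (Bind (Power (Arg 0))
       (If_less (Arg 0) (Op Times Alpha (Arg 3)) (Fork (Arg 0) (Arg 2)) (Arg 2))))"

text \<open>Equality of real numbers is tested by two strict comparisons.\<close>
definition Count_sq :: "prog \<Rightarrow> prog \<Rightarrow> prog" where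
  "Count_sq U Z = Bind (Fork U Z) (Foldr (Seq (Arg 0) Tail) (Const 0)
     (Bind (Op Times (Arg 0) (Arg 0))
       (If_less (Arg 0) (Seq (Arg 3) Head) (Arg 2)
         (If_less (Seq (Arg 3) Head) (Arg 0) (Arg 2) (Op Plus (Arg 2) (Const 1))))))"

text \<open>
  Meant for the environment of \<open>Z_list\<close>, where \<open>Arg 0\<close> is the new square, \<open>Arg 2\<close> the vector to be
  extended, and \<open>Arg 6\<close> the pair of the dimension and the levels.
\<close>
definition Extensions :: prog where
  "Extensions = If_less (Op Times Alpha (Seq (Arg 6) Head))
     (Op Times (Op Plus (Count_sq (Arg 0) (Arg 2)) (Const 1)) (Arg 0))
     MkLeaf
     (Fork (Fork (Seq (Arg 0) prog.Sqrt) (Arg 2))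
        (Fork (Fork (Op Minus (Const 0) (Seq (Arg 0) prog.Sqrt)) (Arg 2)) MkLeaf))"

definition Z_list :: "prog \<Rightarrow> prog" where
  "Z_list P = Bind (Fork P (Levels P)) (Foldr (Upto (Seq (Arg 0) Head)) (Fork MkLeaf MkLeaf)
     (Flat_map (Arg 1) (Flat_map (Seq (Arg 4) Tail) Extensions)))"

definition Normalise :: "prog \<Rightarrow> prog" where
  "Normalise Z = Bind Z (Bind (Seq (Dot (Arg 0) (Arg 0)) prog.Sqrt)
     (Map (Arg 1) (Op Divide (Arg 0) (Arg 2))))"

definition H3_list :: "prog \<Rightarrow> prog" where
  "H3_list P = Map (Z_list P) (Normalise (Arg 0))"

definition Zeros :: "prog \<Rightarrow> prog" where
  "Zeros P = Map (Upto P) (Const 0)"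

text \<open>
  Counts up while the counter is below \<open>ln n\<close>; \<open>n\<close> rounds suffice as \<open>ln n \<le> n\<close>.
\<close>
definition Block_size :: "prog \<Rightarrow> prog" where
  "Block_size P = Bind (Seq P prog.Ln)
     (Foldr (Seq Tail (Upto P)) (Const 0)
        (If_less (Arg 1) (Arg 2) (Op Plus (Arg 1) (Const 1)) (Arg 1)))"

definition H5_list :: "prog \<Rightarrow> prog" where
  "H5_list P = Bind P (Bind (Block_size (Arg 0)) (Flat_map (Upto (Arg 1))
     (Bind (Op Times (Arg 0) (Arg 2)) (If_less (Arg 0) (Arg 4)
        (Bind (If_less (Op Plus (Arg 0) (Arg 3)) (Arg 4) (Arg 3) (Op Minus (Arg 4) (Arg 0)))
          (Bind (Arg 5) (Map (H3_list (Arg 1))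
            (Append (Zeros (Arg 4)) (Append (Arg 0)
               (Zeros (Op Minus (Op Minus (Arg 2) (Arg 4)) (Arg 3))))))))
        MkLeaf))))"

definition candidate_list :: "nat list \<Rightarrow> real list list list" where
  "candidate_list ms = product_lists (map (h5_list \<alpha>0 \<beta>0) ms)"

definition Candidate_list :: "prog \<Rightarrow> prog" where
  "Candidate_list M = Foldr M (Fork MkLeaf MkLeaf)
     (Flat_map (H5_list (Arg 0)) (Map (Arg 3) (Fork (Arg 2) (Arg 0))))"

context machine
begin

lemma run_Num: "run (Const c) x (Num a) 0" if "a = of_int c"
  using run_Const[of c x] that by simp

lemma run_Alpha: "run Alpha x (Num \<alpha>0) 10" and run_Beta: "run Beta x (Num \<beta>0) 10"
  unfolding Alpha_def Beta_def
  by (rule run_cong, rule run_arith, rule run_Const, rule run_Seq, rule run_Const, rule run_Sqrt, auto)+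

lemma run_Power:
  assumes "run P \<rho> (Num (real k)) j" "k \<le> B ^ l"
  shows "run (Power P) \<rho> (Num (\<beta>0 ^ k)) (j + 3 * l + 200)"
  unfolding Power_def
proof (rule run_cong, rule run_Foldr[where f = "\<lambda>us. Num (\<beta>0 ^ length us)", OF run_Upto[OF assms]])
  show "run (Op Times Beta (Arg 1)) (Cell x (Cell (Num (\<beta>0 ^ length ys)) \<rho>)) (Num (\<beta>0 ^ length (y # ys))) 16"
    for x and ys :: "nat list" and y
    by (rule run_cong, (rule run_arith run_Arg run_Beta)+) auto
qed (use assms in \<open>auto intro!: run_Num\<close>)

lemma run_Levels:
  assumes P: "run P \<rho> (Num (real s)) j" and s: "s \<le> B ^ l"
  shows "run (Levels P) \<rho> (reals (levels \<alpha>0 \<beta>0 s)) (j + 6 * l + 600)"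
  unfolding Levels_def
proof (rule run_cong, rule run_Bind[OF P],
    rule run_Foldr[where f = "\<lambda>ks. reals (map (\<lambda>k. \<beta>0 ^ k) (filter (\<lambda>k. \<beta>0 ^ k < \<alpha>0 * real s) ks))",
      OF run_Upto[OF run_Arg_0 s]])
  fix k :: nat and ks us assume "[0..<s] = us @ k # ks"
  then have "k \<in> set [0..<s]" by simp
  then have "k \<le> B ^ l" using s by simp
  note Power = run_Power[OF run_Arg_0 this]
  show "run (Bind (Power (Arg 0))
       (If_less (Arg 0) (Op Times Alpha (Arg 3)) (Fork (Arg 0) (Arg 2)) (Arg 2)))
     (Cell (Num (real k)) (Cell (reals (map (\<lambda>k. \<beta>0 ^ k) (filter (\<lambda>k. \<beta>0 ^ k < \<alpha>0 * real s) ks)))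
       (Cell (Num (real s)) \<rho>)))
     (reals (map (\<lambda>k. \<beta>0 ^ k) (filter (\<lambda>k. \<beta>0 ^ k < \<alpha>0 * real s) (k # ks)))) (3 * l + 300)"
    by (rule run_cong, rule run_Bind, rule Power, rule run_If_less,
        (rule run_arith run_Fork run_Arg run_Alpha)+) auto
qed (use s in \<open>auto simp: levels_def run_MkLeaf\<close>)

lemma run_Count_sq:
  assumes U: "run U \<rho> (Num u) j" and Z: "run Z \<rho> (reals z) k" and len: "length z \<le> B ^ l"
  shows "run (Count_sq U Z) \<rho> (Num (real (count_sq u z))) (j + k + 2 * l + 300)"
  unfolding Count_sq_def
proof (rule run_cong, rule run_Bind[OF run_Fork[OF U Z]],
    rule run_Foldr[where f = "\<lambda>z. Num (real (count_sq u z))", OF run_Seq[OF run_Arg_0 run_Tail] _ _ len])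
  fix b z' us
  have *: "(if b * b < u then Num a else if u < b * b then Num a else Num (a + 1)) =
      (if b * b = u then Num (a + 1) else Num a)" for a
    by auto
  show "run (Bind (Op Times (Arg 0) (Arg 0))
       (If_less (Arg 0) (Seq (Arg 3) Head) (Arg 2)
         (If_less (Seq (Arg 3) Head) (Arg 0) (Arg 2) (Op Plus (Arg 2) (Const 1)))))
     (Cell (Num b) (Cell (Num (real (count_sq u z'))) (Cell (Cell (Num u) (reals z)) \<rho>)))
     (Num (real (count_sq u (b # z')))) 100"
    by (rule run_cong, rule run_Bind, (rule run_arith run_Seq run_Arg run_Head run_Const run_If_less)+)
      (auto simp: count_sq_def *)
qed (auto intro!: run_Num simp: count_sq_def)

lemma run_Extensions:
  assumes "length z \<le> B ^ l" "0 \<le> u"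
  shows "run Extensions (Cell (Num u) (Cell a2 (Cell (reals z) (Cell a1 (Cell k (Cell acc
      (Cell (Cell (Num (real s)) us) \<rho>))))))) (enc_list (map reals (extensions \<alpha>0 \<beta>0 s z u))) (2 * l + 500)"
  unfolding Extensions_def
  by (rule run_cong, (rule run_If_less run_arith run_Seq run_Fork run_Alpha run_Arg run_Head run_Const
        run_MkLeaf run_Sqrt run_Count_sq[where l = l] assms)+)
    (auto simp: extensions_def)

lemma length_levels: "length (levels \<alpha> \<beta> s) \<le> s"
  unfolding levels_def by (metis diff_zero length_filter_le length_map length_upt)

lemma length_concat_le:
  "(\<And>x. x \<in> set xs \<Longrightarrow> length (g x) \<le> b) \<Longrightarrow> length (concat (map g xs)) \<le> b * length xs"
  by (induction xs) (fastforce intro: add_mono)+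

text \<open>
  The hypothesis bounds all intermediate lists, since the fold extends every vector found so far.
\<close>
lemma run_Z_list:
  assumes P: "run P \<rho> (Num (real s)) j" and s: "s \<le> B ^ l"
    and len: "\<And>i. i \<le> s \<Longrightarrow> length (z_list \<alpha>0 \<beta>0 s i) \<le> B ^ l"
  shows "run (Z_list P) \<rho> (enc_list (map reals (z_list \<alpha>0 \<beta>0 s s))) (2 * j + 20 * l + 3000)"
proof -
  let ?us = "levels \<alpha>0 \<beta>0 s"
  let ?\<rho> = "Cell (Cell (Num (real s)) (reals ?us)) \<rho>"
  let ?f = "\<lambda>ks. enc_list (map reals (z_list \<alpha>0 \<beta>0 s (length ks)))"
  have us: "length ?us \<le> B ^ l" using length_levels[of \<alpha>0 \<beta>0 s] s by linarith
  have ext: "length (extensions \<alpha>0 \<beta>0 s z u) \<le> B ^ 1" for z u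
    using B by (auto simp: extensions_def)
  have inner: "run (Flat_map (Seq (Arg 4) Tail) Extensions)
      (Cell (reals z) (Cell a1 (Cell k (Cell acc ?\<rho>))))
      (enc_list (map reals (concat (map (extensions \<alpha>0 \<beta>0 s z) ?us)))) (4 * l + 800)"
    if "length z \<le> B ^ l" for z a1 k acc
    unfolding map_concat list.map_comp comp_def
    by (rule run_cong, rule run_Flat_map[where xs = ?us and E = Num and m = 1,
          OF run_Seq[OF run_Arg_4 run_Tail] run_Extensions[OF that] us])
      (use ext in \<open>auto simp: levels_def\<close>)
  have outer: "run (Flat_map (Arg 1) (Flat_map (Seq (Arg 4) Tail) Extensions))
      (Cell k (Cell (enc_list (map reals zs)) ?\<rho>))
      (enc_list (map reals (concat (map (\<lambda>z. concat (map (extensions \<alpha>0 \<beta>0 s z) ?us)) zs)))) (10 * l + 1200)"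
    if "\<forall>z\<in>set zs. length z \<le> B ^ l" "length zs \<le> B ^ l" for zs k
  proof -
    have "length (concat (map (\<lambda>u. map reals (extensions \<alpha>0 \<beta>0 s z u)) ?us)) \<le> B ^ (l + 1)" for z
    proof -
      have "length (concat (map (\<lambda>u. map reals (extensions \<alpha>0 \<beta>0 s z u)) ?us)) \<le> B ^ 1 * length ?us"
        by (rule length_concat_le) (simp only: length_map ext)
      also have "\<dots> \<le> B ^ 1 * B ^ l" by (rule mult_le_mono2[OF us])
      finally show ?thesis by simp
    qed
    then show ?thesis
      unfolding map_concat list.map_comp comp_def
      using that
      by - (rule run_cong, rule run_Flat_map[where xs = zs and E = reals and l = l and m = "l + 1",
            OF run_Arg_1], auto intro!: inner[unfolded map_concat list.map_comp comp_def])
  qed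
  show ?thesis unfolding Z_list_def
  proof (rule run_cong, rule run_Bind, rule run_Fork[OF P run_Levels[OF P s]],
      rule run_Foldr[where f = ?f, OF run_Upto[OF run_Seq[OF run_Arg_0 run_Head] s]])
    fix k ks us assume "[0..<s] = us @ k # ks"
    then have "length [0..<s] = length (us @ k # ks)" by simp
    then have "length ks \<le> s" by simp
    then show "run (Flat_map (Arg 1) (Flat_map (Seq (Arg 4) Tail) Extensions))
        (Cell (Num (real k)) (Cell (?f ks) ?\<rho>)) (?f (k # ks)) (10 * l + 1200)"
      using outer[of "z_list \<alpha>0 \<beta>0 s (length ks)"] len s by (auto simp: length_z_list_elem)
  next
    show "run (Fork MkLeaf MkLeaf) ?\<rho> (?f []) 2"
      by (rule run_cong, (rule run_Fork run_MkLeaf)+) auto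
  qed (use s in auto)
qed

lemma run_Normalise:
  assumes Z: "run Z \<rho> (reals z) j" and len: "length z \<le> B ^ l" and z: "0 < dot z z"
  shows "run (Normalise Z) \<rho> (reals (normalise z)) (j + 7 * l + 700)"
proof -
  have "run (Op Divide (Arg 0) (Arg 2)) (Cell (Num b) (Cell acc (Cell (Num (sqrt (dot z z))) \<rho>')))
     (Num (b / sqrt (dot z z))) 20" for b acc \<rho>'
    by (rule run_cong, rule run_Op, (rule run_Arg)+) (use z in auto)
  note Div = this
  show ?thesis unfolding Normalise_def
    by (rule run_cong, rule run_Bind[OF Z], rule run_Bind[OF run_Seq],
        rule run_Dot[OF run_Arg_0 run_Arg_0 refl len], rule run_Sqrt, use z in simp,
        rule run_Map[where g = "\<lambda>b. Num (b / sqrt (dot z z))", OF run_Arg_1 Div len])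
      (auto simp: normalise_def comp_def)
qed

lemma run_H3_list:
  assumes P: "run P \<rho> (Num (real s)) j" and s: "s \<le> B ^ l"
    and len: "\<And>i. i \<le> s \<Longrightarrow> length (z_list \<alpha>0 \<beta>0 s i) \<le> B ^ l"
    and pos: "\<And>z. z \<in> set (z_list \<alpha>0 \<beta>0 s s) \<Longrightarrow> 0 < dot z z"
  shows "run (H3_list P) \<rho> (enc_list (map reals (h3_list \<alpha>0 \<beta>0 s))) (2 * j + 30 * l + 4000)"
proof -
  have "run (Normalise (Arg 0)) (Cell (reals z) (Cell acc \<rho>)) (reals (normalise z)) (7 * l + 700)"
    if "z \<in> set (z_list \<alpha>0 \<beta>0 s s)" for z acc
    by (rule run_cong, rule run_Normalise[OF run_Arg_0 _ pos[OF that]])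
      (use length_z_list_elem[OF that] s in auto)
  then show ?thesis unfolding H3_list_def
    by - (rule run_cong, rule run_Map[OF run_Z_list[OF P s len] _ len[OF le_refl], where g = "\<lambda>z. reals (normalise z)"],
      auto simp: h3_list_def comp_def)
qed

lemma run_Zeros:
  assumes "run P \<rho> (Num (real n)) j" "n \<le> B ^ l"
  shows "run (Zeros P) \<rho> (reals (replicate n 0)) (j + 3 * l + 200)"
  unfolding Zeros_def
  by (rule run_cong, rule run_Map[where g = "\<lambda>_. Num 0", OF run_Upto[OF assms] run_Num])
    (use assms in \<open>auto simp: map_replicate_const\<close>)

lemma run_Block_size:
  assumes P: "run P \<rho> (Num (real n)) j" and n: "n \<le> B ^ l" "0 < n"
  shows "run (Block_size P) \<rho> (Num (real (block_size n))) (2 * j + 3 * l + 300)"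
  unfolding Block_size_def
proof (rule run_cong, rule run_Bind, rule run_Seq[OF P], rule run_Ln, use n in simp,
    rule run_Foldr[where f = "\<lambda>ks. Num (real (min (length ks) (block_size n)))", OF run_Seq[OF run_Tail run_Upto[OF P n(1)]]])
  fix k :: nat and ks us
  have "(real i < ln (real n)) = (i < block_size n)" for i
    unfolding block_size_def by linarith
  then show "run (If_less (Arg 1) (Arg 2) (Op Plus (Arg 1) (Const 1)) (Arg 1))
     (Cell (Num (real k)) (Cell (Num (real (min (length ks) (block_size n)))) (Cell (Num (ln (real n))) \<rho>)))
     (Num (real (min (length (k # ks)) (block_size n)))) 30"
    by - (rule run_cong, (rule run_If_less run_arith run_Arg run_Const)+, auto)
next
  have "ln (real n) \<le> real n" using n ln_bound by simp
  then have "block_size n \<le> n" unfolding block_size_def by linarith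
  then show "Num (real (min (length [0..<n]) (block_size n))) = Num (real (block_size n))" by simp
qed (use n in \<open>auto intro!: run_Num\<close>)

end

context machine
begin

lemma length_h3_list_elem: "h \<in> set (h3_list \<alpha> \<beta> s) \<Longrightarrow> length h = s"
  by (auto simp: h3_list_def normalise_def length_z_list_elem)

lemma length_h3_list: "length (h3_list \<alpha> \<beta> s) = length (z_list \<alpha> \<beta> s s)"
  by (simp add: h3_list_def)

lemma run_H5_list:
  assumes P: "run P \<rho> (Num (real n)) j" and n: "n \<le> B ^ l" "0 < n" "0 < block_size n" "block_size n \<le> B ^ l"
    and len: "\<And>s i. s \<le> block_size n \<Longrightarrow> i \<le> s \<Longrightarrow> length (z_list \<alpha>0 \<beta>0 s i) \<le> B ^ l"
    and pos: "\<And>s z. 0 < s \<Longrightarrow> z \<in> set (z_list \<alpha>0 \<beta>0 s s) \<Longrightarrow> 0 < dot z z"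
  shows "run (H5_list P) \<rho> (enc_list (map reals (h5_list \<alpha>0 \<beta>0 n))) (j + 60 * l + 9000)"
proof -
  let ?p = "block_size n"
  let ?\<rho> = "Cell (Num (real ?p)) (Cell (Num (real n)) \<rho>)"
  let ?Pad = "Append (Zeros (Arg 4)) (Append (Arg 0) (Zeros (Op Minus (Op Minus (Arg 2) (Arg 4)) (Arg 3))))"
  let ?Block = "Bind (If_less (Op Plus (Arg 0) (Arg 3)) (Arg 4) (Arg 3) (Op Minus (Arg 4) (Arg 0)))
          (Bind (Arg 5) (Map (H3_list (Arg 1)) ?Pad))"
  have pad: "run ?Pad (Cell (reals h) (Cell acc (Cell (Num (real n)) (Cell (Num (real s)) (Cell (Num (real i)) \<rho>')))))
      (reals (pad n i h)) (12 * l + 1000)" if "length h = s" "i + s \<le> n" for h acc s i \<rho>'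
  proof -
    have "real n - real i - real s = real (n - i - s)" using that by simp
    then have "run (Op Minus (Op Minus (Arg 2) (Arg 4)) (Arg 3))
        (Cell (reals h) (Cell acc (Cell (Num (real n)) (Cell (Num (real s)) (Cell (Num (real i)) \<rho>')))))
        (Num (real (n - i - s))) 30"
      by - (rule run_cong, (rule run_arith run_Arg)+, simp_all)
    note Z = run_Zeros[OF this, of l]
    show ?thesis unfolding pad_def map_append
      by (rule run_cong, rule run_Append[where l = l], rule run_Zeros[OF run_Arg_4, of i l], use that n in simp,
          rule run_Append[OF run_Arg_0 Z, where l = l])
        (use that n in \<open>auto simp: map_append[symmetric] simp del: map_append\<close>)
  qed
  have block: "run ?Block (Cell (Num (real i)) (Cell x (Cell acc ?\<rho>)))
      (enc_list (map reals (h5_block \<alpha>0 \<beta>0 n i))) (50 * l + 7000)" if i: "i < n" for i x acc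
  proof -
    let ?s = "min ?p (n - i)"
    have s: "(if real i + real ?p < real n then Num (real ?p) else Num (real n - real i)) = Num (real ?s)"
      using i by (auto simp: min_def)
    have "run (If_less (Op Plus (Arg 0) (Arg 3)) (Arg 4) (Arg 3) (Op Minus (Arg 4) (Arg 0)))
        (Cell (Num (real i)) (Cell x (Cell acc ?\<rho>))) (Num (real ?s)) 60"
      by (rule run_cong, (rule run_If_less run_arith run_Arg)+) (use s in auto)
    moreover have "run (Map (H3_list (Arg 1)) ?Pad)
        (Cell (Num (real n)) (Cell (Num (real ?s)) (Cell (Num (real i)) \<rho>')))
        (enc_list (map (\<lambda>h. reals (pad n i h)) (h3_list \<alpha>0 \<beta>0 ?s))) (46 * l + 6000)" for \<rho>'
    proof (rule run_cong, rule run_Map[where k = "12 * l + 1000" and l = l and g = "\<lambda>h. reals (pad n i h)"])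
      show "run (H3_list (Arg 1)) (Cell (Num (real n)) (Cell (Num (real ?s)) (Cell (Num (real i)) \<rho>')))
          (enc_list (map reals (h3_list \<alpha>0 \<beta>0 ?s))) (30 * l + 4004)"
        by (rule run_cong, rule run_H3_list[where l = l, OF run_Arg_1 _ _ pos[of ?s]]) (use i n len in auto)
      show "length (h3_list \<alpha>0 \<beta>0 ?s) \<le> B ^ l" using len[of ?s ?s] by (simp add: length_h3_list)
      fix h acc assume "h \<in> set (h3_list \<alpha>0 \<beta>0 ?s)"
      then show "run ?Pad (Cell (reals h) (Cell acc (Cell (Num (real n)) (Cell (Num (real ?s)) (Cell (Num (real i)) \<rho>')))))
          (reals (pad n i h)) (12 * l + 1000)"
        using i by (intro pad length_h3_list_elem) auto
    qed auto
    ultimately show ?thesis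
      by - (rule run_cong, rule run_Bind, assumption, rule run_Bind, rule run_Arg, assumption,
        use i in \<open>auto simp: h5_block_def comp_def\<close>)
  qed
  have body: "run (Bind (Op Times (Arg 0) (Arg 2)) (If_less (Arg 0) (Arg 4) ?Block MkLeaf))
      (Cell (Num (real j)) (Cell acc ?\<rho>)) (enc_list (map reals (h5_block \<alpha>0 \<beta>0 n (j * ?p)))) (50 * l + 7200)" for j acc
  proof -
    have "run (Op Times (Arg 0) (Arg 2)) (Cell (Num (real j)) (Cell acc ?\<rho>)) (Num (real (j * ?p))) 10"
      by (rule run_cong, (rule run_arith run_Arg)+) auto
    note offset = this
    have blk: "run ?Block (Cell (Num (real (j * ?p))) (Cell (Num (real j)) (Cell acc ?\<rho>)))
      (enc_list (map reals (h5_block \<alpha>0 \<beta>0 n (j * ?p)))) (50 * l + 7000)" if "real (j * ?p) < real n"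
      using that by (intro block) (simp only: of_nat_less_iff)
    have "run (If_less (Arg 0) (Arg 4) ?Block MkLeaf) (Cell (Num (real (j * ?p))) (Cell (Num (real j)) (Cell acc ?\<rho>)))
      (enc_list (map reals (h5_block \<alpha>0 \<beta>0 n (j * ?p)))) (50 * l + 7100)"
      by (rule run_cong, rule run_If_less, rule run_Arg_0, rule run_Arg_4, erule blk, rule run_MkLeaf)
        (auto simp: h5_block_def simp flip: of_nat_mult)
    then show ?thesis
      by (rule run_cong[OF run_Bind[OF offset]]) auto
  qed
  show ?thesis unfolding H5_list_def
    by (rule run_cong, rule run_Bind[OF P], rule run_Bind,
        rule run_Block_size[OF run_Arg_0 n(1,2)],
        rule run_Flat_map[where g = "\<lambda>j. map reals (h5_block \<alpha>0 \<beta>0 n (j * ?p))" and l = l and m = l,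
          OF run_Upto[OF run_Arg_1 n(1)] body])
      (use n len in \<open>auto simp: h5_list_def h5_block_def length_h3_list map_concat comp_def\<close>)
qed

lemma run_Candidate_list:
  assumes M: "run M \<rho> (enc_list (map (\<lambda>n. Num (real n)) ms)) j" and ms: "length ms \<le> B ^ l"
    and n: "\<And>n. n \<in> set ms \<Longrightarrow> n \<le> B ^ l \<and> 0 < n \<and> 0 < block_size n \<and> block_size n \<le> B ^ l"
    and len: "\<And>n s i. n \<in> set ms \<Longrightarrow> s \<le> block_size n \<Longrightarrow> i \<le> s \<Longrightarrow> length (z_list \<alpha>0 \<beta>0 s i) \<le> B ^ l"
    and h5: "\<And>n. n \<in> set ms \<Longrightarrow> length (h5_list \<alpha>0 \<beta>0 n) \<le> B ^ l"
    and pos: "\<And>s z. 0 < s \<Longrightarrow> z \<in> set (z_list \<alpha>0 \<beta>0 s s) \<Longrightarrow> 0 < dot z z"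
    and suf: "\<And>us vs. ms = us @ vs \<Longrightarrow> length (candidate_list vs) \<le> B ^ l"
  shows "run (Candidate_list M) \<rho> (enc_list (map (\<lambda>zs. enc_list (map reals zs)) (candidate_list ms)))
    (j + 80 * l + 11000)"
  unfolding Candidate_list_def
proof (rule run_cong, rule run_Foldr[OF M _ _ ms,
    where f = "\<lambda>ms. enc_list (map (\<lambda>zs. enc_list (map reals zs)) (candidate_list ms))"])
  show "run (Fork MkLeaf MkLeaf) \<rho> (enc_list (map (\<lambda>zs. enc_list (map reals zs)) (candidate_list []))) 2"
    by (rule run_cong, (rule run_Fork run_MkLeaf)+) (auto simp: candidate_list_def)
  fix n ns us assume split: "ms = us @ n # ns"
  then have "n \<in> set ms" by simp
  note n = n[OF this] and len = len[OF this] and h5 = h5[OF this]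
  have c: "length (candidate_list ns) \<le> B ^ l" using suf[of "us @ [n]"] split by simp
  let ?\<rho> = "Cell (Num (real n)) (Cell (enc_list (map (\<lambda>zs. enc_list (map reals zs)) (candidate_list ns))) \<rho>)"
  have push: "run (Fork (Arg 2) (Arg 0)) (Cell (enc_list (map reals zs)) (Cell a' (Cell (reals z) \<rho>')))
      (enc_list (map reals (z # zs))) 6" for z zs a' \<rho>'
    by (rule run_cong, (rule run_Fork run_Arg)+) auto
  have "run (Map (Arg 3) (Fork (Arg 2) (Arg 0))) (Cell (reals z) (Cell a ?\<rho>))
      (enc_list (map (\<lambda>zs. enc_list (map reals (z # zs))) (candidate_list ns))) (2 * l + 120)" for z a
    by (rule run_cong, rule run_Map[where g = "\<lambda>zs. enc_list (map reals (z # zs))", OF run_Arg_3 push c]) auto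
  note body = this
  have cand: "candidate_list (n # ns) =
      concat (map (\<lambda>z. map (Cons z) (candidate_list ns)) (h5_list \<alpha>0 \<beta>0 n))"
    by (simp add: candidate_list_def)
  show "run (Flat_map (H5_list (Arg 0)) (Map (Arg 3) (Fork (Arg 2) (Arg 0)))) ?\<rho>
      (enc_list (map (\<lambda>zs. enc_list (map reals zs)) (candidate_list (n # ns)))) (70 * l + 10000)"
    by (rule run_cong, rule run_Flat_map[where l = l and m = l and
          g = "\<lambda>z. map (\<lambda>zs. enc_list (map reals (z # zs))) (candidate_list ns)",
          OF run_H5_list[where l = l, OF run_Arg_0] body])
      (use n len h5 c pos in \<open>auto simp: cand map_concat comp_def\<close>)
qed auto

end

section \<open>The algorithm as a program\<close>

text \<open>
  The environment holds the blocks of the tensor, its dimensions in reverse order, the dimensions,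
  and the entries.  For each candidate, the matrix of the last two modes is the combination of the
  blocks with the Kronecker product of the candidate as coefficients.  The accumulator is the best
  result so far, or \<open>Leaf\<close> at the start.
\<close>
definition Main_loop :: "prog \<Rightarrow> prog" where
  "Main_loop C = Foldr C MkLeaf
     (Bind (Seq (Chop (Seq (Arg 3) Head) (Combine (Krons (Arg 0)) (Arg 2))) MatSolve)
     (Bind (Append (Arg 1) (Fork (Seq (Arg 0) Head) (Fork (Seq (Arg 0) Tail) MkLeaf)))
     (Bind (Dot (Seq Tail (Arg 6)) (Krons (Arg 0)))
       (If_cell (Arg 4)
          (If_less (Seq (Arg 4) Head) (Arg 0) (Fork (Arg 0) (Arg 1)) (Arg 4))
          (Fork (Arg 0) (Arg 1))))))"

text \<open>
  In the reversed list of dimensions the last two come first.  A block is the part of the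
  list of entries that belongs to one choice of the first \<open>d - 2\<close> indices.
\<close>
definition Algorithm_A :: prog where
  "Algorithm_A = Seq (Fork Head (Fork Tail MkLeaf))
     (Bind (Rev (Arg 0))
     (Bind (Chop (Op Times (Seq (Arg 0) Head) (Seq (Arg 0) (Seq Tail Head))) (Arg 2))
     (Main_loop (Candidate_list (Rev (Seq (Arg 1) (Seq Tail Tail)))))))"

lemma length_multi_indices_pair: "length (multi_indices [a, b]) = a * b"
  by (simp add: length_multi_indices)

lemma combine_map:
  "combine (length js) (map w is) (map (\<lambda>i. map (f i) js) is) = map (\<lambda>j. \<Sum>i\<leftarrow>is. w i * f i j) js"
proof (induction "is")
  case Nil
  show ?case by (simp add: combine_def map_replicate_const)
next
  case (Cons i "is")
  have "combine (length js) (map w (i # is)) (map (\<lambda>i. map (f i) js) (i # is)) =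
      map (\<lambda>(x, y). w i * x + y) (zip (map (f i) js) (combine (length js) (map w is) (map (\<lambda>i. map (f i) js) is)))"
    by (simp add: combine_def)
  then show ?case unfolding Cons by (simp add: zip_map_map zip_same_conv_map comp_def)
qed

lemma sum_list_map_concat: "sum_list (map f (concat xss)) = (\<Sum>xs\<leftarrow>xss. sum_list (map f xs))"
  by (induction xss) simp_all

lemma tensor_form_pair:
  assumes zs: "map length zs = ms"
  shows "tensor_form (ms @ [a, b]) T (map vec_of_list zs @ [x, y]) =
    (\<Sum>i<a. \<Sum>j<b. (\<Sum>is\<leftarrow>multi_indices ms. (\<Prod>k<length zs. zs ! k ! (is ! k)) * T (is @ [i, j])) * (x $ i * y $ j))"
proof -
  let ?w = "\<lambda>is. \<Prod>k<length zs. zs ! k ! (is ! k)"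
  have len: "length zs = length ms" using zs by auto
  have summand: "T (is @ [i, j]) * (\<Prod>k<length (ms @ [a, b]). ((map vec_of_list zs @ [x, y]) ! k) $ ((is @ [i, j]) ! k)) =
      ?w is * T (is @ [i, j]) * (x $ i * y $ j)" if "is \<in> set (multi_indices ms)" for "is" i j
  proof -
    have li: "length is = length ms" using in_multi_indices[OF that] by simp
    have "(\<Prod>k<length ms. ((map vec_of_list zs @ [x, y]) ! k) $ ((is @ [i, j]) ! k)) = ?w is"
      unfolding len using li len by (intro prod.cong) (auto simp: nth_append vec_of_list_index)
    then show ?thesis using li len by (simp add: nth_append)
  qed
  have "tensor_form (ms @ [a, b]) T (map vec_of_list zs @ [x, y]) =
    (\<Sum>is\<leftarrow>multi_indices ms. \<Sum>i\<leftarrow>[0..<a]. \<Sum>j\<leftarrow>[0..<b]. T (is @ [i, j]) *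
       (\<Prod>k<length (ms @ [a, b]). ((map vec_of_list zs @ [x, y]) ! k) $ ((is @ [i, j]) ! k)))"
    unfolding tensor_form_sum_list multi_indices_append multi_indices_pair
    by (simp only: sum_list_map_concat list.map_comp comp_def)
  also have "\<dots> = (\<Sum>is\<leftarrow>multi_indices ms. \<Sum>i<a. \<Sum>j<b. ?w is * T (is @ [i, j]) * (x $ i * y $ j))"
    unfolding interv_sum_list_conv_sum_set_nat set_upt atLeast0LessThan
    by (intro arg_cong[of _ _ sum_list] map_cong refl sum.cong summand)
  also have "\<dots> = (\<Sum>i<a. \<Sum>j<b. (\<Sum>is\<leftarrow>multi_indices ms. ?w is * T (is @ [i, j])) * (x $ i * y $ j))"
  proof -
    have "(\<Sum>is\<leftarrow>L. \<Sum>i<a. \<Sum>j<b. ?w is * T (is @ [i, j]) * (x $ i * y $ j)) =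
        (\<Sum>i<a. \<Sum>j<b. (\<Sum>is\<leftarrow>L. ?w is * T (is @ [i, j])) * (x $ i * y $ j))" for L
      by (induction L) (simp_all add: sum.distrib distrib_right)
    then show ?thesis .
  qed
  finally show ?thesis .
qed

primrec best :: "('a \<Rightarrow> real) \<Rightarrow> 'a list \<Rightarrow> 'a option" where
  "best f [] = None"
| "best f (x # xs) = (case best f xs of None \<Rightarrow> Some x | Some y \<Rightarrow> if f y < f x then Some x else Some y)"

lemma best_maximal:
  "xs \<noteq> [] \<Longrightarrow> \<exists>y. best f xs = Some y \<and> y \<in> set xs \<and> (\<forall>x\<in>set xs. f x \<le> f y)"
proof (induction xs)
  case (Cons x xs)
  then show ?case by (cases "xs = []") (force split: option.splits)+
qed simp

locale solver_run =
  fixes \<sigma> :: "real mat \<Rightarrow> real vec \<times> real vec" and \<kappa> :: "nat \<Rightarrow> nat \<Rightarrow> nat"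
    and ms :: "nat list" and a b :: nat and T :: "nat list \<Rightarrow> real" and N K :: nat
  assumes solver: "matrix_solver \<sigma>" and large: "\<forall>n\<in>set (ms @ [a, b]). 2 \<le> n"
    and N: "N = prod_list (ms @ [a, b])" and cost: "1 + \<kappa> a b \<le> N ^ K"
begin

abbreviation "dims \<equiv> ms @ [a, b]"

lemma prod_list_ge: "\<forall>n\<in>set ns. 2 \<le> n \<Longrightarrow> 2 ^ length ns \<le> prod_list ns" for ns :: "nat list"
  by (induction ns) (auto intro: mult_mono)

lemma two_le_a: "2 \<le> a" and two_le_b: "2 \<le> b"
  using large by auto

text \<open>
  All dimensions are at least 1, so the product over a contiguous part of them is at most \<open>N\<close>.
\<close>
lemma prod_list_part:
  assumes "dims = us @ vs @ ws"
  shows "prod_list vs \<le> N"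
proof -
  have "\<forall>n\<in>set us. 2 \<le> n" "\<forall>n\<in>set ws. 2 \<le> n" using large unfolding assms by auto
  then have "1 \<le> prod_list us" "1 \<le> prod_list ws"
    using prod_list_ge[of us] prod_list_ge[of ws] one_le_power[of "2::nat"] by (meson le_trans one_le_numeral)+
  then have "1 * prod_list vs * 1 \<le> prod_list us * prod_list vs * prod_list ws" by (intro mult_le_mono) auto
  then show ?thesis unfolding N assms by (simp add: mult.assoc)
qed

sublocale machine \<sigma> \<kappa> N
proof
  show "2 \<le> N" using prod_list_part[of "ms @ [a]" "[b]" "[]"] two_le_b by simp
qed

lemma le_size_power: "x \<le> N \<Longrightarrow> x \<le> N ^ 58"
  using power_mono_exp[of 1 58] by simp

lemma dim_le_size: "n \<in> set dims \<Longrightarrow> n \<le> N"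
proof -
  assume "n \<in> set dims"
  then obtain us ws where "dims = us @ n # ws" by (meson split_list)
  then show ?thesis using prod_list_part[of us "[n]" ws] by simp
qed

text \<open>The number of modes is polynomial in \<open>N\<close>, in fact logarithmic, because \<open>2^d \<le> N\<close>.\<close>
lemma length_dims_le: "length dims \<le> N"
proof -
  have "length dims < 2 ^ length dims" by (rule less_exp)
  also have "\<dots> \<le> N" unfolding N by (rule prod_list_ge[OF large])
  finally show ?thesis by simp
qed

definition solve :: "real list list \<Rightarrow> real list list" where
  "solve zs = (case \<sigma> (contract dims T (map vec_of_list zs)) of (x, y) \<Rightarrow> zs @ [list_of_vec x, list_of_vec y])"

definition objective :: "real list list \<Rightarrow> real" where
  "objective zs = dot (map T (multi_indices dims)) (krons zs)"

definition result :: "real list list list \<Rightarrow> val" where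
  "result cs = (case best objective (map solve cs) of
     None \<Rightarrow> Leaf | Some w \<Rightarrow> Cell (Num (objective w)) (enc_list (map reals w)))"

definition blocks :: "real list list" where
  "blocks = map (\<lambda>is. map (\<lambda>js. T (is @ js)) (multi_indices [a, b])) (multi_indices ms)"

lemma concat_blocks: "map T (multi_indices dims) = concat blocks"
  by (simp add: blocks_def multi_indices_append map_concat comp_def)

lemma chop_blocks: "chop (a * b) (map T (multi_indices dims)) = blocks"
  unfolding concat_blocks using two_le_a two_le_b
  by (intro chop_concat) (auto simp: blocks_def length_multi_indices_pair)

lemma combine_blocks:
  assumes "map length zs = ms"
  shows "combine (a * b) (krons zs) blocks =
    map (\<lambda>js. \<Sum>is\<leftarrow>multi_indices ms. (\<Prod>k<length zs. zs ! k ! (is ! k)) * T (is @ js)) (multi_indices [a, b])"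
  unfolding krons_multi_indices assms blocks_def length_multi_indices_pair[symmetric] by (rule combine_map)

lemma enc_contract:
  assumes zs: "map length zs = ms"
  shows "enc_mat (contract dims T (map vec_of_list zs)) =
    enc_list (map reals (chop b (combine (a * b) (krons zs) blocks)))"
proof -
  let ?A = "contract dims T (map vec_of_list zs)"
  let ?g = "\<lambda>js. \<Sum>is\<leftarrow>multi_indices ms. (\<Prod>k<length zs. zs ! k ! (is ! k)) * T (is @ js)"
  have dim: "dim_row ?A = a" "dim_col ?A = b" by (simp_all add: contract_def Let_def nth_append)
  have entry: "?A $$ (i, j) = ?g [i, j]" if "i < a" "j < b" for i j
  proof -
    have "?A $$ (i, j) = tensor_form dims T (map vec_of_list zs @ [unit_vec a i, unit_vec b j])"
      using that by (simp add: contract_def Let_def nth_append)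
    also have "\<dots> = (\<Sum>i'<a. \<Sum>j'<b. if j' = j then (if i' = i then ?g [i', j'] else 0) else 0)"
      unfolding tensor_form_pair[OF zs] using that by (intro sum.cong refl) (auto simp: unit_vec_def)
    finally show ?thesis using that by simp
  qed
  have "chop b (map ?g (multi_indices [a, b])) = map (\<lambda>i. map (\<lambda>j. ?g [i, j]) [0..<b]) [0..<a]"
    unfolding multi_indices_pair map_concat list.map_comp comp_def
    by (rule chop_concat) (use two_le_b in auto)
  moreover have "rows ?A = map vec_of_list (map (\<lambda>i. map (\<lambda>j. ?g [i, j]) [0..<b]) [0..<a])"
    unfolding rows_def dim by (auto simp: dim entry vec_of_list_index intro!: eq_vecI)
  then have "map list_of_vec (rows ?A) = map (\<lambda>i. map (\<lambda>j. ?g [i, j]) [0..<b]) [0..<a]"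
    by (simp only: list.map_comp comp_def list_vec list.map_ident)
  moreover have "enc_mat ?A = enc_list (map reals (map list_of_vec (rows ?A)))"
    by (simp add: enc_mat_def enc_vec_def[abs_def] enc_reals_def comp_def)
  ultimately show ?thesis unfolding combine_blocks[OF zs] by simp
qed

lemma solver_dims:
  assumes "\<sigma> (contract dims T Z) = (x, y)"
  shows "x \<in> carrier_vec a" "y \<in> carrier_vec b"
proof -
  have dim: "dim_row (contract dims T Z) = a" "dim_col (contract dims T Z) = b"
    by (simp_all add: contract_def Let_def nth_append)
  then show "x \<in> carrier_vec a" "y \<in> carrier_vec b"
    using solver[unfolded matrix_solver_def, rule_format, of "contract dims T Z"] assms two_le_a two_le_b
    by (auto simp: sphere_def)
qed

lemma length_solve: "map length zs = ms \<Longrightarrow> map length (solve zs) = dims"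
proof -
  assume zs: "map length zs = ms"
  obtain x y where xy: "\<sigma> (contract dims T (map vec_of_list zs)) = (x, y)" by fastforce
  show ?thesis using zs solver_dims[OF xy] by (simp add: solve_def xy)
qed

text \<open>
  The list \<open>cs\<close> stands for the candidates.  The exponent \<open>K\<close> enters through the call of the matrix
  solver, which is made once per candidate.
\<close>
lemma run_Main_loop:
  assumes C: "run C \<rho> (enc_list (map (\<lambda>zs. enc_list (map reals zs)) cs)) j"
    and \<rho>: "\<rho> = Cell (enc_list (map reals blocks)) (Cell (Cell (Num (real b)) rd)
      (Cell ds (Cell (reals (map T (multi_indices dims))) rest)))"
    and cs: "\<And>zs. zs \<in> set cs \<Longrightarrow> map length zs = ms" and len: "length cs \<le> N ^ 58"
  shows "run (Main_loop C) \<rho> (result cs) (j + K + 10000)"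
  unfolding Main_loop_def
proof (rule run_cong, rule run_Foldr[where f = result, OF C _ _ len])
  show "run MkLeaf \<rho> (result []) 0" by (simp add: result_def run_MkLeaf)
next
  fix zs cs' us assume split: "cs = us @ zs # cs'"
  then have zs: "map length zs = ms" using cs by simp
  then have lzs: "length zs = length ms" by auto
  obtain x y where xy: "\<sigma> (contract dims T (map vec_of_list zs)) = (x, y)" by fastforce
  define full where "full = zs @ [list_of_vec x, list_of_vec y]"
  have solve: "solve zs = full" by (simp add: solve_def xy full_def)
  have full: "map length full = dims" using length_solve[OF zs] by (simp add: solve)
  let ?\<rho>1 = "Cell (enc_list (map reals zs)) (Cell (result cs') \<rho>)"
  have vec_len: "length z \<le> N" if "z \<in> set full" for z
  proof -
    have "length z \<in> set dims" unfolding full[symmetric] using that by simp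
    then show ?thesis by (rule dim_le_size)
  qed
  have krons_len: "length (krons vs) \<le> N" if "full = us @ vs @ ws" for us vs ws
    unfolding length_krons using that
    by (intro prod_list_part[of "map length us" "map length vs" "map length ws"]) (simp flip: full)
  have entries_len: "length (map T (multi_indices dims)) = N" by (simp only: N length_map length_multi_indices)
  have "run (Krons (Arg 0)) ?\<rho>1 (reals (krons zs)) (0 + 8 * 58 + 500)"
  proof (rule run_Krons[OF run_Arg_0])
    show "length zs \<le> N ^ 58" using lzs length_dims_le by (intro le_size_power) simp
    show "length z \<le> N ^ 58" if "z \<in> set zs" for z
      using that by (intro le_size_power vec_len) (simp add: full_def)
    show "length (krons vs) \<le> N ^ 58" if "zs = us @ vs" for us vs
      using that by (intro le_size_power krons_len[of us vs "[list_of_vec x, list_of_vec y]"]) (simp add: full_def)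
  qed
  note K1 = this
  have kb: "length (krons zs) = length blocks"
    by (simp add: length_krons blocks_def length_multi_indices zs)
  have "run (Combine (Krons (Arg 0)) (Arg 2)) ?\<rho>1 (reals (combine (a * b) (krons zs) blocks)) 3000"
  proof (rule run_cong, rule run_Combine[OF K1, where l = 58])
    show "run (Arg 2) ?\<rho>1 (enc_list (map reals blocks)) 4" unfolding \<rho> by (rule run_Arg_2)
    show "length (krons zs) \<le> N ^ 58"
      by (intro le_size_power krons_len[of "[]" zs "[list_of_vec x, list_of_vec y]"]) (simp add: full_def)
    have "2 ^ length ms \<le> prod_list ms" using large by (intro prod_list_ge) simp
    then have "0 < prod_list ms" by (rule less_le_trans[rotated]) simp
    then have "0 < length (krons zs)" by (simp add: length_krons zs)
    then show "blocks \<noteq> []" using kb by auto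
    show "\<forall>c\<in>set blocks. length c = a * b" by (auto simp: blocks_def length_multi_indices_pair)
    show "a * b \<le> N ^ 58" using prod_list_part[of ms "[a, b]" "[]"] by (intro le_size_power) simp
  qed (use kb in auto)
  note Comb = this
  have rowlen: "length (combine (a * b) (krons zs) blocks) \<le> N ^ 58"
  proof -
    have "length (combine (a * b) (krons zs) blocks) = a * b"
      by (rule length_combine) (auto simp: blocks_def length_multi_indices_pair)
    then show ?thesis using prod_list_part[of ms "[a, b]" "[]"] by (intro le_size_power) simp
  qed
  have "run (Seq (Arg 3) Head) ?\<rho>1 (Num (real b)) 8"
    unfolding \<rho> by (rule run_cong, rule run_Seq, rule run_Arg_3, rule run_Head) auto
  from run_Chop[OF this Comb rowlen]
  have "run (Chop (Seq (Arg 3) Head) (Combine (Krons (Arg 0)) (Arg 2))) ?\<rho>1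
      (enc_mat (contract dims T (map vec_of_list zs))) 4000"
    unfolding enc_contract[OF zs] by (rule run_weaken) simp
  moreover have "run MatSolve (enc_mat (contract dims T (map vec_of_list zs))) (Cell (enc_vec x) (enc_vec y)) K"
  proof -
    have dim: "dim_row (contract dims T (map vec_of_list zs)) = a" "dim_col (contract dims T (map vec_of_list zs)) = b"
      by (simp_all add: contract_def Let_def nth_append)
    have "exec \<sigma> \<kappa> MatSolve (enc_mat (contract dims T (map vec_of_list zs))) (Cell (enc_vec x) (enc_vec y)) (1 + \<kappa> a b)"
      using exec.MatSolve[of "contract dims T (map vec_of_list zs)" \<sigma> x y \<kappa>] two_le_a two_le_b xy by (simp add: dim)
    then show ?thesis unfolding run_def using cost by blast
  qed
  ultimately have Solve: "run (Seq (Chop (Seq (Arg 3) Head) (Combine (Krons (Arg 0)) (Arg 2))) MatSolve) ?\<rho>1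
      (Cell (enc_vec x) (enc_vec y)) (4000 + K + 2)"
    by (rule run_Seq)
  let ?\<rho>2 = "Cell (Cell (enc_vec x) (enc_vec y)) ?\<rho>1"
  have "run (Fork (Seq (Arg 0) Head) (Fork (Seq (Arg 0) Tail) MkLeaf)) ?\<rho>2 (enc_list [enc_vec x, enc_vec y]) 20"
    by (rule run_cong, (rule run_Fork run_Seq run_Arg_0 run_Head run_Tail run_MkLeaf)+) auto
  then have App: "run (Append (Arg 1) (Fork (Seq (Arg 0) Head) (Fork (Seq (Arg 0) Tail) MkLeaf))) ?\<rho>2
      (enc_list (map reals full)) 300"
    by - (rule run_cong, rule run_Append[where l = 58, OF run_Arg_1],
      use lzs length_dims_le in \<open>auto simp: full_def enc_vec_def enc_reals_def intro!: le_size_power\<close>)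
  let ?\<rho>3 = "Cell (enc_list (map reals full)) ?\<rho>2"
  have "run (Krons (Arg 0)) ?\<rho>3 (reals (krons full)) (0 + 8 * 58 + 500)"
  proof (rule run_Krons[OF run_Arg_0])
    have "length full = length dims" using full by (metis length_map)
    then show "length full \<le> N ^ 58" using length_dims_le by (intro le_size_power) simp
    show "length z \<le> N ^ 58" if "z \<in> set full" for z using that by (intro le_size_power vec_len)
    show "length (krons vs) \<le> N ^ 58" if "full = us @ vs" for us vs
      using that by (intro le_size_power krons_len[of us vs "[]"]) simp
  qed
  note K2 = this
  have "run (Seq Tail (Arg 6)) ?\<rho>3 (reals (map T (multi_indices dims))) 14"
    unfolding \<rho> by (rule run_cong, rule run_Seq, rule run_Tail, rule run_Arg_6) auto
  then have D: "run (Dot (Seq Tail (Arg 6)) (Krons (Arg 0))) ?\<rho>3 (Num (objective full)) 2000"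
    unfolding objective_def
    by (rule run_cong[OF run_Dot[OF _ K2, where l = 58]])
      (use entries_len le_size_power[OF le_refl] in \<open>auto simp: length_krons full N[symmetric] simp del: prod_list.append\<close>)
  let ?\<rho>4 = "Cell (Num (objective full)) ?\<rho>3"
  have out: "run (If_cell (Arg 4) (If_less (Seq (Arg 4) Head) (Arg 0) (Fork (Arg 0) (Arg 1)) (Arg 4)) (Fork (Arg 0) (Arg 1)))
      ?\<rho>4 (result (zs # cs')) 100"
  proof (cases "best objective (map solve cs')")
    case None
    then have res: "result cs' = Leaf" "result (zs # cs') = Cell (Num (objective full)) (enc_list (map reals full))"
      by (simp_all add: result_def solve)
    show ?thesis unfolding res
      by (rule run_cong, rule run_If_cell, rule run_Arg_4, simp, (rule run_Fork run_Arg_0 run_Arg_1)+) auto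
  next
    case (Some w)
    then have res: "result cs' = Cell (Num (objective w)) (enc_list (map reals w))"
      "result (zs # cs') = (if objective w < objective full then Cell (Num (objective full)) (enc_list (map reals full))
         else Cell (Num (objective w)) (enc_list (map reals w)))"
      by (simp_all add: result_def solve)
    show ?thesis unfolding res
      by (rule run_cong, rule run_If_cell, rule run_Arg_4, rule run_If_less,
          (rule run_Seq run_Fork run_Arg_4 run_Head run_Arg_0 run_Arg_1)+) auto
  qed
  show "run (Bind (Seq (Chop (Seq (Arg 3) Head) (Combine (Krons (Arg 0)) (Arg 2))) MatSolve)
     (Bind (Append (Arg 1) (Fork (Seq (Arg 0) Head) (Fork (Seq (Arg 0) Tail) MkLeaf)))
     (Bind (Dot (Seq Tail (Arg 6)) (Krons (Arg 0)))
       (If_cell (Arg 4)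
          (If_less (Seq (Arg 4) Head) (Arg 0) (Fork (Arg 0) (Arg 1)) (Arg 4))
          (Fork (Arg 0) (Arg 1)))))) ?\<rho>1 (result (zs # cs')) (K + 9000)"
    by (rule run_cong, rule run_Bind[OF Solve], rule run_Bind[OF App], rule run_Bind[OF D out]) auto
qed auto

lemma length_candidate_list:
  assumes "\<forall>n\<in>set ns. 2 \<le> n"
  shows "length (candidate_list ns) \<le> prod_list ns ^ 58"
  using assms
proof (induction ns)
  case Nil
  show ?case by (simp add: candidate_list_def)
next
  case (Cons n ns)
  have "length (concat (map (\<lambda>z. map (Cons z) cs) hs)) = length hs * length cs" for cs :: "real list list list" and hs
    by (induction hs) auto
  then have "length (candidate_list (n # ns)) = length (h5_list \<alpha>0 \<beta>0 n) * length (candidate_list ns)"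
    by (simp add: candidate_list_def)
  also have "\<dots> \<le> n ^ 58 * prod_list ns ^ 58"
    using Cons sqrt5_bounds by (intro mult_le_mono chosen.length_h5_list) auto
  finally show ?case by (simp add: power_mult_distrib)
qed

lemma candidate_list_mem:
  "zs \<in> set (candidate_list ms) \<longleftrightarrow> length zs = length ms \<and> (\<forall>k<length ms. zs ! k \<in> set (h5_list \<alpha>0 \<beta>0 (ms ! k)))"
  by (auto simp: candidate_list_def product_lists_set list_all2_conv_all_nth)

lemma length_h5_list_mem: "2 \<le> n \<Longrightarrow> z \<in> set (h5_list \<alpha>0 \<beta>0 n) \<Longrightarrow> length z = n"
proof -
  assume n: "2 \<le> n" and z: "z \<in> set (h5_list \<alpha>0 \<beta>0 n)"
  have "vec_of_list z \<in> H5 \<alpha>0 \<beta>0 n" unfolding chosen.H5_h5_list[OF n] using z by (rule imageI)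
  then have "vec_of_list z \<in> sphere n" using chosen.H5_subset_sphere[OF n] by (rule rev_subsetD)
  then have "vec_of_list z \<in> carrier_vec n" by (simp only: sphere_def mem_Collect_eq)
  then have "dim_vec (vec_of_list z) = n" by (rule carrier_vecD)
  then show ?thesis by simp
qed

lemma candidate_list_lengths:
  assumes "zs \<in> set (candidate_list ms)"
  shows "map length zs = ms"
proof (rule nth_equalityI)
  show "length (map length zs) = length ms" using assms by (simp add: candidate_list_mem)
  fix k assume "k < length (map length zs)"
  then have k: "k < length ms" "k < length zs" using assms by (simp_all add: candidate_list_mem)
  then have "2 \<le> ms ! k" using large by simp
  then show "map length zs ! k = ms ! k" using k assms length_h5_list_mem by (simp add: candidate_list_mem)
qed

lemma run_Algorithm_A:
  "run Algorithm_A (enc_tensor dims T) (result (candidate_list ms)) (K + 100000)"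
proof -
  let ?ds = "enc_list (map (\<lambda>n. Num (real n)) dims)"
  let ?es = "reals (map T (multi_indices dims))"
  have input: "enc_tensor dims T = Cell ?ds ?es"
    by (simp add: enc_tensor_def enc_reals_def comp_def)
  let ?\<rho>0 = "Cell ?ds (Cell ?es Leaf)"
  let ?\<rho>1 = "Cell (enc_list (rev (map (\<lambda>n. Num (real n)) dims))) ?\<rho>0"
  have rd: "enc_list (rev (map (\<lambda>n. Num (real n)) dims)) =
      Cell (Num (real b)) (Cell (Num (real a)) (enc_list (rev (map (\<lambda>n. Num (real n)) ms))))"
    by simp
  have Rev: "run (Rev (Arg 0)) ?\<rho>0 (enc_list (rev (map (\<lambda>n. Num (real n)) dims))) (0 + 1 + 50)"
    by (rule run_Rev[OF run_Arg_0]) (use length_dims_le in simp)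
  have ab: "run (Op Times (Seq (Arg 0) Head) (Seq (Arg 0) (Seq Tail Head))) ?\<rho>1 (Num (real (a * b))) 30"
    unfolding rd by (rule run_cong, (rule run_arith run_Seq run_Arg_0 run_Head run_Tail)+) auto
  have Blocks: "run (Chop (Op Times (Seq (Arg 0) Head) (Seq (Arg 0) (Seq Tail Head))) (Arg 2)) ?\<rho>1
      (enc_list (map reals blocks)) 1000"
  proof -
    have len: "length (map T (multi_indices dims)) \<le> N ^ 58"
      by (simp only: length_map length_multi_indices N[symmetric] le_size_power[OF le_refl])
    show ?thesis by (rule run_cong[OF run_Chop[OF ab run_Arg_2 len]]) (simp only: chop_blocks, simp)
  qed
  let ?\<rho>2 = "Cell (enc_list (map reals blocks)) ?\<rho>1"
  have "run (Seq (Arg 1) (Seq Tail Tail)) ?\<rho>2 (enc_list (rev (map (\<lambda>n. Num (real n)) ms))) 20"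
    unfolding rd by (rule run_cong, (rule run_Seq run_Arg_1 run_Tail)+) auto
  from run_Rev[OF this, of 1]
  have M: "run (Rev (Seq (Arg 1) (Seq Tail Tail))) ?\<rho>2 (enc_list (map (\<lambda>n. Num (real n)) ms)) (20 + 1 + 50)"
    using length_dims_le by simp
  have ms2: "2 \<le> n" "n \<le> N" if "n \<in> set ms" for n using that large dim_le_size[of n] by auto
  have "run (Candidate_list (Rev (Seq (Arg 1) (Seq Tail Tail)))) ?\<rho>2
      (enc_list (map (\<lambda>zs. enc_list (map reals zs)) (candidate_list ms))) (20 + 1 + 50 + 80 * 58 + 11000)"
  proof (rule run_Candidate_list[OF M])
    show "length ms \<le> N ^ 58" using length_dims_le by (intro le_size_power) simp
    show "n \<le> N ^ 58 \<and> 0 < n \<and> 0 < block_size n \<and> block_size n \<le> N ^ 58" if "n \<in> set ms" for n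
      using ms2[OF that] block_size_bounds[of n] by (auto intro!: le_size_power)
    show "length (z_list \<alpha>0 \<beta>0 s i) \<le> N ^ 58" if "n \<in> set ms" "s \<le> block_size n" "i \<le> s" for n s i
    proof -
      have "length (z_list \<alpha>0 \<beta>0 s i) \<le> n ^ 57"
        using ms2[OF that(1)] that sqrt5_bounds by (intro chosen.length_z_list_le_power) auto
      also have "\<dots> \<le> N ^ 57" using ms2[OF that(1)] by (intro power_mono) auto
      also have "\<dots> \<le> N ^ 58" by (rule power_mono_exp) simp
      finally show ?thesis .
    qed
    show "length (h5_list \<alpha>0 \<beta>0 n) \<le> N ^ 58" if "n \<in> set ms" for n
    proof -
      have "length (h5_list \<alpha>0 \<beta>0 n) \<le> n ^ 58"
        using ms2[OF that(1)] sqrt5_bounds by (intro chosen.length_h5_list) auto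
      also have "\<dots> \<le> N ^ 58" using ms2[OF that(1)] by (intro power_mono) auto
      finally show ?thesis .
    qed
    show "0 < dot z z" if "0 < s" "z \<in> set (z_list \<alpha>0 \<beta>0 s s)" for s z using that by (rule chosen.dot_self_pos)
    show "length (candidate_list vs) \<le> N ^ 58" if "ms = us @ vs" for us vs
    proof -
      have "length (candidate_list vs) \<le> prod_list vs ^ 58" using large that by (intro length_candidate_list) auto
      also have "\<dots> \<le> N ^ 58" using that by (intro power_mono prod_list_part[of us vs "[a, b]"]) auto
      finally show ?thesis .
    qed
  qed
  moreover have "length (candidate_list ms) \<le> N ^ 58"
  proof -
    have "length (candidate_list ms) \<le> prod_list ms ^ 58" using large by (intro length_candidate_list) auto
    also have "\<dots> \<le> N ^ 58" by (intro power_mono prod_list_part[of "[]" ms "[a, b]"]) auto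
    finally show ?thesis .
  qed
  ultimately have Main: "run (Main_loop (Candidate_list (Rev (Seq (Arg 1) (Seq Tail Tail))))) ?\<rho>2
      (result (candidate_list ms)) ((20 + 1 + 50 + 80 * 58 + 11000) + K + 10000)"
    using candidate_list_lengths unfolding rd by (intro run_Main_loop[OF _ refl])
  show ?thesis unfolding Algorithm_A_def input
    by (rule run_cong, rule run_Seq, (rule run_Fork run_Head run_Tail run_MkLeaf)+,
        rule run_Bind[OF Rev], rule run_Bind[OF Blocks Main]) auto
qed

text \<open>
  Links the maximum found by the program to the candidates of the algorithm; a vector is determined
  by the list of its entries.
\<close>
lemma candidates_eq: "candidates \<sigma> dims T = (\<lambda>zs. map vec_of_list (solve zs)) ` set (candidate_list ms)"
proof -
  have H5: "H5 \<alpha>0 \<beta>0 (ms ! k) = vec_of_list ` set (h5_list \<alpha>0 \<beta>0 (ms ! k))" if "k < length ms" for k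
    using that large by (intro chosen.H5_h5_list) auto
  have mem: "map vec_of_list (solve zs) = map vec_of_list zs @ [x, y]"
    if "\<sigma> (contract dims T (map vec_of_list zs)) = (x, y)" for zs x y
    using that by (simp add: solve_def vec_list)
  have cand: "candidates \<sigma> dims T = {zs @ [x, y] | zs x y. length zs = length ms \<and>
      (\<forall>k<length ms. zs ! k \<in> H5 \<alpha>0 \<beta>0 (ms ! k)) \<and> \<sigma> (contract dims T zs) = (x, y)}"
    unfolding candidates_def by (auto simp: nth_append)
  show ?thesis
  proof (intro equalityI subsetI)
    fix ws assume "ws \<in> candidates \<sigma> dims T"
    then obtain Z x y where ws: "ws = Z @ [x, y]" "length Z = length ms"
        "\<forall>k<length ms. Z ! k \<in> H5 \<alpha>0 \<beta>0 (ms ! k)" "\<sigma> (contract dims T Z) = (x, y)"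
      unfolding cand by blast
    have Z: "map vec_of_list (map list_of_vec Z) = Z" by (simp add: vec_list comp_def)
    have "list_of_vec (Z ! k) \<in> set (h5_list \<alpha>0 \<beta>0 (ms ! k))" if "k < length ms" for k
    proof -
      have "Z ! k \<in> vec_of_list ` set (h5_list \<alpha>0 \<beta>0 (ms ! k))"
        unfolding H5[OF that, symmetric] using ws(3) that by blast
      then obtain l where "l \<in> set (h5_list \<alpha>0 \<beta>0 (ms ! k))" "Z ! k = vec_of_list l" by (elim imageE)
      then show ?thesis by (simp add: list_vec)
    qed
    then have "map list_of_vec Z \<in> set (candidate_list ms)" using ws(2) by (simp add: candidate_list_mem)
    moreover have "ws = map vec_of_list (solve (map list_of_vec Z))"
      using mem[of "map list_of_vec Z" x y] ws(1,4) unfolding Z by simp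
    ultimately show "ws \<in> (\<lambda>zs. map vec_of_list (solve zs)) ` set (candidate_list ms)" by blast
  next
    fix ws assume "ws \<in> (\<lambda>zs. map vec_of_list (solve zs)) ` set (candidate_list ms)"
    then obtain zs where zs: "zs \<in> set (candidate_list ms)" "ws = map vec_of_list (solve zs)" by blast
    obtain x y where xy: "\<sigma> (contract dims T (map vec_of_list zs)) = (x, y)" by fastforce
    have "length (map vec_of_list zs) = length ms" using zs(1) by (simp add: candidate_list_mem)
    moreover have "\<forall>k<length ms. map vec_of_list zs ! k \<in> H5 \<alpha>0 \<beta>0 (ms ! k)"
      using zs(1) H5 by (simp add: candidate_list_mem)
    ultimately show "ws \<in> candidates \<sigma> dims T" unfolding cand zs(2) mem[OF xy] using xy by blast
  qed
qed

lemma candidate_list_nonempty: "candidate_list ms \<noteq> []"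
proof -
  have "h5_list \<alpha>0 \<beta>0 (ms ! k) \<noteq> []" if "k < length ms" for k
  proof -
    have n: "2 \<le> ms ! k" using large that by simp
    obtain h where "h \<in> H5 \<alpha>0 \<beta>0 (ms ! k)"
      using chosen.H5_hits[OF n zero_carrier_vec parameters_balance] by blast
    then show ?thesis unfolding chosen.H5_h5_list[OF n] by auto
  qed
  then have "\<forall>k<length ms. hd (h5_list \<alpha>0 \<beta>0 (ms ! k)) \<in> set (h5_list \<alpha>0 \<beta>0 (ms ! k))" by simp
  then have "map (\<lambda>n. hd (h5_list \<alpha>0 \<beta>0 n)) ms \<in> set (candidate_list ms)" by (simp add: candidate_list_mem)
  then show ?thesis by auto
qed

lemma Algorithm_A_correct:
  "\<exists>v zs t. exec \<sigma> \<kappa> Algorithm_A (enc_tensor dims T) (enc_output v zs) t \<and>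
     t \<le> N ^ (K + 100000) \<and> algA_output \<sigma> dims T v zs"
proof -
  have "map solve (candidate_list ms) \<noteq> []" using candidate_list_nonempty by simp
  from best_maximal[OF this, of objective]
  obtain w where w: "best objective (map solve (candidate_list ms)) = Some w"
      "w \<in> set (map solve (candidate_list ms))"
      "\<forall>x\<in>set (map solve (candidate_list ms)). objective x \<le> objective w"
    by blast
  have obj: "tensor_form dims T (map vec_of_list (solve zs)) = objective (solve zs)"
    if "zs \<in> set (candidate_list ms)" for zs
    unfolding objective_def
    by (rule tensor_form_dot[OF length_solve[OF candidate_list_lengths[OF that]]])
  have "result (candidate_list ms) = enc_output (objective w) (map vec_of_list w)"
    by (simp add: result_def w(1) enc_output_def enc_vec_def enc_reals_def list_vec comp_def)
  moreover have "algA_output \<sigma> dims T (objective w) (map vec_of_list w)"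
    using w(2,3) obj unfolding algA_output_def candidates_eq by auto
  ultimately show ?thesis using run_Algorithm_A unfolding run_def by auto
qed

end

text \<open>
  The cost \<open>c (a b)^e\<close> of the solver is at most \<open>N^(c + 1 + e)\<close>, since \<open>a b \<le> N\<close> and
  \<open>c + 1 \<le> 2^(c + 1) \<le> N^(c + 1)\<close>.
\<close>
lemma Algorithm_A_polytime:
  assumes \<sigma>: "matrix_solver \<sigma>" and \<kappa>: "poly_cost \<kappa>"
  shows "polytime_implements_algA \<sigma> \<kappa> Algorithm_A"
proof -
  obtain c e where ce: "\<kappa> a b \<le> c * (a * b) ^ e" if "0 < a" "0 < b" for a b
    using \<kappa> unfolding poly_cost_def by blast
  define K where "K = c + 1 + e"
  have "\<exists>v zs t. exec \<sigma> \<kappa> Algorithm_A (enc_tensor ns T) (enc_output v zs) t \<and>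
           t \<le> 1 * prod_list ns ^ (K + 100000) \<and> algA_output \<sigma> ns T v zs"
    if ns: "3 \<le> length ns" "\<forall>n\<in>set ns. 2 \<le> n" for ns T
  proof -
    define ms a b where "ms = butlast (butlast ns)" and "a = last (butlast ns)" and "b = last ns"
    have "ns \<noteq> []" using ns(1) by (cases ns) auto
    then have last: "butlast ns @ [b] = ns" unfolding b_def by (rule append_butlast_last_id)
    have "butlast ns \<noteq> []" using ns(1) by (cases ns rule: rev_cases) auto
    then have "ms @ [a] = butlast ns" unfolding ms_def a_def by (rule append_butlast_last_id)
    with last have "(ms @ [a]) @ [b] = ns" by (simp only:)
    then have split: "ns = ms @ [a, b]" by simp
    have a: "2 \<le> a" and b: "2 \<le> b" using ns(2) unfolding split by auto
    have pos: "1 \<le> prod_list ms"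
      using ns(2) unfolding split by (induction ms) (auto simp: Suc_le_eq)
    have ab: "a * b \<le> prod_list ns" using pos unfolding split by simp
    have two: "2 \<le> prod_list ns" using ab a b mult_le_mono[of 1 a 2 b] by simp
    have "1 + \<kappa> a b \<le> 1 + c * (a * b) ^ e" using ce[of a b] a b by simp
    also have "\<dots> \<le> (c + 1) * (a * b) ^ e" using a b by simp
    also have "\<dots> \<le> prod_list ns ^ (c + 1) * prod_list ns ^ e"
    proof (intro mult_le_mono power_mono ab)
      have "c + 1 \<le> 2 ^ (c + 1)" using less_exp[of "c + 1"] by simp
      also have "\<dots> \<le> prod_list ns ^ (c + 1)" using two by (intro power_mono) auto
      finally show "c + 1 \<le> prod_list ns ^ (c + 1)" .
    qed auto
    finally have "1 + \<kappa> a b \<le> prod_list ns ^ K" by (simp add: K_def power_add)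
    then interpret solver_run \<sigma> \<kappa> ms a b T "prod_list ns" K
      using \<sigma> ns(2) unfolding split by unfold_locales simp_all
    show ?thesis using Algorithm_A_correct unfolding split[symmetric] by simp
  qed
  then show ?thesis unfolding polytime_implements_algA_def by blast
qed

theorem theorem3p4:
  "(\<exists>P. \<forall>\<sigma> \<kappa>. matrix_solver \<sigma> \<and> poly_cost \<kappa> \<longrightarrow> polytime_implements_algA \<sigma> \<kappa> P) \<and>
   (\<forall>\<sigma> ns T v zs. matrix_solver \<sigma> \<and>
      3 \<le> length ns \<and> sorted ns \<and> (\<forall>n\<in>set ns. 2 \<le> n) \<and>
      algA_output \<sigma> ns T v zs \<longrightarrow>
        length zs = length ns \<and>
        (\<forall>k<length ns - 2. zs ! k \<in> H5 (2 + sqrt 5) (3 + sqrt 5) (ns ! k)) \<and>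
        (\<forall>k\<in>{length ns - 2..<length ns}. zs ! k \<in> sphere (ns ! k)) \<and>
        v = tensor_form ns T zs \<and>
        approximates
          ((3 / 10) ^ (length ns - 2) *
             sqrt (\<Prod>k<length ns - 2. ln (real (ns ! k)) / real (ns ! k)))
          (spectral_norm ns T) v)"
proof (rule conjI)
  show "\<exists>P. \<forall>\<sigma> \<kappa>. matrix_solver \<sigma> \<and> poly_cost \<kappa> \<longrightarrow> polytime_implements_algA \<sigma> \<kappa> P"
    using Algorithm_A_polytime by blast
qed (intro allI impI, elim conjE, (intro conjI; (rule algA_output_approximates; assumption)))

end
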